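(* Let $f,g:\mathbb{R}^n\to\mathbb{R}^n$ be smooth ($C^\infty$) vector fields with $f(0)=0$, and consider the single-input control-affine system $\dot x=f(x)+u\,g(x)$, $(x,u)\in\mathbb{R}^n\times\mathbb{R}$. Assume that there exists a smooth, positive definite and proper function $V:\mathbb{R}^n\to\mathbb{R}^+$ such that for every $x\neq 0$ at least one of the following three alternatives holds: (i) $(gV)(x)\neq 0$; (ii) $(gV)(x)=0$ and $(fV)(x)<0$; (iii) there exists an integer $N=N(x)\ge 1$ such that $$(gV)(x)=0,\qquad (f^{i}V)(x)=0,\quad i=1,2,\ldots,N,$$ and $$(\Delta_1\Delta_2\cdots\Delta_k V)(x)=0\quad\text{for all }k\geq 1 \text{ and all }\Delta_1,\ldots,\Delta_k\in Lie\{f,g\}\setminus\{g\}\text{ with }\sum_{p=1}^k order_{\{f,g\}}\Delta_p\le N,$$ and such that one of the following properties holds: (P1) $(f^{N+1}V)(x)<0$; (P2) $N$ is odd and $([[\ldots[[f,\underbrace{g],g],\ldots,g],g]}_{N}V)(x)\neq 0$; (P3) $N$ is even and $([[\ldots[[f,\underbrace{g],g],\ldots,g],g]}_{N}V)(x)<0$; (P4) $N$ is an arbitrary positive integer with $(f^{N+1}V)(x)=0$ and $([[\ldots[[g,\underbrace{f],f],\ldots,f],f]}_{N}V)(x)\neq 0$. Then the system $\dot x=f(x)+u\,g(x)$ is SDF-SGAS and therefore SDF-WGAS.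
   Context: Notation. $\mathbb{R}^+=[0,\infty)$; $|x|$ is the Euclidean norm; $B[0,R]=\{x\in\mathbb{R}^n:|x|\le R\}$. For $C^1$ maps $X:\mathbb{R}^n\to\mathbb{R}^k$, $Y:\mathbb{R}^k\to\mathbb{R}^\ell$, $XY:=(DY)X$, where $DY$ is the derivative of $Y$; in particular, for a vector field $X$ and a scalar function $V$, $(XV)(x)=DV(x)X(x)$. The Lie bracket of vector fields is $[X,Y]=XY-YX$. Products act successively: $\Delta_1\Delta_2\cdots\Delta_kV=\Delta_1(\Delta_2(\cdots(\Delta_kV)))$; $f^1V:=fV$ and $f^iV:=f(f^{i-1}V)$ for $i\ge 2$. The expression $[[\ldots[[f,\underbrace{g],g],\ldots,g],g]}_{N}$ denotes the iterated bracket obtained from $f$ by bracketing on the right $N$ times with $g$ (for $N=1$ it is $[f,g]$); likewise with the roles of $f$ and $g$ exchanged. $Lie\{f,g\}$ is the Lie algebra generated by $\{f,g\}$. Put $L_1:=span\{f,g\}$ and $L_{i+1}:=span\{[X,Y]:X\in L_i,\,Y\in L_1\}$, $i=1,2,\ldots$. For nonzero $\Delta\in Lie\{f,g\}$: $order_{\{f,g\}}\Delta:=1$ if $\Delta\in L_1\setminus\{0\}$; $order_{\{f,g\}}\Delta:=k>1$ if $\Delta=\Delta_1+\Delta_2$ with $\Delta_1\in L_k\setminus\{0\}$ and $\Delta_2\in span\{\cup_{i=1}^{k-1}L_i\}$. A function $V:\mathbb{R}^n\to\mathbb{R}^+$ is positive definite if $V(0)=0$ and $V(x)>0$ for $x\ne0$,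 and proper if preimages of compact sets are compact. Definition (SDF-SGAS). A system $\dot x=F(x,u)$, $(x,u)\in\mathbb{R}^n\times\mathbb{R}^m$, $F(0,0)=0$, is Semi-Globally Asymptotically Stabilizable by Sampled-Data Feedback (SDF-SGAS) if for every $R>0$ and for any given partition of times $T_1:=0<T_2<T_3<\cdots<T_\nu<\cdots$ with $T_\nu\to\infty$ there exist a neighborhood $\Pi$ of zero with $B[0,R]\subset\Pi$ and a map $k:\mathbb{R}^+\times\Pi\to\mathbb{R}^m$ such that for any $x\in\Pi$ the map $k(\cdot,x):\mathbb{R}^+\to\mathbb{R}^m$ is measurable and locally essentially bounded, and the trajectory $x(\cdot)$ of the sampled-data closed-loop system $\dot x=F(x,k(t,x(T_i)))$, $t\in[T_i,T_{i+1})$, $i=1,2,\ldots$, $x(0)\in\Pi$, satisfies: Stability: for every $\varepsilon>0$ there is $\delta=\delta(\varepsilon)>0$ such that $x(0)\in\Pi$, $|x(0)|\le\delta$ imply $|x(t)|\le\varepsilon$ for all $t\ge0$; Attractivity: $\lim_{t\to\infty}x(t)=0$ for all $x(0)\in\Pi$. Definition (SDF-WGAS). The system $\dot x=F(x,u)$ is Weakly Globally Asymptotically Stabilizable by Sampled-Data Feedback (SDF-WGAS) if for any constant $\tau>0$ there exist mappings $T:\mathbb{R}^n\setminus\{0\}\to\mathbb{R}^+\setminus\{0\}$ with $T(x)\le\tau$ for all $x\in\mathbb{R}^n\setminus\{0\}$, and $k(t,x;x_0):\mathbb{R}^+\times\mathbb{R}^n\times\mathbb{R}^n\to\mathbb{R}^m$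 such that for any fixed $(x,x_0)$ the map $k(\cdot,x;x_0)$ is measurable and locally essentially bounded, and such that for every $x_0\neq0$ there exists a sequence of times $t_1:=0<t_2<t_3<\cdots$ with $t_\nu\to\infty$ in such a way that the trajectory $x(\cdot)$ of the sampled-data closed-loop system $\dot x=F(x,k(t,x(t_i);x_0))$, $t\in[t_i,t_{i+1})$, $i=1,2,\ldots$, $x(0)=x_0$, satisfies $t_{i+1}-t_i=T(x(t_i))$, $i=1,2,\ldots$, together with: Stability: for every $\varepsilon>0$ there is $\delta=\delta(\varepsilon)>0$ such that $|x(0)|\le\delta$ implies $|x(t)|\le\varepsilon$ for all $t\ge0$; Attractivity: $\lim_{t\to\infty}x(t)=0$ for all $x(0)\in\mathbb{R}^n$. *)

theory Defs
  imports "HOL-Analysis.Analysis" "HOL-Library.Function_Algebras"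
begin

text \<open>The pointwise vector space structure on functions, so that \<^const>\<open>span\<close>,
  \<^const>\<open>subspace\<close> and linear combinations of vector fields are the library notions.\<close>

instantiation "fun" :: (type, real_vector) real_vector
begin

definition scaleR_fun :: "real \<Rightarrow> ('a \<Rightarrow> 'b) \<Rightarrow> 'a \<Rightarrow> 'b"
  where "scaleR_fun c X = (\<lambda>x. c *\<^sub>R X x)"

instance
  by standard (simp_all add: scaleR_fun_def fun_eq_iff algebra_simps)

end


subsection \<open>Smooth maps and Lie derivatives\<close>

text \<open>Between Euclidean spaces, a map is of class \<open>C^(k+1)\<close> iff it is differentiable and all its
  directional derivatives are of class \<open>C^k\<close>.\<close>

primrec Ck :: "nat \<Rightarrow> ('a::euclidean_space \<Rightarrow> 'b::euclidean_space) \<Rightarrow> bool"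
  where
    "Ck 0 F \<longleftrightarrow> continuous_on UNIV F"
  | "Ck (Suc k) F \<longleftrightarrow>
      F differentiable_on UNIV \<and> (\<forall>v. Ck k (\<lambda>x. frechet_derivative F (at x) v))"

definition smooth :: "('a::euclidean_space \<Rightarrow> 'b::euclidean_space) \<Rightarrow> bool"
  where "smooth F \<longleftrightarrow> (\<forall>k. Ck k F)"

definition lie_derivative ::
    "('a::euclidean_space \<Rightarrow> 'a) \<Rightarrow> ('a \<Rightarrow> 'b::euclidean_space) \<Rightarrow> 'a \<Rightarrow> 'b"
  where "lie_derivative X Y = (\<lambda>x. frechet_derivative Y (at x) (X x))"

definition lie_bracket ::
    "('a::euclidean_space \<Rightarrow> 'a) \<Rightarrow> ('a \<Rightarrow> 'a) \<Rightarrow> 'a \<Rightarrow> 'a"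
  where "lie_bracket X Y = (\<lambda>x. lie_derivative X Y x - lie_derivative Y X x)"

definition iterated_bracket ::
    "nat \<Rightarrow> ('a::euclidean_space \<Rightarrow> 'a) \<Rightarrow> ('a \<Rightarrow> 'a) \<Rightarrow> 'a \<Rightarrow> 'a"
  where "iterated_bracket N X Y = ((\<lambda>Z. lie_bracket Z Y) ^^ N) X"


subsection \<open>The Lie algebra generated by two vector fields, and the order of its elements\<close>

definition lie_algebra ::
    "('a::euclidean_space \<Rightarrow> 'a) \<Rightarrow> ('a \<Rightarrow> 'a) \<Rightarrow> ('a \<Rightarrow> 'a) set"
  where "lie_algebra f g =
    (\<lambda>A. subspace A \<and> (\<forall>X\<in>A. \<forall>Y\<in>A. lie_bracket X Y \<in> A)) hull {f, g}"

text \<open>The layers \<open>L\<^sub>i\<close> are indexed from 1; index 0 carries no information.\<close>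

fun lie_layer ::
    "('a::euclidean_space \<Rightarrow> 'a) \<Rightarrow> ('a \<Rightarrow> 'a) \<Rightarrow> nat \<Rightarrow> ('a \<Rightarrow> 'a) set"
  where
    "lie_layer f g 0 = {0}"
  | "lie_layer f g (Suc 0) = span {f, g}"
  | "lie_layer f g (Suc (Suc i)) =
      span {lie_bracket X Y |X Y. X \<in> lie_layer f g (Suc i) \<and> Y \<in> lie_layer f g (Suc 0)}"

definition has_lie_order ::
    "('a::euclidean_space \<Rightarrow> 'a) \<Rightarrow> ('a \<Rightarrow> 'a) \<Rightarrow> ('a \<Rightarrow> 'a) \<Rightarrow> nat \<Rightarrow> bool"
  where "has_lie_order f g \<Delta> k \<longleftrightarrow>
    (k = 1 \<and> \<Delta> \<in> lie_layer f g 1 - {0}) \<or>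
    (k > 1 \<and> (\<exists>\<Delta>\<^sub>1 \<Delta>\<^sub>2. \<Delta> = \<Delta>\<^sub>1 + \<Delta>\<^sub>2 \<and> \<Delta>\<^sub>1 \<in> lie_layer f g k - {0} \<and>
      \<Delta>\<^sub>2 \<in> span (\<Union>i\<in>{1..k-1}. lie_layer f g i)))"

text \<open>Several \<open>k\<close> may be admissible for the same vector field when \<open>f\<close> and \<open>g\<close> satisfy relations
  (the layers need not be independent); the order is the least one.  It is meaningful only for
  nonzero elements of the generated Lie algebra, each of which has an admissible \<open>k\<close>.\<close>

definition lie_order ::
    "('a::euclidean_space \<Rightarrow> 'a) \<Rightarrow> ('a \<Rightarrow> 'a) \<Rightarrow> ('a \<Rightarrow> 'a) \<Rightarrow> nat"
  where "lie_order f g \<Delta> = (LEAST k. has_lie_order f g \<Delta> k)"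


subsection \<open>Positive definite and proper functions\<close>

definition positive_definite :: "('a::euclidean_space \<Rightarrow> real) \<Rightarrow> bool"
  where "positive_definite V \<longleftrightarrow> V 0 = 0 \<and> (\<forall>x. x \<noteq> 0 \<longrightarrow> V x > 0)"

text \<open>Properness of \<open>V\<close> as a map into \<open>[0,\<infinity>)\<close>.\<close>

definition proper_function :: "('a::euclidean_space \<Rightarrow> real) \<Rightarrow> bool"
  where "proper_function V \<longleftrightarrow> (\<forall>K\<subseteq>{0..}. compact K \<longrightarrow> compact (V -` K))"


subsection \<open>Sampled-data feedback\<close>

definition admissible_input :: "(real \<Rightarrow> 'u::euclidean_space) \<Rightarrow> bool"
  where "admissible_input u \<longleftrightarrow>
    u \<in> borel_measurable (lebesgue_on {0..}) \<and>
    (\<forall>b\<ge>0. \<exists>M. AE t in lebesgue_on {0..b}. norm (u t) \<le> M)"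

definition sampling_times :: "(nat \<Rightarrow> real) \<Rightarrow> bool"
  where "sampling_times T \<longleftrightarrow> T 0 = 0 \<and> strict_mono T \<and> filterlim T at_top sequentially"

text \<open>Caratheodory solutions, defined on all of \<open>[0,\<infinity>)\<close>, of
  \<open>x' = F (x, k (t, x (T i)))\<close> on \<open>[T i, T (i+1))\<close>, written in integrated form.\<close>

definition sampled_trajectory ::
    "('a::euclidean_space \<Rightarrow> 'u::euclidean_space \<Rightarrow> 'a) \<Rightarrow> (real \<Rightarrow> 'a \<Rightarrow> 'u) \<Rightarrow>
      (nat \<Rightarrow> real) \<Rightarrow> (real \<Rightarrow> 'a) \<Rightarrow> bool"
  where "sampled_trajectory F k T x \<longleftrightarrow>
    (\<forall>i. \<forall>t\<in>{T i..T (Suc i)}.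
      (\<lambda>s. F (x s) (k s (x (T i)))) absolutely_integrable_on {T i..t} \<and>
      x t = x (T i) + integral {T i..t} (\<lambda>s. F (x s) (k s (x (T i)))))"

text \<open>The feedback is only given on the region \<open>D\<close>, so a closed-loop trajectory has to be in \<open>D\<close> at
  every sampling time.  ``The trajectory satisfies P'' is rendered as: a trajectory on
  \<open>[0,\<infinity>)\<close> exists, and every trajectory satisfies P.\<close>

definition SDF_SGAS ::
    "('a::euclidean_space \<Rightarrow> 'u::euclidean_space \<Rightarrow> 'a) \<Rightarrow> bool"
  where "SDF_SGAS F \<longleftrightarrow>
    F 0 0 = 0 \<and>
    (\<forall>R>0. \<forall>T. sampling_times T \<longrightarrow>
      (\<exists>D k.
        0 \<in> interior D \<and> cball 0 R \<subseteq> D \<and>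
        (\<forall>x\<in>D. admissible_input (\<lambda>t. k t x)) \<and>
        (let traj = (\<lambda>x. x 0 \<in> D \<and> (\<forall>i. x (T i) \<in> D) \<and> sampled_trajectory F k T x) in
          (\<forall>x\<^sub>0\<in>D. \<exists>x. traj x \<and> x 0 = x\<^sub>0) \<and>
          (\<forall>\<epsilon>>0. \<exists>\<delta>>0. \<forall>x. traj x \<and> norm (x 0) \<le> \<delta> \<longrightarrow> (\<forall>t\<ge>0. norm (x t) \<le> \<epsilon>)) \<and>
          (\<forall>x. traj x \<longrightarrow> (x \<longlongrightarrow> 0) at_top))))"

text \<open>Here \<open>T\<close> is a map on the nonzero states only (its value at \<open>0\<close> is irrelevant), so the
  requirement \<open>t\<^sub>i\<^sub>+\<^sub>1 - t\<^sub>i = T (x (t\<^sub>i))\<close> includes \<open>x (t\<^sub>i) \<noteq> 0\<close>; the sampling times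
  \<open>t x\<^sub>0\<close> depend on the initial state \<open>x\<^sub>0\<close>, whereas \<open>\<delta>\<close> depends on \<open>\<epsilon>\<close> only.\<close>

definition SDF_WGAS ::
    "('a::euclidean_space \<Rightarrow> 'u::euclidean_space \<Rightarrow> 'a) \<Rightarrow> bool"
  where "SDF_WGAS F \<longleftrightarrow>
    F 0 0 = 0 \<and>
    (\<forall>\<tau>>0. \<exists>(T :: 'a \<Rightarrow> real) (k :: real \<Rightarrow> 'a \<Rightarrow> 'a \<Rightarrow> 'u).
      (\<forall>x. x \<noteq> 0 \<longrightarrow> 0 < T x \<and> T x \<le> \<tau>) \<and>
      (\<forall>x x\<^sub>0. admissible_input (\<lambda>t. k t x x\<^sub>0)) \<and>
      (\<exists>t :: 'a \<Rightarrow> nat \<Rightarrow> real.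
        (\<forall>x\<^sub>0. x\<^sub>0 \<noteq> 0 \<longrightarrow> sampling_times (t x\<^sub>0)) \<and>
        (let traj = (\<lambda>x\<^sub>0 x. x\<^sub>0 \<noteq> 0 \<and> x 0 = x\<^sub>0 \<and>
                       sampled_trajectory F (\<lambda>s y. k s y x\<^sub>0) (t x\<^sub>0) x) in
          (\<forall>x\<^sub>0. x\<^sub>0 \<noteq> 0 \<longrightarrow> (\<exists>x. traj x\<^sub>0 x)) \<and>
          (\<forall>x\<^sub>0 x. traj x\<^sub>0 x \<longrightarrow>
            (\<forall>i. x (t x\<^sub>0 i) \<noteq> 0 \<and> t x\<^sub>0 (Suc i) - t x\<^sub>0 i = T (x (t x\<^sub>0 i)))) \<and>
          (\<forall>\<epsilon>>0. \<exists>\<delta>>0. \<forall>x\<^sub>0 x. traj x\<^sub>0 x \<and> norm (x 0) \<le> \<delta> \<longrightarrow>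
            (\<forall>s\<ge>0. norm (x s) \<le> \<epsilon>)) \<and>
          (\<forall>x\<^sub>0 x. traj x\<^sub>0 x \<longrightarrow> (x \<longlongrightarrow> 0) at_top))))"

end

theory Submission
  imports Defs
begin

text \<open>The proof has a local part, which lowers \<open>V\<close> near each \<open>x \<noteq> 0\<close>, and a global part, which turns local
descent into sampled-data feedback.

\<^bold>\<open>Local descent.\<close>  Follow \<open>X1 = f + u1 g\<close> for time \<open>\<alpha> \<epsilon>\<close> and then \<open>X2 = f + u2 g\<close> for time \<open>\<epsilon>\<close>.
Expanding along each piece, \<open>V\<close> changes by a sum of terms
\<open>\<alpha>^j \<epsilon>^(j+k) X1^j X2^k V(x) / (j! k!)\<close>.  In alternative (iii) all products of \<open>f\<close> and \<open>g\<close> of length at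
most \<open>N\<close> annihilate \<open>V\<close> at \<open>x\<close> (lemma \<open>vanishing_products\<close>), so the change is \<open>\<epsilon>^(N+1) Q + O(\<epsilon>^(N+2))\<close>
with \<open>Q\<close> the sum of the terms with \<open>j + k = N + 1\<close> (\<open>two_piece_coefficient\<close>), and it remains to find
controls with \<open>Q < 0\<close>.  Under (P1) the zero control does.  Under (P2) and (P3) large opposite controls
\<open>\<mu>/\<kappa>\<close> and \<open>- \<mu>/\<kappa>\<close> do: the two displacements along \<open>g\<close> cancel, and what \<open>f\<close> contributes in between is,
to first order in \<open>\<kappa>\<close>, a positive multiple of \<open>(- \<mu>)^N [..[f,g]..,g] V(x)\<close>, whose sign can be chosen for
odd \<open>N\<close> and is the right one for even \<open>N\<close> (lemma \<open>switched_descent\<close>).  Under (P4) a small control that is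
switched on with a delay \<open>\<alpha>\<close> does: the coefficient linear in the control is a polynomial in \<open>\<alpha>\<close> that can
only vanish identically if all the products \<open>f^i g f^(N-i) V(x)\<close> vanish, and with them the bracket (lemma
\<open>delayed_descent\<close>).

\<^bold>\<open>Plans.\<close>  The endpoint depends continuously on the initial state, so one pair of controls works on a
whole ball (\<open>local_descent\<close>), and by compactness \<open>V\<close> can be brought below any positive level in finite time
(\<open>descend_below\<close>).  The times spent could be summable, with the trajectory running into the origin in
finite time; this is prevented by inserting waiting periods of a fixed length, in which the control is zero
and, as \<open>f 0 = 0\<close>, the state stays comparable to its initial value (\<open>halving_step\<close>).  Thus every \<open>y \<noteq> 0\<close> has
an open-loop control along which \<open>V \<le> 2 V(y)\<close>, the state never vanishes, and it tends to \<open>0\<close>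
(\<open>open_loop_plan\<close>).

\<^bold>\<open>Feedback.\<close>  A weakly stabilizing feedback may depend on the initial state, hence may simply play its
plan.  A semi-global one sees only the time and the sampled state, while sampling intervals may be too
short for a useful decrease of \<open>V\<close> within any one of them.  At time \<open>T i\<close> it therefore continues one of the
plans, begun at this or an earlier sampling time, whose trajectory passes through the sampled state.  The choice
is made by a fixed ranking, so the rank of the plan that is followed improves monotonically; either it
improves without bound, which forces convergence, or one single plan is followed from some time on
(\<open>semiglobal_sampled_data_feedback\<close>).\<close>

section \<open>Smooth maps and Lie brackets\<close>

lemma Ck_antimono_Suc: "Ck (Suc k) F \<Longrightarrow> Ck k F"
  by (induction k arbitrary: F) (auto simp: differentiable_imp_continuous_on)

lemma frechet_derivative_eqI:
  "(F has_derivative F') (at x) \<Longrightarrow> frechet_derivative F (at x) v = F' v"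
  using frechet_derivative_at by metis

lemma Ck_const: "Ck k (\<lambda>x. c)"
proof (induction k arbitrary: c)
  case (Suc k)
  then show ?case using Suc[of 0] by simp
qed simp

lemma Ck_add: "Ck k F \<Longrightarrow> Ck k G \<Longrightarrow> Ck k (\<lambda>x. F x + G x)"
proof (induction k arbitrary: F G)
  case 0
  then show ?case by (auto intro: continuous_on_add)
next
  case (Suc k)
  have d: "F differentiable at x" "G differentiable at x" for x
    using Suc.prems by (auto simp: differentiable_on_def)
  have "frechet_derivative (\<lambda>x. F x + G x) (at x) v
      = frechet_derivative F (at x) v + frechet_derivative G (at x) v" for x v
    by (rule frechet_derivative_eqI)
      (intro has_derivative_add d[THEN frechet_derivative_works[THEN iffD1]])
  with Suc show ?case by (auto intro: differentiable_on_add)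
qed

lemma Ck_scaleR: "Ck k s \<Longrightarrow> Ck k F \<Longrightarrow> Ck k (\<lambda>x. s x *\<^sub>R F x)"
proof (induction k arbitrary: s F)
  case 0
  then show ?case by (auto intro: continuous_on_scaleR)
next
  case (Suc k)
  have d: "s differentiable at x" "F differentiable at x" for x
    using Suc.prems by (auto simp: differentiable_on_def)
  have "frechet_derivative (\<lambda>x. s x *\<^sub>R F x) (at x) v
      = s x *\<^sub>R frechet_derivative F (at x) v + frechet_derivative s (at x) v *\<^sub>R F x" for x v
    by (rule frechet_derivative_eqI)
      (intro has_derivative_scaleR d[THEN frechet_derivative_works[THEN iffD1]])
  moreover have "Ck k s" "Ck k F"
    using Suc.prems Ck_antimono_Suc by blast+
  moreover have "Ck k (\<lambda>x. frechet_derivative s (at x) v)"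
      "Ck k (\<lambda>x. frechet_derivative F (at x) v)" for v
    using Suc.prems by auto
  ultimately have "Ck k (\<lambda>x. frechet_derivative (\<lambda>x. s x *\<^sub>R F x) (at x) v)" for v
    using Suc.IH by (auto intro!: Ck_add)
  moreover have "(\<lambda>x. s x *\<^sub>R F x) differentiable_on UNIV"
    using d by (auto simp: differentiable_on_def)
  ultimately show ?case by simp
qed

lemma Ck_bounded_linear:
  assumes "bounded_linear L"
  shows "Ck k F \<Longrightarrow> Ck k (\<lambda>x. L (F x))"
proof (induction k arbitrary: F)
  case 0
  then show ?case using assms by (auto intro: bounded_linear.continuous_on)
next
  case (Suc k)
  have d: "F differentiable at x" for x
    using Suc.prems by (auto simp: differentiable_on_def)
  have D: "((\<lambda>x. L (F x)) has_derivative (\<lambda>v. L (frechet_derivative F (at x) v))) (at x)" for x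
    by (intro bounded_linear.has_derivative[OF assms] d[THEN frechet_derivative_works[THEN iffD1]])
  have "Ck k (\<lambda>x. frechet_derivative (\<lambda>x. L (F x)) (at x) v)" for v
    using Suc by (simp add: frechet_derivative_eqI[OF D])
  moreover have "(\<lambda>x. L (F x)) differentiable_on UNIV"
    using D by (auto simp: differentiable_on_def differentiable_def)
  ultimately show ?case by simp
qed

lemma smooth_const [simp]: "smooth (\<lambda>x. c)"
  by (simp add: smooth_def Ck_const)

lemma smooth_add: "smooth F \<Longrightarrow> smooth G \<Longrightarrow> smooth (\<lambda>x. F x + G x)"
  by (simp add: smooth_def Ck_add)

lemma smooth_scaleR: "smooth s \<Longrightarrow> smooth F \<Longrightarrow> smooth (\<lambda>x. s x *\<^sub>R F x)"
  by (simp add: smooth_def Ck_scaleR)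

lemma smooth_inner_const: "smooth F \<Longrightarrow> smooth (\<lambda>x. F x \<bullet> b)"
  by (simp add: smooth_def Ck_bounded_linear[OF bounded_linear_inner_left])

lemma smooth_cmult: "smooth F \<Longrightarrow> smooth (\<lambda>x. c *\<^sub>R F x)"
  by (rule smooth_scaleR) auto

lemma smooth_sum: "(\<And>i. i \<in> I \<Longrightarrow> smooth (F i)) \<Longrightarrow> smooth (\<lambda>x. \<Sum>i\<in>I. F i x)"
  by (induction I rule: infinite_finite_induct) (auto intro: smooth_add)

lemma smooth_linear_combination:
  "smooth X \<Longrightarrow> smooth Y \<Longrightarrow> smooth (\<lambda>x. a *\<^sub>R X x + b *\<^sub>R Y x)"
  by (intro smooth_add smooth_cmult)

lemma smooth_differentiable: "smooth F \<Longrightarrow> F differentiable at x"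
  by (auto simp: smooth_def differentiable_on_def dest: spec[of _ "Suc 0"])

lemma smooth_has_derivative: "smooth F \<Longrightarrow> (F has_derivative frechet_derivative F (at x)) (at x)"
  using smooth_differentiable frechet_derivative_works by blast

lemma smooth_directional_derivative: "smooth F \<Longrightarrow> smooth (\<lambda>x. frechet_derivative F (at x) v)"
  unfolding smooth_def
proof
  fix k assume "\<forall>k. Ck k F"
  then have "Ck (Suc k) F" by blast
  then show "Ck k (\<lambda>x. frechet_derivative F (at x) v)" by simp
qed

lemma smooth_continuous_on: "smooth F \<Longrightarrow> continuous_on S F"
  unfolding smooth_def using continuous_on_subset[OF _ subset_UNIV] Ck.simps(1) by blast

lemma frechet_derivative_Basis_expansion:
  assumes "smooth F"
  shows "frechet_derivative F (at x) v = (\<Sum>b\<in>Basis. (v \<bullet> b) *\<^sub>R frechet_derivative F (at x) b)"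
proof -
  interpret linear "frechet_derivative F (at x)"
    using smooth_has_derivative[OF assms] by (rule has_derivative_linear)
  have "frechet_derivative F (at x) v = frechet_derivative F (at x) (\<Sum>b\<in>Basis. (v \<bullet> b) *\<^sub>R b)"
    by (simp add: euclidean_representation)
  then show ?thesis by (simp add: sum scale)
qed

lemma smooth_lie_derivative:
  assumes "smooth X" "smooth F"
  shows "smooth (lie_derivative X F)"
proof -
  have "lie_derivative X F = (\<lambda>x. \<Sum>b\<in>Basis. (X x \<bullet> b) *\<^sub>R frechet_derivative F (at x) b)"
    unfolding lie_derivative_def using frechet_derivative_Basis_expansion[OF assms(2)] by blast
  then show ?thesis
    using assms by (auto intro!: smooth_sum smooth_scaleR smooth_inner_const smooth_directional_derivative)
qed

lemma smooth_lie_derivative_power: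
  "smooth X \<Longrightarrow> smooth F \<Longrightarrow> smooth ((lie_derivative X ^^ k) F)"
  by (induction k) (auto intro: smooth_lie_derivative)

lemma lie_derivative_add:
  assumes "smooth F" "smooth G"
  shows "lie_derivative X (\<lambda>x. F x + G x) = (\<lambda>x. lie_derivative X F x + lie_derivative X G x)"
  unfolding lie_derivative_def
  by (rule ext, rule frechet_derivative_eqI) (intro has_derivative_add smooth_has_derivative assms)

lemma lie_derivative_cmult:
  assumes "smooth F"
  shows "lie_derivative X (\<lambda>x. c *\<^sub>R F x) = (\<lambda>x. c *\<^sub>R lie_derivative X F x)"
  unfolding lie_derivative_def
  by (rule ext, rule frechet_derivative_eqI) (intro has_derivative_scaleR_right smooth_has_derivative assms)

lemma lie_derivative_const: "lie_derivative X (\<lambda>x. c) = (\<lambda>x. 0)"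
  by (simp add: lie_derivative_def)

lemma lie_derivative_sum:
  assumes "\<And>i. i \<in> I \<Longrightarrow> smooth (F i)"
  shows "lie_derivative X (\<lambda>x. \<Sum>i\<in>I. F i x) = (\<lambda>x. \<Sum>i\<in>I. lie_derivative X (F i) x)"
  using assms
  by (induction I rule: infinite_finite_induct)
    (auto simp: lie_derivative_const lie_derivative_add smooth_sum)

lemma lie_derivative_linear_combination:
  assumes "smooth F"
  shows "lie_derivative (\<lambda>x. a *\<^sub>R X x + b *\<^sub>R Y x) F
    = (\<lambda>x. a *\<^sub>R lie_derivative X F x + b *\<^sub>R lie_derivative Y F x)"
proof
  fix x
  interpret linear "frechet_derivative F (at x)"
    using smooth_has_derivative[OF assms] by (rule has_derivative_linear)
  show "lie_derivative (\<lambda>x. a *\<^sub>R X x + b *\<^sub>R Y x) F x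
    = a *\<^sub>R lie_derivative X F x + b *\<^sub>R lie_derivative Y F x"
    by (simp add: lie_derivative_def add scale)
qed

lemma lie_derivative_scaled_field:
  assumes "smooth F"
  shows "lie_derivative (\<lambda>x. a *\<^sub>R X x) F = (\<lambda>x. a *\<^sub>R lie_derivative X F x)"
  using lie_derivative_linear_combination[OF assms, of a X 0 X] by simp

text \<open>Both mixed derivatives are limits of the same second difference quotient of \<open>W\<close>: the mean value theorem,
applied once in each direction, evaluates it as either one at a point close to \<open>x\<close>, depending on the order.\<close>

lemma symmetric_second_derivative:
  fixes W :: "'a::euclidean_space \<Rightarrow> real"
  assumes W: "smooth W"
  shows "frechet_derivative (\<lambda>y. frechet_derivative W (at y) v) (at x) w
    = frechet_derivative (\<lambda>y. frechet_derivative W (at y) w) (at x) v"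
proof -
  define D where "D v y = frechet_derivative W (at y) v" for v y
  define DD where "DD v w y = frechet_derivative (D v) (at y) w" for v w y
  have sD: "smooth (D v)" for v
    unfolding D_def by (rule smooth_directional_derivative[OF W])
  have sDD: "smooth (DD v w)" for v w
    unfolding DD_def by (rule smooth_directional_derivative[OF sD])
  have along: "((\<lambda>t. F (p + t *\<^sub>R v)) has_real_derivative frechet_derivative F (at (p + t *\<^sub>R v)) v) (at t)"
    if "smooth F" for F :: "'a \<Rightarrow> real" and p v t
  proof -
    have "((\<lambda>t. F (p + t *\<^sub>R v)) has_derivative
        (\<lambda>s. frechet_derivative F (at (p + t *\<^sub>R v)) (s *\<^sub>R v))) (at t)"
      by (rule has_derivative_compose[OF _ smooth_has_derivative[OF that]])
        (auto intro!: derivative_eq_intros)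
    moreover have "frechet_derivative F (at (p + t *\<^sub>R v)) (s *\<^sub>R v)
        = s * frechet_derivative F (at (p + t *\<^sub>R v)) v" for s
      using linear_scale[OF has_derivative_linear[OF smooth_has_derivative[OF that]]] by auto
    ultimately show ?thesis
      by (simp add: has_field_derivative_def mult.commute[of _ "frechet_derivative F (at (p + t *\<^sub>R v)) v"])
  qed
  have quot: "\<exists>a b. 0 < a \<and> a < t \<and> 0 < b \<and> b < t \<and>
      W (x + t *\<^sub>R v + t *\<^sub>R w) - W (x + t *\<^sub>R v) - W (x + t *\<^sub>R w) + W x
        = t * t * DD v w (x + a *\<^sub>R v + b *\<^sub>R w)" if "t > 0" for t v w
  proof -
    define \<phi> where "\<phi> s = W (x + t *\<^sub>R w + s *\<^sub>R v) - W (x + s *\<^sub>R v)" for s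
    have "(\<phi> has_real_derivative D v (x + t *\<^sub>R w + s *\<^sub>R v) - D v (x + s *\<^sub>R v)) (at s)" for s
      unfolding \<phi>_def D_def by (intro DERIV_diff along W)
    from MVT2[OF that, of \<phi>, OF this] obtain a where a: "0 < a" "a < t"
      "\<phi> t - \<phi> 0 = (t - 0) * (D v (x + t *\<^sub>R w + a *\<^sub>R v) - D v (x + a *\<^sub>R v))" by blast
    have "((\<lambda>s. D v (x + a *\<^sub>R v + s *\<^sub>R w)) has_real_derivative DD v w (x + a *\<^sub>R v + s *\<^sub>R w)) (at s)" for s
      unfolding DD_def by (intro along sD)
    from MVT2[OF that, of "\<lambda>s. D v (x + a *\<^sub>R v + s *\<^sub>R w)", OF this] obtain b where b: "0 < b" "b < t"
      "D v (x + a *\<^sub>R v + t *\<^sub>R w) - D v (x + a *\<^sub>R v + 0 *\<^sub>R w) = (t - 0) * DD v w (x + a *\<^sub>R v + b *\<^sub>R w)"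
      by blast
    have "W (x + t *\<^sub>R v + t *\<^sub>R w) - W (x + t *\<^sub>R v) - W (x + t *\<^sub>R w) + W x = \<phi> t - \<phi> 0"
      by (simp add: \<phi>_def algebra_simps)
    also have "\<dots> = t * (D v (x + a *\<^sub>R v + t *\<^sub>R w) - D v (x + a *\<^sub>R v + 0 *\<^sub>R w))"
      using a by (simp add: algebra_simps)
    also have "\<dots> = t * t * DD v w (x + a *\<^sub>R v + b *\<^sub>R w)"
      using b by simp
    finally show ?thesis using a b by blast
  qed
  have lim: "(\<lambda>n. DD v w (x + a n *\<^sub>R v + b n *\<^sub>R w)) \<longlonglongrightarrow> DD v w x"
    if "\<And>n. 0 < a n \<and> a n < inverse (Suc n)" "\<And>n. 0 < b n \<and> b n < inverse (Suc n)"
    for v w and a b :: "nat \<Rightarrow> real"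
  proof -
    have "a \<longlonglongrightarrow> 0" "b \<longlonglongrightarrow> 0"
      using that by (auto intro!: tendsto_sandwich[OF _ _ tendsto_const LIMSEQ_inverse_real_of_nat]
          always_eventually less_imp_le)
    then have "(\<lambda>n. x + a n *\<^sub>R v + b n *\<^sub>R w) \<longlonglongrightarrow> x + 0 *\<^sub>R v + 0 *\<^sub>R w"
      by (intro tendsto_intros)
    then show ?thesis
      using continuous_on_tendsto_compose[OF smooth_continuous_on[where S=UNIV, OF sDD]] by auto
  qed
  have pos: "inverse (real (Suc n)) > 0" for n by simp
  obtain a b where ab: "\<And>n. 0 < a n \<and> a n < inverse (real (Suc n)) \<and> 0 < b n \<and> b n < inverse (real (Suc n)) \<and>
    W (x + inverse (real (Suc n)) *\<^sub>R v + inverse (real (Suc n)) *\<^sub>R w) - W (x + inverse (real (Suc n)) *\<^sub>R v)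
     - W (x + inverse (real (Suc n)) *\<^sub>R w) + W x
        = inverse (real (Suc n)) * inverse (real (Suc n)) * DD v w (x + a n *\<^sub>R v + b n *\<^sub>R w)"
    using quot[OF pos, of _ v w] by metis
  obtain c d where cd: "\<And>n. 0 < c n \<and> c n < inverse (real (Suc n)) \<and> 0 < d n \<and> d n < inverse (real (Suc n)) \<and>
    W (x + inverse (real (Suc n)) *\<^sub>R w + inverse (real (Suc n)) *\<^sub>R v) - W (x + inverse (real (Suc n)) *\<^sub>R w)
     - W (x + inverse (real (Suc n)) *\<^sub>R v) + W x
        = inverse (real (Suc n)) * inverse (real (Suc n)) * DD w v (x + c n *\<^sub>R w + d n *\<^sub>R v)"
    using quot[OF pos, of _ w v] by metis
  have e: "DD v w (x + a n *\<^sub>R v + b n *\<^sub>R w) = DD w v (x + c n *\<^sub>R w + d n *\<^sub>R v)" for n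
  proof -
    define r where "r = inverse (real (Suc n))"
    have "r * r * DD v w (x + a n *\<^sub>R v + b n *\<^sub>R w)
        = W (x + r *\<^sub>R v + r *\<^sub>R w) - W (x + r *\<^sub>R v) - W (x + r *\<^sub>R w) + W x"
      using ab[of n] unfolding r_def by metis
    also have "\<dots> = W (x + r *\<^sub>R w + r *\<^sub>R v) - W (x + r *\<^sub>R w) - W (x + r *\<^sub>R v) + W x"
      by (simp add: add.commute add.left_commute)
    also have "\<dots> = r * r * DD w v (x + c n *\<^sub>R w + d n *\<^sub>R v)"
      using cd[of n] unfolding r_def by metis
    finally show ?thesis by (simp add: r_def)
  qed
  have "(\<lambda>n. DD v w (x + a n *\<^sub>R v + b n *\<^sub>R w)) \<longlonglongrightarrow> DD v w x"
    by (rule lim) (use ab in blast)+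
  moreover have "(\<lambda>n. DD w v (x + c n *\<^sub>R w + d n *\<^sub>R v)) \<longlonglongrightarrow> DD w v x"
    by (rule lim) (use cd in blast)+
  ultimately have "DD v w x = DD w v x" unfolding e by (rule LIMSEQ_unique)
  then show ?thesis by (simp add: DD_def D_def[abs_def])
qed

text \<open>The second summand, the Hessian of \<open>W\<close> at \<open>(X, Y)\<close>, is symmetric.  It hence cancels in \<open>X Y W - Y X W\<close>,
and only the derivative of \<open>W\<close> along the bracket remains.\<close>

lemma lie_derivative_lie_derivative:
  fixes W :: "'a::euclidean_space \<Rightarrow> real"
  assumes "smooth Y" "smooth W"
  shows "lie_derivative X (lie_derivative Y W) x
    = frechet_derivative W (at x) (lie_derivative X Y x)
      + frechet_derivative (\<lambda>y. frechet_derivative W (at y) (X x)) (at x) (Y x)"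
proof -
  define D where "D b y = frechet_derivative W (at y) b" for b y
  have sD: "smooth (D b)" for b
    unfolding D_def by (rule smooth_directional_derivative[OF assms(2)])
  have e: "lie_derivative Y W = (\<lambda>y. \<Sum>b\<in>Basis. (Y y \<bullet> b) * D b y)"
  proof
    fix y
    show "lie_derivative Y W y = (\<Sum>b\<in>Basis. (Y y \<bullet> b) * D b y)"
      using frechet_derivative_Basis_expansion[OF assms(2), of y "Y y"]
      by (simp add: lie_derivative_def D_def)
  qed
  have "((\<lambda>y. \<Sum>b\<in>Basis. (Y y \<bullet> b) * D b y) has_derivative
      (\<lambda>v. \<Sum>b\<in>Basis. (Y x \<bullet> b) * frechet_derivative (D b) (at x) v
          + (frechet_derivative Y (at x) v \<bullet> b) * D b x)) (at x)"
    by (intro has_derivative_sum has_derivative_mult has_derivative_inner_left smooth_has_derivative assms sD)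
  then have "lie_derivative X (lie_derivative Y W) x
      = (\<Sum>b\<in>Basis. (Y x \<bullet> b) * frechet_derivative (D b) (at x) (X x)
          + (frechet_derivative Y (at x) (X x) \<bullet> b) * D b x)"
    unfolding e unfolding lie_derivative_def[of X] by (rule frechet_derivative_eqI)
  also have "\<dots> = (\<Sum>b\<in>Basis. (Y x \<bullet> b) * frechet_derivative (D b) (at x) (X x))
      + frechet_derivative W (at x) (lie_derivative X Y x)"
    using frechet_derivative_Basis_expansion[OF assms(2), of x "frechet_derivative Y (at x) (X x)"]
    by (simp add: sum.distrib lie_derivative_def[of X Y] D_def[of _ x])
  also have "(\<Sum>b\<in>Basis. (Y x \<bullet> b) * frechet_derivative (D b) (at x) (X x))
      = (\<Sum>b\<in>Basis. (Y x \<bullet> b) * frechet_derivative (D (X x)) (at x) b)"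
    using symmetric_second_derivative[OF assms(2)] by (simp add: D_def[abs_def])
  also have "\<dots> = frechet_derivative (D (X x)) (at x) (Y x)"
    using frechet_derivative_Basis_expansion[OF sD, of "X x" x "Y x"] by simp
  finally show ?thesis by (simp add: D_def[abs_def])
qed

lemma smooth_diff: "smooth F \<Longrightarrow> smooth G \<Longrightarrow> smooth (\<lambda>x. F x - G x)"
  using smooth_linear_combination[of F G 1 "-1"] by simp

lemma smooth_lie_bracket: "smooth X \<Longrightarrow> smooth Y \<Longrightarrow> smooth (lie_bracket X Y)"
  unfolding lie_bracket_def by (intro smooth_diff smooth_lie_derivative)

lemma lie_derivative_lie_bracket:
  fixes W :: "'a::euclidean_space \<Rightarrow> real"
  assumes "smooth X" "smooth Y" "smooth W"
  shows "lie_derivative (lie_bracket X Y) W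
    = (\<lambda>x. lie_derivative X (lie_derivative Y W) x - lie_derivative Y (lie_derivative X W) x)"
proof
  fix x
  have "frechet_derivative (\<lambda>y. frechet_derivative W (at y) (X x)) (at x) (Y x)
      = frechet_derivative (\<lambda>y. frechet_derivative W (at y) (Y x)) (at x) (X x)"
    by (rule symmetric_second_derivative[OF assms(3)])
  moreover have "lie_derivative (lie_bracket X Y) W x
      = frechet_derivative W (at x) (lie_derivative X Y x) - frechet_derivative W (at x) (lie_derivative Y X x)"
    using linear_diff[OF has_derivative_linear[OF smooth_has_derivative[OF assms(3)]]]
    by (simp add: lie_derivative_def lie_bracket_def)
  ultimately show "lie_derivative (lie_bracket X Y) W x
      = lie_derivative X (lie_derivative Y W) x - lie_derivative Y (lie_derivative X W) x"
    by (simp add: lie_derivative_lie_derivative assms)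
qed

lemma smooth_iterated_bracket:
  "smooth X \<Longrightarrow> smooth Y \<Longrightarrow> smooth (iterated_bracket N X Y)"
  by (induction N) (auto simp: iterated_bracket_def intro: smooth_lie_bracket)

text \<open>Bracketing with \<open>Y\<close> turns the operator \<open>Z\<close> into \<open>Z Y - Y Z\<close>.  Composition with \<open>Y\<close> on the right and on the
left commute, so the \<open>N\<close>-fold bracket expands like the \<open>N\<close>-th power of a difference.\<close>

lemma lie_derivative_iterated_bracket:
  fixes W :: "'a::euclidean_space \<Rightarrow> real"
  assumes "smooth X" "smooth Y" "smooth W"
  shows "lie_derivative (iterated_bracket N X Y) W x = (\<Sum>i\<le>N. (-1) ^ i * real (N choose i) *
    (lie_derivative Y ^^ i) (lie_derivative X ((lie_derivative Y ^^ (N - i)) W)) x)"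
  using assms(3)
proof (induction N arbitrary: W x)
  case 0
  then show ?case by (simp add: iterated_bracket_def)
next
  case (Suc N)
  define T where "T i = (lie_derivative Y ^^ i) (lie_derivative X ((lie_derivative Y ^^ (Suc N - i)) W))" for i
  define Z where "Z = iterated_bracket N X Y"
  have sZ: "smooth Z" unfolding Z_def by (intro smooth_iterated_bracket assms)
  have sYW: "smooth (lie_derivative Y W)" by (intro smooth_lie_derivative assms Suc)
  have sU: "smooth ((lie_derivative Y ^^ i) (lie_derivative X ((lie_derivative Y ^^ k) W)))" for i k
    by (intro smooth_lie_derivative_power smooth_lie_derivative assms Suc)
  have A: "lie_derivative Z (lie_derivative Y W) x = (\<Sum>i\<le>N. (-1) ^ i * real (N choose i) * T i x)"
    unfolding Z_def Suc.IH[OF sYW] T_def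
    by (rule sum.cong) (auto simp: Suc_diff_le funpow_swap1)
  have "lie_derivative Z W = (\<lambda>x. \<Sum>i\<le>N. ((-1) ^ i * real (N choose i)) *\<^sub>R
      (lie_derivative Y ^^ i) (lie_derivative X ((lie_derivative Y ^^ (N - i)) W)) x)"
    unfolding Z_def using Suc.IH[OF Suc.prems] by auto
  then have B: "lie_derivative Y (lie_derivative Z W) x = (\<Sum>i\<le>N. (-1) ^ i * real (N choose i) * T (Suc i) x)"
    by (simp add: lie_derivative_sum smooth_cmult[OF sU, simplified] lie_derivative_cmult[OF sU, simplified] T_def)
  have "(\<Sum>i\<le>Suc N. (-1) ^ i * real (Suc N choose i) * T i x)
      = T 0 x + (\<Sum>i\<le>N. (-1) ^ Suc i * real (Suc N choose Suc i) * T (Suc i) x)"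
    by (subst sum.atMost_Suc_shift) simp
  also have "\<dots> = (T 0 x + (\<Sum>i\<le>N. (-1) ^ Suc i * real (N choose Suc i) * T (Suc i) x))
      - (\<Sum>i\<le>N. (-1) ^ i * real (N choose i) * T (Suc i) x)"
    unfolding add_diff_eq[symmetric] sum_subtractf[symmetric]
    by (intro arg_cong2[of _ _ _ _ "(+)"] sum.cong refl) (simp add: algebra_simps)
  also have "T 0 x + (\<Sum>i\<le>N. (-1) ^ Suc i * real (N choose Suc i) * T (Suc i) x)
      = (\<Sum>i\<le>Suc N. (-1) ^ i * real (N choose i) * T i x)"
    by (subst sum.atMost_Suc_shift) simp
  also have "\<dots> = (\<Sum>i\<le>N. (-1) ^ i * real (N choose i) * T i x)"
    by simp
  finally have "(\<Sum>i\<le>Suc N. (-1) ^ i * real (Suc N choose i) * T i x)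
      = lie_derivative Z (lie_derivative Y W) x - lie_derivative Y (lie_derivative Z W) x"
    by (simp only: A B)
  also have "\<dots> = lie_derivative (lie_bracket Z Y) W x"
    by (simp add: lie_derivative_lie_bracket sZ assms Suc)
  also have "lie_bracket Z Y = iterated_bracket (Suc N) X Y"
    by (simp add: Z_def iterated_bracket_def)
  finally show ?case by (simp only: T_def)
qed


section \<open>Expansion of products of Lie derivatives in a small parameter\<close>

text \<open>Polynomials in a real parameter whose coefficients are smooth functions.  The class is preserved by Lie
derivatives, and its members are bounded at each point uniformly for parameters in \<open>[-1, 1]\<close>, which
is what makes the remainders below quadratically small.\<close>

inductive polynomial_family :: "(real \<Rightarrow> 'a::euclidean_space \<Rightarrow> real) \<Rightarrow> bool" where
  const: "smooth F \<Longrightarrow> polynomial_family (\<lambda>\<kappa>. F)"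
| add: "polynomial_family H \<Longrightarrow> polynomial_family K \<Longrightarrow> polynomial_family (\<lambda>\<kappa> x. H \<kappa> x + K \<kappa> x)"
| cmult: "polynomial_family H \<Longrightarrow> polynomial_family (\<lambda>\<kappa> x. c * H \<kappa> x)"
| param: "polynomial_family H \<Longrightarrow> polynomial_family (\<lambda>\<kappa> x. \<kappa> * H \<kappa> x)"

lemma smooth_mult_const: "smooth F \<Longrightarrow> smooth (\<lambda>x. c * F x)" for F :: "'a::euclidean_space \<Rightarrow> real"
  using smooth_cmult[of F c] by simp

lemma lie_derivative_mult_const:
  fixes F :: "'a::euclidean_space \<Rightarrow> real"
  shows "smooth F \<Longrightarrow> lie_derivative X (\<lambda>x. c * F x) = (\<lambda>x. c * lie_derivative X F x)"
  using lie_derivative_cmult[of F X c] by simp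

lemma polynomial_family_smooth: "polynomial_family H \<Longrightarrow> smooth (H \<kappa>)"
  by (induction rule: polynomial_family.induct) (auto intro: smooth_add smooth_mult_const)

lemma polynomial_family_lie_derivative:
  assumes "polynomial_family H" "smooth X"
  shows "polynomial_family (\<lambda>\<kappa>. lie_derivative X (H \<kappa>))"
  using assms(1)
proof (induction rule: polynomial_family.induct)
  case (const F)
  then show ?case by (intro polynomial_family.const smooth_lie_derivative assms)
next
  case (add H K)
  then show ?case by (simp add: lie_derivative_add polynomial_family_smooth polynomial_family.add)
next
  case (cmult H c)
  then show ?case by (simp add: lie_derivative_mult_const polynomial_family_smooth polynomial_family.cmult)
next
  case (param H)
  then show ?case by (simp add: lie_derivative_mult_const polynomial_family_smooth polynomial_family.param)
qed

lemma polynomial_family_bounded: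
  assumes "polynomial_family H"
  shows "\<exists>C. \<forall>\<kappa>. \<bar>\<kappa>\<bar> \<le> 1 \<longrightarrow> \<bar>H \<kappa> x\<bar> \<le> C"
  using assms
proof (induction rule: polynomial_family.induct)
  case (const F)
  then show ?case by auto
next
  case (add H K)
  then obtain C D where "\<forall>\<kappa>. \<bar>\<kappa>\<bar> \<le> 1 \<longrightarrow> \<bar>H \<kappa> x\<bar> \<le> C" "\<forall>\<kappa>. \<bar>\<kappa>\<bar> \<le> 1 \<longrightarrow> \<bar>K \<kappa> x\<bar> \<le> D" by blast
  then have "\<forall>\<kappa>. \<bar>\<kappa>\<bar> \<le> 1 \<longrightarrow> \<bar>H \<kappa> x + K \<kappa> x\<bar> \<le> C + D"
    by (metis abs_triangle_ineq add_mono order_trans)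
  then show ?case by blast
next
  case (cmult H c)
  then obtain C where "\<forall>\<kappa>. \<bar>\<kappa>\<bar> \<le> 1 \<longrightarrow> \<bar>H \<kappa> x\<bar> \<le> C" by blast
  then have "\<forall>\<kappa>. \<bar>\<kappa>\<bar> \<le> 1 \<longrightarrow> \<bar>c * H \<kappa> x\<bar> \<le> \<bar>c\<bar> * C"
    by (simp add: abs_mult mult_left_mono)
  then show ?case by blast
next
  case (param H)
  then obtain C where C: "\<forall>\<kappa>. \<bar>\<kappa>\<bar> \<le> 1 \<longrightarrow> \<bar>H \<kappa> x\<bar> \<le> C" by blast
  then have "\<bar>\<kappa> * H \<kappa> x\<bar> \<le> 1 * C" if "\<bar>\<kappa>\<bar> \<le> 1" for \<kappa>
    unfolding abs_mult using that by (intro mult_mono) auto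
  then show ?case by auto
qed

definition first_order_expansion ::
    "(real \<Rightarrow> 'a::euclidean_space \<Rightarrow> real) \<Rightarrow> ('a \<Rightarrow> real) \<Rightarrow> ('a \<Rightarrow> real) \<Rightarrow> bool"
  where "first_order_expansion H H0 H1 \<longleftrightarrow> smooth H0 \<and> smooth H1 \<and>
    (\<exists>R. polynomial_family R \<and> (\<forall>\<kappa>. H \<kappa> = (\<lambda>x. H0 x + \<kappa> * H1 x + \<kappa>\<^sup>2 * R \<kappa> x)))"

text \<open>The product rule: the parameter enters to first order either through \<open>H\<close> or through the field.\<close>

lemma first_order_expansion_lie_derivative:
  assumes "first_order_expansion H H0 H1" and "smooth A" "smooth B"
  shows "first_order_expansion (\<lambda>\<kappa>. lie_derivative (\<lambda>x. a *\<^sub>R A x + (\<kappa> * c) *\<^sub>R B x) (H \<kappa>))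
    (\<lambda>x. a * lie_derivative A H0 x) (\<lambda>x. a * lie_derivative A H1 x + c * lie_derivative B H0 x)"
proof -
  obtain R where s: "smooth H0" "smooth H1" and R: "polynomial_family R"
    and H: "\<And>\<kappa>. H \<kappa> = (\<lambda>x. H0 x + \<kappa> * H1 x + \<kappa>\<^sup>2 * R \<kappa> x)"
    using assms unfolding first_order_expansion_def by blast
  note sR = polynomial_family_smooth[OF R]
  have L: "lie_derivative X (H \<kappa>)
      = (\<lambda>x. lie_derivative X H0 x + \<kappa> * lie_derivative X H1 x + \<kappa>\<^sup>2 * lie_derivative X (R \<kappa>) x)" for X \<kappa>
    unfolding H by (simp add: lie_derivative_add lie_derivative_mult_const s sR smooth_add smooth_mult_const)
  have sH: "smooth (H \<kappa>)" for \<kappa>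
    unfolding H by (intro smooth_add smooth_mult_const s sR)
  define R' where "R' = (\<lambda>\<kappa> x. a * lie_derivative A (R \<kappa>) x + (c * lie_derivative B H1 x + c * (\<kappa> * lie_derivative B (R \<kappa>) x)))"
  have "polynomial_family R'"
    unfolding R'_def
    by (intro polynomial_family.add polynomial_family.cmult polynomial_family.param
        polynomial_family_lie_derivative polynomial_family.const R assms s smooth_lie_derivative)
  moreover have "lie_derivative (\<lambda>x. a *\<^sub>R A x + (\<kappa> * c) *\<^sub>R B x) (H \<kappa>)
      = (\<lambda>x. a * lie_derivative A H0 x + \<kappa> * (a * lie_derivative A H1 x + c * lie_derivative B H0 x) + \<kappa>\<^sup>2 * R' \<kappa> x)" for \<kappa>
    unfolding lie_derivative_linear_combination[OF sH] L R'_def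
    by (auto simp: algebra_simps power2_eq_square)
  moreover have "smooth (\<lambda>x. a * lie_derivative A H0 x)"
    "smooth (\<lambda>x. a * lie_derivative A H1 x + c * lie_derivative B H0 x)"
    by (intro smooth_add smooth_mult_const smooth_lie_derivative s assms)+
  ultimately show ?thesis unfolding first_order_expansion_def by blast
qed

text \<open>The product of \<open>m\<close> factors \<open>A\<close> in which factor number \<open>i\<close>, counted from \<open>0\<close>, is replaced by \<open>B\<close>.  These
are the terms that a perturbation of \<open>A\<close> in direction \<open>B\<close> contributes to first order.\<close>

definition single_insertion where
  "single_insertion A B W m i = (lie_derivative A ^^ i) (lie_derivative B ((lie_derivative A ^^ (m - Suc i)) W))"

lemma smooth_single_insertion:
  "smooth A \<Longrightarrow> smooth B \<Longrightarrow> smooth W \<Longrightarrow> smooth (single_insertion A B W m i)"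
  unfolding single_insertion_def by (intro smooth_lie_derivative_power smooth_lie_derivative)

lemma lie_derivative_single_insertion:
  "lie_derivative A (single_insertion A B W m i) = single_insertion A B W (Suc m) (Suc i)"
  by (simp add: single_insertion_def)

lemma single_insertion_0: "lie_derivative B ((lie_derivative A ^^ m) W) = single_insertion A B W (Suc m) 0"
  by (simp add: single_insertion_def)

text \<open>In the linear coefficient exactly one of the \<open>j + k\<close> factors contributes its perturbation.  The first sum
collects the insertions into the outer block, which acts last, the second those into the inner block.
For an empty block the truncated exponent is harmless, since the corresponding sum is empty.\<close>

lemma first_order_expansion_product:
  fixes A B :: "'a::euclidean_space \<Rightarrow> 'a" and W :: "'a \<Rightarrow> real"
  assumes "smooth A" "smooth B" "smooth W"
  shows "first_order_expansion
    (\<lambda>\<kappa>. (lie_derivative (\<lambda>x. a1 *\<^sub>R A x + (\<kappa> * c1) *\<^sub>R B x) ^^ j)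
         ((lie_derivative (\<lambda>x. a2 *\<^sub>R A x + (\<kappa> * c2) *\<^sub>R B x) ^^ k) W))
    (\<lambda>x. a1 ^ j * a2 ^ k * (lie_derivative A ^^ (j + k)) W x)
    (\<lambda>x. c1 * a1 ^ (j - 1) * a2 ^ k * (\<Sum>i<j. single_insertion A B W (j + k) i x)
       + c2 * a1 ^ j * a2 ^ (k - 1) * (\<Sum>i=j..<j+k. single_insertion A B W (j + k) i x))"
proof -
  let ?T = "single_insertion A B W"
  have sT: "smooth (?T m i)" for m i
    by (intro smooth_single_insertion assms)
  have sA: "smooth ((lie_derivative A ^^ m) W)" for m
    by (intro smooth_lie_derivative_power assms)
  have LS: "lie_derivative A (\<lambda>x. \<Sum>i\<in>I. ?T m i x) = (\<lambda>x. \<Sum>i\<in>I. ?T (Suc m) (Suc i) x)" for I m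
    by (subst lie_derivative_sum) (simp_all add: sT lie_derivative_single_insertion)
  have sS: "smooth (\<lambda>x. \<Sum>i\<in>I. ?T m i x)" for I m
    by (intro smooth_sum sT)
  show ?thesis
  proof (induction j)
    case 0
    show ?case
    proof (induction k)
      case 0
      have "polynomial_family (\<lambda>\<kappa> x. 0)" by (intro polynomial_family.const smooth_const)
      then show ?case unfolding first_order_expansion_def using assms(3) by auto
    next
      case (Suc k)
      have "first_order_expansion
        (\<lambda>\<kappa>. lie_derivative (\<lambda>x. a2 *\<^sub>R A x + (\<kappa> * c2) *\<^sub>R B x)
         ((lie_derivative (\<lambda>x. a2 *\<^sub>R A x + (\<kappa> * c2) *\<^sub>R B x) ^^ k) W))
         (\<lambda>x. a2 * lie_derivative A (\<lambda>x. a2 ^ k * (lie_derivative A ^^ k) W x) x)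
         (\<lambda>x. a2 * lie_derivative A (\<lambda>x. c2 * a2 ^ (k - 1) * (\<Sum>i<k. ?T k i x)) x
            + c2 * lie_derivative B (\<lambda>x. a2 ^ k * (lie_derivative A ^^ k) W x) x)"
        by (rule first_order_expansion_lie_derivative[OF _ assms(1,2)])
          (use Suc in \<open>simp add: lessThan_atLeast0\<close>)
      moreover have "(\<lambda>x. a2 * lie_derivative A (\<lambda>x. a2 ^ k * (lie_derivative A ^^ k) W x) x)
          = (\<lambda>x. a2 ^ Suc k * (lie_derivative A ^^ Suc k) W x)"
        by (simp add: lie_derivative_mult_const sA mult.assoc)
      moreover have "a2 * lie_derivative A (\<lambda>x. c2 * a2 ^ (k - 1) * (\<Sum>i<k. ?T k i x)) x
            + c2 * lie_derivative B (\<lambda>x. a2 ^ k * (lie_derivative A ^^ k) W x) x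
          = c2 * a2 ^ k * (\<Sum>i<Suc k. ?T (Suc k) i x)" for x
      proof -
        have "a2 * (c2 * a2 ^ (k - 1) * (\<Sum>i<k. ?T (Suc k) (Suc i) x))
            = c2 * a2 ^ k * (\<Sum>i<k. ?T (Suc k) (Suc i) x)"
          by (cases k) auto
        moreover have "lie_derivative A (\<lambda>x. c2 * a2 ^ (k - 1) * (\<Sum>i<k. ?T k i x))
            = (\<lambda>x. c2 * a2 ^ (k - 1) * (\<Sum>i<k. ?T (Suc k) (Suc i) x))"
          by (simp only: lie_derivative_mult_const[OF sS] LS)
        moreover have "lie_derivative B (\<lambda>x. a2 ^ k * (lie_derivative A ^^ k) W x)
            = (\<lambda>x. a2 ^ k * ?T (Suc k) 0 x)"
          by (simp only: lie_derivative_mult_const[OF sA] single_insertion_0)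
        ultimately show ?thesis
          unfolding sum.lessThan_Suc_shift by (simp add: algebra_simps)
      qed
      ultimately show ?case by (simp add: lessThan_atLeast0)
    qed
  next
    case (Suc j)
    let ?Hf = "\<lambda>\<kappa>. (lie_derivative (\<lambda>x. a1 *\<^sub>R A x + (\<kappa> * c1) *\<^sub>R B x) ^^ j)
         ((lie_derivative (\<lambda>x. a2 *\<^sub>R A x + (\<kappa> * c2) *\<^sub>R B x) ^^ k) W)"
    let ?Ha = "\<lambda>x. a1 ^ j * a2 ^ k * (lie_derivative A ^^ (j + k)) W x"
    let ?Hb = "\<lambda>x. c1 * a1 ^ (j - 1) * a2 ^ k * (\<Sum>i<j. ?T (j + k) i x)
       + c2 * a1 ^ j * a2 ^ (k - 1) * (\<Sum>i=j..<j+k. ?T (j + k) i x)"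
    have "first_order_expansion
        (\<lambda>\<kappa>. lie_derivative (\<lambda>x. a1 *\<^sub>R A x + (\<kappa> * c1) *\<^sub>R B x) (?Hf \<kappa>))
         (\<lambda>x. a1 * lie_derivative A ?Ha x)
         (\<lambda>x. a1 * lie_derivative A ?Hb x + c1 * lie_derivative B ?Ha x)"
      by (rule first_order_expansion_lie_derivative[OF Suc assms(1,2)])
    moreover have "(\<lambda>x. a1 * lie_derivative A ?Ha x)
          = (\<lambda>x. a1 ^ Suc j * a2 ^ k * (lie_derivative A ^^ (Suc j + k)) W x)"
      by (simp only: lie_derivative_mult_const[OF sA]) (simp add: mult.assoc)
    moreover have "a1 * lie_derivative A ?Hb x + c1 * lie_derivative B ?Ha x
        = c1 * a1 ^ (Suc j - 1) * a2 ^ k * (\<Sum>i<Suc j. ?T (Suc j + k) i x)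
       + c2 * a1 ^ Suc j * a2 ^ (k - 1) * (\<Sum>i=Suc j..<Suc j+k. ?T (Suc j + k) i x)" for x
    proof -
      have "a1 * (c1 * a1 ^ (j - 1) * a2 ^ k * (\<Sum>i<j. ?T (Suc (j + k)) (Suc i) x))
            = c1 * a1 ^ j * a2 ^ k * (\<Sum>i<j. ?T (Suc (j + k)) (Suc i) x)"
        by (cases j) auto
      moreover have "(\<Sum>i=Suc j..<Suc j+k. ?T (Suc j + k) i x) = (\<Sum>i=j..<j+k. ?T (Suc (j + k)) (Suc i) x)"
        using sum.shift_bounds_Suc_ivl[of "\<lambda>i. ?T (Suc j + k) i x" j "j + k"] by simp
      moreover have "lie_derivative A ?Hb = (\<lambda>x. c1 * a1 ^ (j - 1) * a2 ^ k * (\<Sum>i<j. ?T (Suc (j + k)) (Suc i) x)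
       + c2 * a1 ^ j * a2 ^ (k - 1) * (\<Sum>i=j..<j+k. ?T (Suc (j + k)) (Suc i) x))"
        by (simp add: lie_derivative_add lie_derivative_mult_const sS LS smooth_mult_const)
      moreover have "lie_derivative B ?Ha = (\<lambda>x. a1 ^ j * a2 ^ k * ?T (Suc (j + k)) 0 x)"
        by (simp add: lie_derivative_mult_const sA single_insertion_0)
      ultimately show ?thesis
        unfolding sum.lessThan_Suc_shift by (simp add: algebra_simps)
    qed
    ultimately show ?case by simp
  qed
qed

lemma negative_value_near_zero:
  fixes Q :: "real \<Rightarrow> real"
  assumes "\<And>\<kappa>. \<bar>\<kappa>\<bar> \<le> 1 \<Longrightarrow> \<bar>Q \<kappa> - \<kappa> * q\<bar> \<le> C * \<kappa>\<^sup>2" and "s * q < 0" "\<bar>s\<bar> = 1"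
  shows "\<exists>\<kappa>>0. Q (s * \<kappa>) < 0"
proof -
  \<comment> \<open>small enough that the linear term dominates the quadratic error\<close>
  define \<kappa> where "\<kappa> = min 1 (- (s * q) / (2 * (\<bar>C\<bar> + 1)))"
  have pos: "\<kappa> > 0" "\<kappa> \<le> 1"
    using divide_pos_pos[of "- (s * q)" "2 * (\<bar>C\<bar> + 1)"] assms(2) by (auto simp: \<kappa>_def)
  have "\<kappa> \<le> - (s * q) / (2 * (\<bar>C\<bar> + 1))" unfolding \<kappa>_def by simp
  then have bnd: "\<kappa> * (2 * (\<bar>C\<bar> + 1)) \<le> - (s * q)"
    by (subst (asm) pos_le_divide_eq) auto
  have le: "C * \<kappa> + s * q < 0"
  proof -
    have "C * \<kappa> \<le> \<bar>C\<bar> * \<kappa>" using pos by (intro mult_right_mono) auto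
    moreover have "\<kappa> * (2 * (\<bar>C\<bar> + 1)) = 2 * (\<bar>C\<bar> * \<kappa>) + 2 * \<kappa>" by (simp add: algebra_simps)
    ultimately show ?thesis
      using bnd pos assms(2) by linarith
  qed
  have "(s * \<kappa>)\<^sup>2 = \<kappa>\<^sup>2"
    using assms(3) by (metis mult.left_neutral one_power2 power2_abs power_mult_distrib)
  then have "Q (s * \<kappa>) \<le> s * \<kappa> * q + C * \<kappa>\<^sup>2"
    using assms(1)[of "s * \<kappa>"] assms(3) pos by (simp add: abs_mult)
  also have "\<dots> = \<kappa> * (C * \<kappa> + s * q)" by (simp add: algebra_simps power2_eq_square)
  also have "\<dots> < 0" using le pos by (simp add: mult_pos_neg)
  finally show ?thesis using pos by blast
qed

text \<open>If \<open>W\<close> is evaluated after following \<open>X1\<close> for time \<open>\<alpha> \<epsilon>\<close> and then \<open>X2\<close> for time \<open>\<epsilon>\<close>, this is the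
coefficient of \<open>\<epsilon>^m\<close>.  The field that is followed first stands on the left.\<close>

definition two_piece_coefficient where
  "two_piece_coefficient X1 X2 W m \<alpha> x = (\<Sum>j\<le>m. \<alpha> ^ j / (fact j * fact (m - j)) *
    (lie_derivative X1 ^^ j) ((lie_derivative X2 ^^ (m - j)) W) x :: real)"

text \<open>Assumption \<open>q0\<close> says that the coefficient vanishes for the unperturbed fields, so its sign for small \<open>\<kappa>\<close> is
governed by the term linear in \<open>\<kappa>\<close>.\<close>

lemma two_piece_coefficient_expansion:
  fixes A B :: "'a::euclidean_space \<Rightarrow> 'a" and W :: "'a \<Rightarrow> real"
  assumes "smooth A" "smooth B" "smooth W"
    and q0: "(\<Sum>j\<le>m. \<alpha> ^ j / (fact j * fact (m - j)) * (a1 ^ j * a2 ^ (m - j))) * (lie_derivative A ^^ m) W x = 0"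
  shows "\<exists>C. \<forall>\<kappa>. \<bar>\<kappa>\<bar> \<le> 1 \<longrightarrow> \<bar>two_piece_coefficient (\<lambda>x. a1 *\<^sub>R A x + (\<kappa> * c1) *\<^sub>R B x)
      (\<lambda>x. a2 *\<^sub>R A x + (\<kappa> * c2) *\<^sub>R B x) W m \<alpha> x
    - \<kappa> * (\<Sum>j\<le>m. \<alpha> ^ j / (fact j * fact (m - j)) *
        (c1 * a1 ^ (j - 1) * a2 ^ (m - j) * (\<Sum>i<j. single_insertion A B W m i x)
       + c2 * a1 ^ j * a2 ^ (m - j - 1) * (\<Sum>i=j..<m. single_insertion A B W m i x)))\<bar> \<le> C * \<kappa>\<^sup>2"
proof -
  define w where "w j = \<alpha> ^ j / (fact j * fact (m - j))" for j
  define H where "H = (\<lambda>j \<kappa>. (lie_derivative (\<lambda>x. a1 *\<^sub>R A x + (\<kappa> * c1) *\<^sub>R B x) ^^ j)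
         ((lie_derivative (\<lambda>x. a2 *\<^sub>R A x + (\<kappa> * c2) *\<^sub>R B x) ^^ (m - j)) W) x)"
  define h where "h j = c1 * a1 ^ (j - 1) * a2 ^ (m - j) * (\<Sum>i<j. single_insertion A B W m i x)
       + c2 * a1 ^ j * a2 ^ (m - j - 1) * (\<Sum>i=j..<m. single_insertion A B W m i x)" for j
  define p where "p j = a1 ^ j * a2 ^ (m - j) * (lie_derivative A ^^ m) W x" for j
  have "\<exists>C. \<forall>\<kappa>. \<bar>\<kappa>\<bar> \<le> 1 \<longrightarrow> \<bar>H j \<kappa> - p j - \<kappa> * h j\<bar> \<le> C * \<kappa>\<^sup>2" if j: "j \<le> m" for j
  proof -
    obtain R where R: "polynomial_family R"
      and eq: "\<And>\<kappa>. H j \<kappa> = p j + \<kappa> * h j + \<kappa>\<^sup>2 * R \<kappa> x"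
      using first_order_expansion_product[OF assms(1-3), where ?a1.0 = a1 and ?c1.0 = c1
          and ?a2.0 = a2 and ?c2.0 = c2 and j = j and k = "m - j",
          unfolded le_add_diff_inverse[OF j]]
      unfolding first_order_expansion_def H_def h_def p_def by (auto simp: fun_eq_iff)
    obtain C where C: "\<And>\<kappa>. \<bar>\<kappa>\<bar> \<le> 1 \<Longrightarrow> \<bar>R \<kappa> x\<bar> \<le> C"
      using polynomial_family_bounded[OF R] by blast
    have "\<bar>H j \<kappa> - p j - \<kappa> * h j\<bar> \<le> C * \<kappa>\<^sup>2" if "\<bar>\<kappa>\<bar> \<le> 1" for \<kappa>
      using mult_left_mono[OF C[OF that], of "\<kappa>\<^sup>2"] by (simp add: eq abs_mult mult.commute)
    then show ?thesis by blast
  qed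
  then obtain C where C: "\<And>j \<kappa>. j \<le> m \<Longrightarrow> \<bar>\<kappa>\<bar> \<le> 1 \<Longrightarrow> \<bar>H j \<kappa> - p j - \<kappa> * h j\<bar> \<le> C j * \<kappa>\<^sup>2"
    by metis
  have p0: "(\<Sum>j\<le>m. w j * p j) = 0"
    using q0 by (simp add: w_def p_def sum_distrib_right mult.assoc)
  have "\<bar>(\<Sum>j\<le>m. w j * H j \<kappa>) - \<kappa> * (\<Sum>j\<le>m. w j * h j)\<bar> \<le> (\<Sum>j\<le>m. \<bar>w j\<bar> * C j) * \<kappa>\<^sup>2"
    if "\<bar>\<kappa>\<bar> \<le> 1" for \<kappa>
  proof -
    have "(\<Sum>j\<le>m. w j * H j \<kappa>) - \<kappa> * (\<Sum>j\<le>m. w j * h j)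
        = (\<Sum>j\<le>m. w j * H j \<kappa>) - (\<Sum>j\<le>m. w j * p j) - \<kappa> * (\<Sum>j\<le>m. w j * h j)"
      using p0 by simp
    also have "\<dots> = (\<Sum>j\<le>m. w j * (H j \<kappa> - p j - \<kappa> * h j))"
      by (simp add: sum_distrib_left sum_subtractf sum.distrib algebra_simps)
    also have "\<bar>\<dots>\<bar> \<le> (\<Sum>j\<le>m. \<bar>w j\<bar> * (C j * \<kappa>\<^sup>2))"
      by (rule order_trans[OF sum_abs sum_mono]) (auto simp: abs_mult intro!: mult_left_mono C that)
    finally show ?thesis by (simp add: sum_distrib_right mult.assoc)
  qed
  then show ?thesis
    unfolding two_piece_coefficient_def w_def H_def h_def by blast
qed


lemma alternating_binomial_partial_sum:
  "(\<Sum>j\<le>i. (- 1) ^ j * real (Suc N choose j)) = (- 1) ^ i * real (N choose i)"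
  by (induction i) (simp_all add: algebra_simps)

text \<open>The linear coefficient for the pair \<open>\<mu> g\<close>, \<open>- \<mu> g\<close>, with \<open>T i\<close> the product that has \<open>f\<close> in position \<open>i\<close>.
Up to a common factor the weight at switching index \<open>j\<close> is \<open>(- 1)^j (N+1 choose j)\<close>, and the sign of \<open>T i\<close>
depends on whether \<open>i < j\<close>.  Summing over \<open>j\<close> first leaves a partial alternating sum of binomial
coefficients, that is, the weight of \<open>T i\<close> in the iterated bracket.\<close>

lemma switched_coefficient:
  fixes T :: "nat \<Rightarrow> real"
  shows "(\<Sum>j\<le>Suc N. 1 ^ j / (fact j * fact (Suc N - j)) *
        (1 * \<mu> ^ (j - 1) * (- \<mu>) ^ (Suc N - j) * (\<Sum>i<j. T i)
       + 1 * \<mu> ^ j * (- \<mu>) ^ (Suc N - j - 1) * (\<Sum>i=j..<Suc N. T i)))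
    = 2 * (- \<mu>) ^ N / fact (Suc N) * (\<Sum>i\<le>N. (- 1) ^ i * real (N choose i) * T i)"
proof -
  define m where "m = Suc N"
  define S where "S j = (\<Sum>i<j. T i)" for j
  define b where "b j = (- 1) ^ j * real (m choose j)" for j
  have tail: "(\<Sum>i=j..<m. T i) = S m - S j" if "j \<le> m" for j
    using sum.atLeastLessThan_concat[of 0 j m T] that by (simp add: S_def lessThan_atLeast0)
  have neg: "(- \<mu>) ^ k = (- 1) ^ k * \<mu> ^ k" for k
    by (rule power_minus)
  have sgn: "(- 1 :: real) ^ (N - j) = (- 1) ^ N * (- 1) ^ j" if "j \<le> N" for j
  proof -
    have "(- 1 :: real) ^ N = (- 1) ^ (N - j) * (- 1) ^ j"
      using that by (simp flip: power_add)
    then show ?thesis by (simp add: mult.assoc flip: power_mult_distrib)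
  qed
  have b0: "(\<Sum>j\<le>m. b j) = 0"
    unfolding b_def m_def alternating_binomial_partial_sum by simp
  have summand: "1 ^ j / (fact j * fact (m - j)) *
        (1 * \<mu> ^ (j - 1) * (- \<mu>) ^ (m - j) * (\<Sum>i<j. T i)
       + 1 * \<mu> ^ j * (- \<mu>) ^ (m - j - 1) * (\<Sum>i=j..<m. T i))
     = (- \<mu>) ^ N / fact m * (b j * (S m - 2 * S j))" if "j \<le> m" for j
  proof -
    have 1: "\<mu> ^ (j - 1) * (- \<mu>) ^ (m - j) * S j = - ((- \<mu>) ^ N * (- 1) ^ j * S j)"
    proof (cases j)
      case (Suc i)
      then have i: "i \<le> N" using that m_def by simp
      then have "\<mu> ^ i * \<mu> ^ (N - i) = \<mu> ^ N" by (simp flip: power_add)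
      then show ?thesis using sgn[OF i] by (simp add: Suc m_def neg)
    qed (simp add: S_def)
    have 2: "\<mu> ^ j * (- \<mu>) ^ (m - j - 1) * (S m - S j) = (- \<mu>) ^ N * (- 1) ^ j * (S m - S j)"
    proof (cases "j = m")
      case False
      then have i: "j \<le> N" using that m_def by simp
      then have "\<mu> ^ j * \<mu> ^ (N - j) = \<mu> ^ N" by (simp flip: power_add)
      moreover have "m - j - 1 = N - j" using m_def by simp
      ultimately show ?thesis using sgn[OF i] by (simp add: neg)
    qed simp
    have "real (m choose j) = fact m / (fact j * fact (m - j))"
      using that by (rule binomial_fact)
    then have 3: "1 ^ j / (fact j * fact (m - j)) = real (m choose j) / fact m" by simp
    show ?thesis
      unfolding tail[OF that] S_def[symmetric] 3 mult_1 1 2 b_def by (simp add: algebra_simps add_divide_distrib)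
  qed
  have inner: "(\<Sum>j\<le>m. if i < j then b j else 0) = - ((- 1) ^ i * real (N choose i))" if "i < m" for i
  proof -
    have "(\<Sum>j\<le>m. b j) = (\<Sum>j\<le>m. if i < j then b j else 0) + (\<Sum>j\<le>m. if j \<le> i then b j else 0)"
      unfolding sum.distrib[symmetric] by (rule sum.cong) auto
    also have "(\<Sum>j\<le>m. if j \<le> i then b j else 0) = (\<Sum>j\<in>{..m} \<inter> {j. j \<le> i}. b j)"
      by (subst sum.inter_restrict) auto
    also have "{..m} \<inter> {j. j \<le> i} = {..i}" using that by auto
    also have "sum b {..i} = (- 1) ^ i * real (N choose i)"
      unfolding b_def m_def by (rule alternating_binomial_partial_sum)
    finally show ?thesis using b0 by simp
  qed
  have "(\<Sum>j\<le>m. b j * S j) = (\<Sum>j\<le>m. \<Sum>i<m. T i * (if i < j then b j else 0))"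
  proof (rule sum.cong)
    fix j assume "j \<in> {..m}"
    then have "{..<m} \<inter> {i. i < j} = {..<j}" by auto
    then have "S j = (\<Sum>i<m. if i < j then T i else 0)"
      unfolding S_def using sum.inter_restrict[of "{..<m}" T "{i. i < j}"] by simp
    then show "b j * S j = (\<Sum>i<m. T i * (if i < j then b j else 0))"
      by (auto simp: sum_distrib_left intro!: sum.cong)
  qed simp
  also have "\<dots> = (\<Sum>i<m. T i * (\<Sum>j\<le>m. if i < j then b j else 0))"
    by (subst sum.swap) (simp add: sum_distrib_left)
  also have "\<dots> = - (\<Sum>i<m. (- 1) ^ i * real (N choose i) * T i)"
    by (simp add: inner sum_negf[symmetric] mult.commute mult.left_commute)
  finally have bS: "(\<Sum>j\<le>m. b j * S j) = - (\<Sum>i\<le>N. (- 1) ^ i * real (N choose i) * T i)"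
    by (simp add: m_def lessThan_Suc_atMost)
  have "(\<Sum>j\<le>m. b j * (S m - 2 * S j)) = S m * (\<Sum>j\<le>m. b j) - 2 * (\<Sum>j\<le>m. b j * S j)"
    by (simp add: sum_distrib_left sum_subtractf algebra_simps)
  then have "(\<Sum>j\<le>m. (- \<mu>) ^ N / fact m * (b j * (S m - 2 * S j)))
      = 2 * (- \<mu>) ^ N / fact m * (\<Sum>i\<le>N. (- 1) ^ i * real (N choose i) * T i)"
    unfolding sum_distrib_left[symmetric] using bS b0 by simp
  then show ?thesis
    unfolding m_def[symmetric] using summand by simp
qed

lemma lie_derivative_power_scaled_field:
  fixes W :: "'a::euclidean_space \<Rightarrow> real"
  assumes "smooth X" "smooth W"
  shows "(lie_derivative (\<lambda>x. c *\<^sub>R X x) ^^ k) W = (\<lambda>x. c ^ k * (lie_derivative X ^^ k) W x)"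
proof (induction k)
  case (Suc k)
  have s: "smooth ((lie_derivative X ^^ k) W)" by (intro smooth_lie_derivative_power assms)
  show ?case
    by (simp add: Suc lie_derivative_mult_const[OF s] lie_derivative_scaled_field[OF s]
        lie_derivative_scaled_field[OF smooth_mult_const[OF s]] mult_ac)
qed simp

text \<open>Multiplying both fields by \<open>c\<close> amounts to rescaling time, and the coefficient belongs to the power \<open>m\<close> of time.\<close>

lemma two_piece_coefficient_scaled:
  fixes W :: "'a::euclidean_space \<Rightarrow> real"
  assumes "smooth X1" "smooth X2" "smooth W"
  shows "two_piece_coefficient (\<lambda>x. c *\<^sub>R X1 x) (\<lambda>x. c *\<^sub>R X2 x) W m \<alpha> x
    = c ^ m * two_piece_coefficient X1 X2 W m \<alpha> x"
proof -
  have "(lie_derivative (\<lambda>x. c *\<^sub>R X1 x) ^^ j) ((lie_derivative (\<lambda>x. c *\<^sub>R X2 x) ^^ (m - j)) W) x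
      = c ^ m * (lie_derivative X1 ^^ j) ((lie_derivative X2 ^^ (m - j)) W) x" if "j \<le> m" for j
  proof -
    have s: "smooth ((lie_derivative X2 ^^ (m - j)) W)" by (intro smooth_lie_derivative_power assms)
    have p: "(lie_derivative X1 ^^ j) (\<lambda>x. d * F x) = (\<lambda>x. d * (lie_derivative X1 ^^ j) F x)"
      if "smooth F" for d and F :: "'a \<Rightarrow> real"
      by (induction j) (simp_all add: lie_derivative_mult_const smooth_lie_derivative_power assms that)
    have "c ^ j * c ^ (m - j) = c ^ m" using that by (simp flip: power_add)
    then show ?thesis
      unfolding lie_derivative_power_scaled_field[OF assms(2,3)]
        lie_derivative_power_scaled_field[OF assms(1) smooth_mult_const[OF s]] p[OF s]
      by (simp flip: mult.assoc)
  qed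
  then show ?thesis
    unfolding two_piece_coefficient_def by (simp add: sum_distrib_left algebra_simps)
qed

lemma two_piece_coefficient_0:
  "two_piece_coefficient X1 X2 W m 0 x = (lie_derivative X2 ^^ m) W x / fact m"
proof -
  have "two_piece_coefficient X1 X2 W m 0 x
      = (\<Sum>j\<le>m. if j = 0 then (lie_derivative X2 ^^ m) W x / fact m else 0)"
    unfolding two_piece_coefficient_def by (rule sum.cong) auto
  then show ?thesis by simp
qed

abbreviation control_field :: "('a::euclidean_space \<Rightarrow> 'a) \<Rightarrow> ('a \<Rightarrow> 'a) \<Rightarrow> real \<Rightarrow> 'a \<Rightarrow> 'a"
  where "control_field f g u \<equiv> \<lambda>x. f x + u *\<^sub>R g x"

text \<open>Up to the time scale \<open>\<kappa>\<close>, the controls \<open>\<mu>/\<kappa>\<close> and \<open>- \<mu>/\<kappa>\<close> produce the fields \<open>\<mu> g + \<kappa> f\<close> and \<open>- \<mu> g + \<kappa> f\<close>.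
For \<open>\<kappa> = 0\<close> the second flow undoes the first and the coefficient vanishes; to first order in \<open>\<kappa>\<close> the field
\<open>f\<close> is seen through the flow of \<open>g\<close>, which brings in the iterated bracket.\<close>

lemma switched_descent:
  fixes f g :: "'a::euclidean_space \<Rightarrow> 'a" and V :: "'a \<Rightarrow> real"
  assumes "smooth f" "smooth g" "smooth V"
    and neg: "(- \<mu>) ^ N * lie_derivative (iterated_bracket N f g) V x < 0"
  shows "\<exists>u1 u2. two_piece_coefficient (control_field f g u1) (control_field f g u2) V (Suc N) 1 x < 0"
proof -
  let ?m = "Suc N"
  define Q where "Q \<kappa> = two_piece_coefficient (\<lambda>x. \<mu> *\<^sub>R g x + (\<kappa> * 1) *\<^sub>R f x)
    (\<lambda>x. (- \<mu>) *\<^sub>R g x + (\<kappa> * 1) *\<^sub>R f x) V ?m 1 x" for \<kappa>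
  define q where "q = 2 * (- \<mu>) ^ N / fact ?m * lie_derivative (iterated_bracket N f g) V x"
  have q: "q = (\<Sum>j\<le>?m. 1 ^ j / (fact j * fact (?m - j)) *
        (1 * \<mu> ^ (j - 1) * (- \<mu>) ^ (?m - j) * (\<Sum>i<j. single_insertion g f V ?m i x)
       + 1 * \<mu> ^ j * (- \<mu>) ^ (?m - j - 1) * (\<Sum>i=j..<?m. single_insertion g f V ?m i x)))"
    unfolding switched_coefficient q_def lie_derivative_iterated_bracket[OF assms(1-3)]
    by (simp add: single_insertion_def)
  have "(\<Sum>j\<le>?m. 1 ^ j / (fact j * fact (?m - j)) * (\<mu> ^ j * (- \<mu>) ^ (?m - j)))
      = (\<mu> + (- \<mu>)) ^ ?m / fact ?m"
    unfolding binomial_ring sum_divide_distrib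
    by (rule sum.cong) (auto simp: binomial_fact)
  then have q0: "(\<Sum>j\<le>?m. 1 ^ j / (fact j * fact (?m - j)) * (\<mu> ^ j * (- \<mu>) ^ (?m - j)))
      * (lie_derivative g ^^ ?m) V x = 0" by simp
  obtain C where C: "\<And>\<kappa>. \<bar>\<kappa>\<bar> \<le> 1 \<Longrightarrow> \<bar>Q \<kappa> - \<kappa> * q\<bar> \<le> C * \<kappa>\<^sup>2"
    unfolding Q_def q
    using two_piece_coefficient_expansion[OF assms(2,1,3) q0, where ?c1.0 = 1 and ?c2.0 = 1] by blast
  have "q = 2 / fact ?m * ((- \<mu>) ^ N * lie_derivative (iterated_bracket N f g) V x)"
    by (simp add: q_def)
  also have "\<dots> < 0" by (rule mult_pos_neg[OF _ neg]) simp
  finally have "1 * q < 0" by simp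
  from negative_value_near_zero[OF C this] obtain \<kappa> where \<kappa>: "\<kappa> > 0" "Q \<kappa> < 0" by auto
  have e: "(\<lambda>x. f x + (c / \<kappa>) *\<^sub>R g x) = (\<lambda>x. (1 / \<kappa>) *\<^sub>R (c *\<^sub>R g x + (\<kappa> * 1) *\<^sub>R f x))" for c
    using \<kappa> by (auto simp: scaleR_add_right)
  have "two_piece_coefficient (\<lambda>x. f x + (\<mu> / \<kappa>) *\<^sub>R g x) (\<lambda>x. f x + (- \<mu> / \<kappa>) *\<^sub>R g x) V ?m 1 x
      = (1 / \<kappa>) ^ ?m * Q \<kappa>"
    unfolding e Q_def
    by (rule two_piece_coefficient_scaled) (intro smooth_linear_combination assms)+
  also have "\<dots> < 0" using \<kappa> by (intro mult_pos_neg) auto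
  finally show ?thesis by blast
qed

text \<open>The control is \<open>0\<close> for time \<open>\<alpha> \<epsilon>\<close> and then a small constant \<open>u\<close>, whose linear coefficient can be given either
sign once it is nonzero.  As a polynomial in the delay \<open>\<alpha>\<close> its coefficients are multiples of the tail sums of
\<open>f^i g f^(N-i) V(x)\<close>; if all of these vanished, so would each product and hence the bracket.\<close>

lemma delayed_descent:
  fixes f g :: "'a::euclidean_space \<Rightarrow> 'a" and V :: "'a \<Rightarrow> real"
  assumes "smooth f" "smooth g" "smooth V"
    and zero: "(lie_derivative f ^^ Suc N) V x = 0"
    and nz: "lie_derivative (iterated_bracket N g f) V x \<noteq> 0"
  shows "\<exists>\<alpha>>0. \<exists>u. two_piece_coefficient f (control_field f g u) V (Suc N) \<alpha> x < 0"
proof -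
  let ?m = "Suc N"
  define T where "T = (\<lambda>i. single_insertion f g V ?m i x)"
  define c where "c j = (\<Sum>i=j..<?m. T i) / (fact j * fact (?m - j))" for j
  define q where "q \<alpha> = (\<Sum>j\<le>?m. c j * \<alpha> ^ j)" for \<alpha>
  have "\<exists>\<alpha>>0. q \<alpha> \<noteq> 0"
  proof (rule ccontr)
    assume "\<not> ?thesis"
    then have "{0<..} \<subseteq> {\<alpha>. q \<alpha> = 0}" by auto
    then have "infinite {\<alpha>. q \<alpha> = 0}"
      using infinite_Ioi[of "0::real"] finite_subset by blast
    then have c: "c j = 0" if "j \<le> ?m" for j
      using polyfun_finite_roots[of c ?m] that unfolding q_def by blast
    then have tail: "(\<Sum>i=j..<?m. T i) = 0" if "j \<le> ?m" for j
      using that c[of j] by (simp add: c_def del: sum.op_ivl_Suc)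
    have "T j = 0" if "j \<le> N" for j
      using tail[of j] tail[of "Suc j"] that sum.atLeast_Suc_lessThan[of j ?m T] by simp
    then have "lie_derivative (iterated_bracket N g f) V x = 0"
      unfolding lie_derivative_iterated_bracket[OF assms(2,1,3)]
      by (intro sum.neutral) (auto simp: T_def single_insertion_def)
    with nz show False by blast
  qed
  then obtain \<alpha> where \<alpha>: "\<alpha> > 0" "q \<alpha> \<noteq> 0" by blast
  define Q where "Q \<kappa> = two_piece_coefficient (\<lambda>x. 1 *\<^sub>R f x + (\<kappa> * 0) *\<^sub>R g x)
    (\<lambda>x. 1 *\<^sub>R f x + (\<kappa> * 1) *\<^sub>R g x) V ?m \<alpha> x" for \<kappa>
  have q: "q \<alpha> = (\<Sum>j\<le>?m. \<alpha> ^ j / (fact j * fact (?m - j)) *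
        (0 * 1 ^ (j - 1) * 1 ^ (?m - j) * (\<Sum>i<j. single_insertion f g V ?m i x)
       + 1 * 1 ^ j * 1 ^ (?m - j - 1) * (\<Sum>i=j..<?m. single_insertion f g V ?m i x)))"
    unfolding q_def c_def T_def by (rule sum.cong) auto
  have q0: "(\<Sum>j\<le>?m. \<alpha> ^ j / (fact j * fact (?m - j)) * (1 ^ j * 1 ^ (?m - j)))
      * (lie_derivative f ^^ ?m) V x = 0" using zero by simp
  obtain C where C: "\<And>\<kappa>. \<bar>\<kappa>\<bar> \<le> 1 \<Longrightarrow> \<bar>Q \<kappa> - \<kappa> * q \<alpha>\<bar> \<le> C * \<kappa>\<^sup>2"
    unfolding Q_def q
    using two_piece_coefficient_expansion[OF assms(1,2,3) q0, where ?c1.0 = 0 and ?c2.0 = 1] by blast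
  have "\<exists>\<kappa>>0. Q (- sgn (q \<alpha>) * \<kappa>) < 0"
    by (rule negative_value_near_zero[OF C]) (use \<alpha> in \<open>auto simp: sgn_if\<close>)
  then obtain \<kappa> where "Q (- sgn (q \<alpha>) * \<kappa>) < 0" by blast
  then show ?thesis
    using \<alpha>(1) unfolding Q_def mult_1_right mult_zero_right scaleR_one scaleR_zero_left add_0_right by blast
qed


section \<open>Two constant controls that decrease the function to leading order\<close>

lemma span_subset_lie_algebra: "span {f, g} \<subseteq> lie_algebra f g"
  unfolding lie_algebra_def by (rule span_minimal) (auto simp: hull_def subspace_Inter hull_subset intro!: subspace_Inter)

lemma lie_order_span:
  assumes "\<Delta> \<in> span {f, g}" "\<Delta> \<noteq> 0"
  shows "lie_order f g \<Delta> = 1"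
  unfolding lie_order_def
proof (rule Least_equality)
  show "has_lie_order f g \<Delta> 1" using assms by (simp add: has_lie_order_def)
  show "1 \<le> k" if "has_lie_order f g \<Delta> k" for k
    using that by (auto simp: has_lie_order_def)
qed

lemma smooth_span:
  assumes "smooth f" "smooth g" "\<Delta> \<in> span {f, g}"
  shows "smooth \<Delta>"
  using assms(3)
proof (induction rule: span_induct)
  show "subspace {X. smooth X}"
    by (auto simp: subspace_def zero_fun_def plus_fun_def scaleR_fun_def smooth_add smooth_cmult)
qed (use assms in auto)

lemma smooth_foldr_lie_derivative:
  assumes "\<And>\<Delta>. \<Delta> \<in> set \<Delta>s \<Longrightarrow> smooth \<Delta>" "smooth W"
  shows "smooth (foldr lie_derivative \<Delta>s W)"
  using assms by (induction \<Delta>s) (auto intro: smooth_lie_derivative)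

lemma foldr_lie_derivative_zero_field:
  fixes W :: "'a::euclidean_space \<Rightarrow> real"
  assumes "\<And>\<Delta>. \<Delta> \<in> set \<Delta>s \<Longrightarrow> smooth \<Delta>" "smooth W" "0 \<in> set \<Delta>s"
  shows "foldr lie_derivative \<Delta>s W = (\<lambda>x. 0)"
  using assms
proof (induction \<Delta>s)
  case (Cons \<Delta> \<Delta>s)
  have s: "smooth (foldr lie_derivative \<Delta>s W)"
    using Cons.prems by (intro smooth_foldr_lie_derivative) auto
  show ?case
  proof (cases "0 \<in> set \<Delta>s")
    case True
    then have "foldr lie_derivative \<Delta>s W = (\<lambda>x. 0)"
      by (intro Cons.IH) (use Cons.prems True in \<open>auto simp: zero_fun_def\<close>)
    then show ?thesis by (simp add: lie_derivative_const)
  next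
    case False
    then have "\<Delta> = (\<lambda>x. 0 *\<^sub>R 0)" using Cons.prems by (auto simp: zero_fun_def)
    then show ?thesis using lie_derivative_scaled_field[OF s, of 0 "\<lambda>x. 0"] by simp
  qed
qed simp

lemma foldr_lie_derivative_scaled:
  fixes W :: "'a::euclidean_space \<Rightarrow> real"
  assumes "\<And>\<Delta>. \<Delta> \<in> set \<Delta>s \<Longrightarrow> smooth \<Delta>" "smooth W"
  shows "foldr lie_derivative (map (\<lambda>\<Delta>. c \<Delta> *\<^sub>R \<Delta>) \<Delta>s) W
    = (\<lambda>x. (\<Prod>\<Delta>\<leftarrow>\<Delta>s. c \<Delta>) * foldr lie_derivative \<Delta>s W x)"
  using assms
proof (induction \<Delta>s)
  case (Cons \<Delta> \<Delta>s)
  have s: "smooth (foldr lie_derivative \<Delta>s W)"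
    using Cons.prems by (intro smooth_foldr_lie_derivative) auto
  have "lie_derivative (c \<Delta> *\<^sub>R \<Delta>) F = (\<lambda>x. c \<Delta> * lie_derivative \<Delta> F x)"
    if "smooth F" for F :: "'a \<Rightarrow> real"
    using lie_derivative_scaled_field[OF that, of "c \<Delta>" \<Delta>] by (simp add: scaleR_fun_def)
  from this[OF smooth_mult_const[OF s]] show ?case
    using Cons by (simp add: lie_derivative_mult_const[OF s] mult_ac)
qed simp

text \<open>Removing \<open>g\<close> from the Lie algebra removes this one vector field but not its multiples.  Scaling each
nonzero factor by \<open>1\<close> or \<open>2\<close> therefore avoids \<open>g\<close>, keeps the order equal to \<open>1\<close>, and changes the product
only by a nonzero constant.\<close>

lemma vanishing_products:
  fixes f g :: "'a::euclidean_space \<Rightarrow> 'a" and V :: "'a \<Rightarrow> real"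
  assumes "smooth f" "smooth g" "smooth V"
    and hyp: "\<forall>\<Delta>s. \<Delta>s \<noteq> [] \<and> set \<Delta>s \<subseteq> (lie_algebra f g - {0}) - {g} \<and>
            (\<Sum>\<Delta>\<leftarrow>\<Delta>s. lie_order f g \<Delta>) \<le> N \<longrightarrow> foldr lie_derivative \<Delta>s V x = 0"
    and \<Delta>s: "\<Delta>s \<noteq> []" "set \<Delta>s \<subseteq> span {f, g}" "length \<Delta>s \<le> N"
  shows "foldr lie_derivative \<Delta>s V x = 0"
proof (cases "0 \<in> set \<Delta>s")
  case True
  then have "foldr lie_derivative \<Delta>s V = (\<lambda>x. 0)"
    by (intro foldr_lie_derivative_zero_field assms(3)) (use \<Delta>s(2) in \<open>auto intro: smooth_span[OF assms(1,2)]\<close>)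
  then show ?thesis by simp
next
  case False
  define c where "c \<Delta> = (if \<Delta> = g then 2 else 1 :: real)" for \<Delta>
  have g2: "2 *\<^sub>R g \<noteq> g" if "g \<noteq> 0"
  proof
    assume "2 *\<^sub>R g = g"
    then have "(2 - 1) *\<^sub>R g = 0" by (subst scaleR_left_diff_distrib) simp
    with that show False by simp
  qed
  have mem: "c \<Delta> *\<^sub>R \<Delta> \<in> span {f, g} \<and> c \<Delta> *\<^sub>R \<Delta> \<noteq> 0 \<and> c \<Delta> *\<^sub>R \<Delta> \<noteq> g" if "\<Delta> \<in> set \<Delta>s" for \<Delta>
  proof -
    have "\<Delta> \<noteq> 0" "\<Delta> \<in> span {f, g}" using that False \<Delta>s by auto
    then show ?thesis using g2 by (auto simp: c_def span_scale)
  qed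
  let ?\<Delta>s = "map (\<lambda>\<Delta>. c \<Delta> *\<^sub>R \<Delta>) \<Delta>s"
  have "(\<Sum>\<Delta>\<leftarrow>?\<Delta>s. lie_order f g \<Delta>) = (\<Sum>\<Delta>\<leftarrow>\<Delta>s. 1)"
    unfolding map_map
  proof (intro arg_cong[of _ _ sum_list] map_cong refl)
    fix \<Delta> assume "\<Delta> \<in> set \<Delta>s"
    with mem lie_order_span show "(lie_order f g \<circ> (\<lambda>\<Delta>. c \<Delta> *\<^sub>R \<Delta>)) \<Delta> = 1"
      unfolding o_def by blast
  qed
  also have "\<dots> = length \<Delta>s" by (simp add: sum_list_triv)
  finally have "(\<Sum>\<Delta>\<leftarrow>?\<Delta>s. lie_order f g \<Delta>) \<le> N" using \<Delta>s by simp
  moreover have "set ?\<Delta>s \<subseteq> (lie_algebra f g - {0}) - {g}"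
    using mem span_subset_lie_algebra by fastforce
  ultimately have "foldr lie_derivative ?\<Delta>s V x = 0" using hyp \<Delta>s(1) by blast
  moreover have "foldr lie_derivative ?\<Delta>s V = (\<lambda>x. (\<Prod>\<Delta>\<leftarrow>\<Delta>s. c \<Delta>) * foldr lie_derivative \<Delta>s V x)"
    by (intro foldr_lie_derivative_scaled assms(3)) (use \<Delta>s(2) in \<open>auto intro: smooth_span[OF assms(1,2)]\<close>)
  moreover have "(\<Prod>\<Delta>\<leftarrow>\<Delta>s. c \<Delta>) \<noteq> 0"
    by (auto simp: prod_list_zero_iff c_def)
  ultimately show ?thesis by simp
qed

lemma control_field_in_span: "(control_field f g u) \<in> span {f, g}"
proof -
  have "f + u *\<^sub>R g \<in> span {f, g}"
    by (intro span_add span_scale span_base) auto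
  then show ?thesis by (simp add: plus_fun_def scaleR_fun_def)
qed

text \<open>The case distinction over the alternatives.  In cases (i) and (ii) and under (P1) a single constant control
is enough, which is the choice \<open>\<alpha> = 0\<close>, with an empty first piece.\<close>

lemma descent_pair:
  fixes f g :: "'a::euclidean_space \<Rightarrow> 'a" and V :: "'a \<Rightarrow> real"
  assumes "smooth f" "smooth g" "smooth V"
    and alt: "lie_derivative g V x \<noteq> 0 \<or>
      (lie_derivative g V x = 0 \<and> lie_derivative f V x < 0) \<or>
      (\<exists>N\<ge>1.
        lie_derivative g V x = 0 \<and>
        (\<forall>i\<in>{1..N}. (lie_derivative f ^^ i) V x = 0) \<and>
        (\<forall>\<Delta>s. \<Delta>s \<noteq> [] \<and> set \<Delta>s \<subseteq> (lie_algebra f g - {0}) - {g} \<and>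
            (\<Sum>\<Delta>\<leftarrow>\<Delta>s. lie_order f g \<Delta>) \<le> N \<longrightarrow>
          foldr lie_derivative \<Delta>s V x = 0) \<and>
        ((lie_derivative f ^^ (N + 1)) V x < 0 \<or>
         (odd N \<and> lie_derivative (iterated_bracket N f g) V x \<noteq> 0) \<or>
         (even N \<and> lie_derivative (iterated_bracket N f g) V x < 0) \<or>
         ((lie_derivative f ^^ (N + 1)) V x = 0 \<and>
          lie_derivative (iterated_bracket N g f) V x \<noteq> 0)))"
  obtains \<alpha> u1 u2 m where "\<alpha> \<ge> 0" "m \<ge> 1"
    and "\<And>j k. 0 < j + k \<Longrightarrow> j + k < m \<Longrightarrow>
      (lie_derivative (control_field f g u1) ^^ j) ((lie_derivative (control_field f g u2) ^^ k) V) x = 0"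
    and "two_piece_coefficient (control_field f g u1) (control_field f g u2) V m \<alpha> x < 0"
proof -
  have L: "lie_derivative (control_field f g u) V x = lie_derivative f V x + u * lie_derivative g V x" for u
    using lie_derivative_linear_combination[OF assms(3), of 1 f u g] by simp
  consider (1) "lie_derivative g V x \<noteq> 0" | (2) "lie_derivative f V x < 0"
    | (3) N where "\<forall>\<Delta>s. \<Delta>s \<noteq> [] \<and> set \<Delta>s \<subseteq> (lie_algebra f g - {0}) - {g} \<and>
            (\<Sum>\<Delta>\<leftarrow>\<Delta>s. lie_order f g \<Delta>) \<le> N \<longrightarrow> foldr lie_derivative \<Delta>s V x = 0"
        "((lie_derivative f ^^ (N + 1)) V x < 0 \<or>
         (odd N \<and> lie_derivative (iterated_bracket N f g) V x \<noteq> 0) \<or>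
         (even N \<and> lie_derivative (iterated_bracket N f g) V x < 0) \<or>
         ((lie_derivative f ^^ (N + 1)) V x = 0 \<and>
          lie_derivative (iterated_bracket N g f) V x \<noteq> 0))"
    using alt by blast
  then show ?thesis
  proof cases
    case 1
    \<comment> \<open>normalized so that the derivative of \<open>V\<close> along the controlled field is \<open>- 1\<close>\<close>
    let ?u = "- (lie_derivative f V x + 1) / lie_derivative g V x"
    have "lie_derivative f V x + ?u * lie_derivative g V x = - 1"
      using 1 by simp
    then show ?thesis
      by (intro that[where \<alpha> = 0 and m = 1 and ?u2.0 = ?u]) (auto simp: two_piece_coefficient_0 L)
  next
    case 2
    then show ?thesis
      by (intro that[where \<alpha> = 0 and m = 1 and ?u2.0 = 0]) (auto simp: two_piece_coefficient_0)
  next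
    case (3 N)
    let ?X = "control_field f g"
    have van: "(lie_derivative (?X u1) ^^ j) ((lie_derivative (?X u2) ^^ k) V) x = 0"
      if "0 < j + k" "j + k < Suc N" for j k u1 u2
      using vanishing_products[OF assms(1-3) 3(1), of "replicate j (?X u1) @ replicate k (?X u2)"]
        control_field_in_span[of f _ g] that
      by (auto simp: set_replicate_conv_if)
    have "\<exists>\<alpha>\<ge>0. \<exists>u1 u2. two_piece_coefficient (?X u1) (?X u2) V (Suc N) \<alpha> x < 0"
    proof -
      consider (a) "(lie_derivative f ^^ (N + 1)) V x < 0"
        | (b) "odd N" "lie_derivative (iterated_bracket N f g) V x \<noteq> 0"
        | (c) "even N" "lie_derivative (iterated_bracket N f g) V x < 0"
        | (d) "(lie_derivative f ^^ Suc N) V x = 0" "lie_derivative (iterated_bracket N g f) V x \<noteq> 0"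
        using 3(2) by auto
      then show ?thesis
      proof cases
        case a
        then have "two_piece_coefficient (?X 0) (?X 0) V (Suc N) 0 x < 0"
          by (simp add: two_piece_coefficient_0 divide_neg_pos del: funpow.simps)
        then show ?thesis by blast
      next
        case b
        let ?\<mu> = "sgn (lie_derivative (iterated_bracket N f g) V x)"
        have "(- ?\<mu>) ^ N * lie_derivative (iterated_bracket N f g) V x < 0"
          using b by (auto simp: sgn_if)
        from switched_descent[OF assms(1-3) this] show ?thesis by (meson zero_le_one)
      next
        case c
        then have "(- 1) ^ N * lie_derivative (iterated_bracket N f g) V x < 0" by simp
        from switched_descent[OF assms(1-3) this] show ?thesis by (meson zero_le_one)
      next
        case d
        then obtain \<alpha> u where "\<alpha> > 0" "two_piece_coefficient f (?X u) V (Suc N) \<alpha> x < 0"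
          using delayed_descent[OF assms(1-3)] by blast
        moreover have "f = ?X 0" by simp
        ultimately show ?thesis by (metis less_imp_le)
      qed
    qed
    then obtain \<alpha> u1 u2 where "\<alpha> \<ge> 0" "two_piece_coefficient (?X u1) (?X u2) V (Suc N) \<alpha> x < 0"
      by blast
    then show ?thesis using that[of \<alpha> "Suc N" u1 u2, OF _ _ van] by simp
  qed
qed


section \<open>Local solutions of ordinary differential equations\<close>

lemma continuous_on_cball_bounded:
  fixes X :: "'a::euclidean_space \<Rightarrow> 'b::real_normed_vector"
  assumes "continuous_on (cball x r) X"
  obtains M where "M > 0" "\<And>y. y \<in> cball x r \<Longrightarrow> norm (X y) \<le> M"
proof -
  have "bounded (X ` cball x r)"
    by (intro compact_imp_bounded compact_continuous_image assms) auto
  then show ?thesis using that by (auto simp: bounded_pos)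
qed

lemma smooth_Lipschitz_on_cball:
  fixes X :: "'a::euclidean_space \<Rightarrow> 'b::euclidean_space"
  assumes "smooth X"
  obtains K where "K > 0" "\<And>y z. y \<in> cball x r \<Longrightarrow> z \<in> cball x r \<Longrightarrow> norm (X y - X z) \<le> K * norm (y - z)"
proof -
  have "continuous_on (cball x r) (\<lambda>y. \<Sum>b\<in>Basis. norm (frechet_derivative X (at y) b))"
    by (intro continuous_on_sum continuous_on_norm smooth_continuous_on smooth_directional_derivative assms)
  then obtain B where "\<And>y. y \<in> cball x r \<Longrightarrow> norm (\<Sum>b\<in>Basis. norm (frechet_derivative X (at y) b)) \<le> B"
    using continuous_on_cball_bounded by blast
  then have B: "(\<Sum>b\<in>Basis. norm (frechet_derivative X (at y) b)) \<le> B" if "y \<in> cball x r" for y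
    using that by fastforce
  have on: "onorm (frechet_derivative X (at y)) \<le> \<bar>B\<bar> + 1" if "y \<in> cball x r" for y
  proof (rule onorm_bound)
    fix v
    have "norm (frechet_derivative X (at y) v) = norm (\<Sum>b\<in>Basis. (v \<bullet> b) *\<^sub>R frechet_derivative X (at y) b)"
      by (subst frechet_derivative_Basis_expansion[OF assms]) simp
    also have "\<dots> \<le> (\<Sum>b\<in>Basis. norm v * norm (frechet_derivative X (at y) b))"
      by (rule sum_norm_le) (auto intro: mult_right_mono Basis_le_norm)
    also have "\<dots> = norm v * (\<Sum>b\<in>Basis. norm (frechet_derivative X (at y) b))"
      by (simp add: sum_distrib_left)
    also have "\<dots> \<le> norm v * (\<bar>B\<bar> + 1)"
      using B[OF that] by (intro mult_left_mono) auto
    finally show "norm (frechet_derivative X (at y) v) \<le> (\<bar>B\<bar> + 1) * norm v"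
      by (simp add: mult.commute)
  qed simp
  have "norm (X y - X z) \<le> (\<bar>B\<bar> + 1) * norm (y - z)" if "y \<in> cball x r" "z \<in> cball x r" for y z
    by (rule differentiable_bound[OF convex_cball _ on that])
      (auto intro: has_derivative_at_withinI smooth_has_derivative assms)
  then show ?thesis by (intro that[of "\<bar>B\<bar> + 1"]) auto
qed

definition solution_on where
  "solution_on X h \<phi> \<longleftrightarrow> (\<forall>t\<in>{0..h}. (\<phi> has_vector_derivative X (\<phi> t)) (at t within {0..h}))"

lemma solution_on_continuous: "solution_on X h \<phi> \<Longrightarrow> continuous_on {0..h} \<phi>"
  unfolding solution_on_def continuous_on_eq_continuous_within
  using has_vector_derivative_continuous by blast

lemma solution_on_subinterval: "solution_on X h \<phi> \<Longrightarrow> h' \<le> h \<Longrightarrow> solution_on X h' \<phi>"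
  unfolding solution_on_def by (auto intro: has_vector_derivative_within_subset[of _ _ _ "{0..h}"])

lemma increment_bound:
  fixes \<phi> :: "real \<Rightarrow> 'a::euclidean_space"
  assumes "\<And>s. s \<in> {0..h} \<Longrightarrow> (\<phi> has_vector_derivative \<phi>' s) (at s within {0..h})"
    and "\<And>s. s \<in> {0..h} \<Longrightarrow> norm (\<phi>' s) \<le> B" and "t \<in> {0..h}"
  shows "norm (\<phi> t - \<phi> 0) \<le> B * t"
proof -
  have "norm (\<phi> t - \<phi> 0) \<le> B * norm (t - 0)"
  proof (rule differentiable_bound[of "{0..h}" \<phi> "\<lambda>s v. v *\<^sub>R \<phi>' s"])
    show "onorm (\<lambda>v. v *\<^sub>R \<phi>' s) \<le> B" if "s \<in> {0..h}" for s
    proof (rule onorm_bound)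
      show "norm (v *\<^sub>R \<phi>' s) \<le> B * norm v" for v
        using mult_left_mono[OF assms(2)[OF that], of "\<bar>v\<bar>"] by (simp add: mult.commute)
      show "0 \<le> B" using assms(2)[OF that] norm_ge_zero order_trans by blast
    qed
  qed (use assms in \<open>auto simp: has_vector_derivative_def\<close>)
  then show ?thesis using assms(3) by simp
qed

text \<open>Picard iteration as a contraction of bounded continuous functions on the whole line; clamping the
upper limit of integration to \<open>[0, h]\<close> makes the iterates bounded.\<close>

lemma Lipschitz_solution_exists:
  fixes X :: "'a::euclidean_space \<Rightarrow> 'a"
  assumes Lip: "\<And>y z. norm (X y - X z) \<le> K * norm (y - z)" and M: "\<And>y. norm (X y) \<le> M"
    and h: "h \<ge> 0" "K * h < 1" "K > 0"
  shows "\<exists>\<phi>. \<phi> 0 = y \<and> solution_on X h \<phi>"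
proof -
  have contX: "continuous_on S X" for S
    using Lip h by (intro lipschitz_on_continuous_on[of K] lipschitz_onI) (auto simp: dist_norm)
  define P where "P \<phi> t = y + integral {0..max 0 (min h t)} (\<lambda>s. X (apply_bcontfun \<phi> s))" for \<phi> t
  have cont: "continuous_on S (\<lambda>s. X (apply_bcontfun \<phi> s))" for S and \<phi> :: "real \<Rightarrow>\<^sub>C 'a"
    by (intro continuous_on_compose2[OF contX[of UNIV]] continuous_on_apply_bcontfun) auto
  have P: "P \<phi> \<in> bcontfun" for \<phi>
  proof (rule bcontfun_normI)
    have "continuous_on {0..h} (\<lambda>t. integral {0..t} (\<lambda>s. X (apply_bcontfun \<phi> s)))"
      by (intro indefinite_integral_continuous_1 integrable_continuous_interval cont)
    then have "continuous_on UNIV (\<lambda>t. integral {0..max 0 (min h t)} (\<lambda>s. X (apply_bcontfun \<phi> s)))"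
      by (rule continuous_on_compose2) (use h in \<open>auto intro!: continuous_intros\<close>)
    then show "continuous_on UNIV (P \<phi>)"
      unfolding P_def[abs_def] by (intro continuous_intros)
    fix t
    have "norm (integral {0..max 0 (min h t)} (\<lambda>s. X (apply_bcontfun \<phi> s))) \<le> M * (max 0 (min h t) - 0)"
      by (rule integral_bound) (auto intro: cont M)
    also have "\<dots> \<le> M * h"
      using order_trans[OF norm_ge_zero M] h by (intro mult_left_mono) auto
    finally show "norm (P \<phi> t) \<le> norm y + M * h"
      unfolding P_def by (intro norm_triangle_le) auto
  qed
  have PB: "apply_bcontfun (Bcontfun (P \<phi>)) = P \<phi>" for \<phi>
    using P by (simp add: Bcontfun_inverse)
  have "dist (Bcontfun (P \<phi>)) (Bcontfun (P \<psi>)) \<le> K * h * dist \<phi> \<psi>" for \<phi> \<psi>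
  proof (rule dist_bound)
    fix t
    let ?t = "max 0 (min h t)"
    have "P \<phi> t - P \<psi> t = integral {0..?t} (\<lambda>s. X (apply_bcontfun \<phi> s) - X (apply_bcontfun \<psi> s))"
      unfolding P_def by (subst integral_diff) (auto intro!: integrable_continuous_interval cont)
    also have "norm \<dots> \<le> K * dist \<phi> \<psi> * (?t - 0)"
    proof (rule integral_bound)
      fix s
      have "norm (X (apply_bcontfun \<phi> s) - X (apply_bcontfun \<psi> s)) \<le> K * dist (apply_bcontfun \<phi> s) (apply_bcontfun \<psi> s)"
        using Lip by (simp add: dist_norm)
      also have "\<dots> \<le> K * dist \<phi> \<psi>" using h by (intro mult_left_mono dist_bounded) auto
      finally show "norm (X (apply_bcontfun \<phi> s) - X (apply_bcontfun \<psi> s)) \<le> K * dist \<phi> \<psi>" .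
    qed (auto intro!: continuous_on_diff cont)
    also have "\<dots> \<le> K * dist \<phi> \<psi> * h" using h by (intro mult_left_mono) auto
    finally show "dist (apply_bcontfun (Bcontfun (P \<phi>)) t) (apply_bcontfun (Bcontfun (P \<psi>)) t) \<le> K * h * dist \<phi> \<psi>"
      unfolding PB by (simp add: dist_norm mult_ac)
  qed
  then have "\<exists>!\<phi>. Bcontfun (P \<phi>) = \<phi>"
    using h by (intro banach_fix_type[of "K * h"]) auto
  then obtain \<phi> where "Bcontfun (P \<phi>) = \<phi>" by blast
  then have \<phi>: "apply_bcontfun \<phi> t = P \<phi> t" for t using PB[of \<phi>] by simp
  have "solution_on X h (apply_bcontfun \<phi>)"
    unfolding solution_on_def
  proof
    fix t assume t: "t \<in> {0..h}"
    have "((\<lambda>u. integral {0..u} (\<lambda>s. X (apply_bcontfun \<phi> s))) has_vector_derivative X (apply_bcontfun \<phi> t)) (at t within {0..h})"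
      by (rule integral_has_vector_derivative[OF cont t])
    from has_vector_derivative_add[OF has_vector_derivative_const[of y] this]
    have D: "((\<lambda>u. y + integral {0..u} (\<lambda>s. X (apply_bcontfun \<phi> s))) has_vector_derivative X (apply_bcontfun \<phi> t)) (at t within {0..h})"
      by simp
    have eq: "apply_bcontfun \<phi> u = y + integral {0..u} (\<lambda>s. X (apply_bcontfun \<phi> s))" if "u \<in> {0..h}" for u
    proof -
      have "apply_bcontfun \<phi> u = y + integral {0..max 0 (min h u)} (\<lambda>s. X (apply_bcontfun \<phi> s))"
        by (rule \<phi>[unfolded P_def])
      also have "max 0 (min h u) = u" using that by auto
      finally show ?thesis .
    qed
    from D show "(apply_bcontfun \<phi> has_vector_derivative X (apply_bcontfun \<phi> t)) (at t within {0..h})"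
      by (rule has_vector_derivative_transform[OF t eq, rotated])
  qed
  moreover have "apply_bcontfun \<phi> 0 = y" using h unfolding \<phi>[of 0] by (simp add: P_def)
  ultimately show ?thesis by blast
qed

text \<open>From each point of the unit ball around \<open>x\<close> a solution exists for time \<open>h\<close> and stays in the ball of radius
\<open>2\<close>; solutions in that ball have speed at most \<open>M\<close>; and, for times up to \<open>h\<close>, the difference of two of them
changes by at most half of its initial size.  The last clause gives continuous dependence on the initial
state, and also keeps distinct solutions apart.\<close>

definition solvable_near :: "('a::euclidean_space \<Rightarrow> 'a) \<Rightarrow> 'a \<Rightarrow> real \<Rightarrow> real \<Rightarrow> bool"
  where "solvable_near X x h M \<longleftrightarrow> h > 0 \<and> M > 0 \<and>
    (\<forall>y\<in>cball x 1. \<exists>\<phi>. \<phi> 0 = y \<and> solution_on X h \<phi> \<and> \<phi> ` {0..h} \<subseteq> cball x 2) \<and>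
    (\<forall>h' \<phi> t. solution_on X h' \<phi> \<and> \<phi> ` {0..h'} \<subseteq> cball x 2 \<and> t \<in> {0..h'} \<longrightarrow> norm (\<phi> t - \<phi> 0) \<le> M * t) \<and>
    (\<forall>h' \<phi> \<psi> t. h' \<le> h \<and> solution_on X h' \<phi> \<and> \<phi> ` {0..h'} \<subseteq> cball x 2 \<and>
      solution_on X h' \<psi> \<and> \<psi> ` {0..h'} \<subseteq> cball x 2 \<and> t \<in> {0..h'} \<longrightarrow>
      norm ((\<phi> t - \<psi> t) - (\<phi> 0 - \<psi> 0)) \<le> norm (\<phi> 0 - \<psi> 0) / 2)"

lemma solvable_nearD:
  assumes "solvable_near X x h M"
  shows "h > 0" "M > 0"
    and "y \<in> cball x 1 \<Longrightarrow> \<exists>\<phi>. \<phi> 0 = y \<and> solution_on X h \<phi> \<and> \<phi> ` {0..h} \<subseteq> cball x 2"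
    and "solution_on X h' \<phi> \<Longrightarrow> \<phi> ` {0..h'} \<subseteq> cball x 2 \<Longrightarrow> t \<in> {0..h'} \<Longrightarrow> norm (\<phi> t - \<phi> 0) \<le> M * t"
    and "h' \<le> h \<Longrightarrow> solution_on X h' \<phi> \<Longrightarrow> \<phi> ` {0..h'} \<subseteq> cball x 2 \<Longrightarrow>
      solution_on X h' \<psi> \<Longrightarrow> \<psi> ` {0..h'} \<subseteq> cball x 2 \<Longrightarrow> t \<in> {0..h'} \<Longrightarrow>
      norm ((\<phi> t - \<psi> t) - (\<phi> 0 - \<psi> 0)) \<le> norm (\<phi> 0 - \<psi> 0) / 2"
  using assms unfolding solvable_near_def by blast+

text \<open>Composed with the nearest-point projection onto the ball of radius \<open>2\<close>, the field becomes bounded and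
globally Lipschitz.  A solution of the modified equation cannot leave the ball before time \<open>h\<close>, so it solves
the original equation.\<close>

lemma local_solutions:
  fixes X :: "'a::euclidean_space \<Rightarrow> 'a"
  assumes "smooth X"
  shows "\<exists>h M. solvable_near X x h M"
proof -
  let ?B = "cball x 2"
  obtain K where K: "K > 0" "\<And>y z. y \<in> ?B \<Longrightarrow> z \<in> ?B \<Longrightarrow> norm (X y - X z) \<le> K * norm (y - z)"
    using smooth_Lipschitz_on_cball[OF assms] by blast
  obtain M where M: "M > 0" "\<And>y. y \<in> ?B \<Longrightarrow> norm (X y) \<le> M"
    using continuous_on_cball_bounded[OF smooth_continuous_on[OF assms]] by blast
  define h where "h = min (1 / M) (1 / (4 * K))"
  have h: "h > 0" "M * h \<le> 1" "K * h \<le> 1 / 4"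
    using K M by (auto simp: h_def min_def field_simps)
  have incr: "norm (\<phi> t - \<phi> 0) \<le> M * t"
    if "solution_on X h' \<phi>" "\<phi> ` {0..h'} \<subseteq> ?B" "t \<in> {0..h'}" for h' \<phi> t
    using that by (intro increment_bound[of h' \<phi> "\<lambda>s. X (\<phi> s)"] M(2)) (auto simp: solution_on_def simp del: mem_cball)
  have exist: "\<exists>\<phi>. \<phi> 0 = y \<and> solution_on X h \<phi> \<and> \<phi> ` {0..h} \<subseteq> ?B" if y: "y \<in> cball x 1" for y
  proof -
    define c where "c = closest_point ?B"
    have c: "c z \<in> ?B" for z unfolding c_def by (intro closest_point_in_set) auto
    have c1: "norm (c y - c z) \<le> norm (y - z)" for y z
      unfolding c_def using closest_point_lipschitz[of ?B y z] by (simp add: dist_norm)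
    have "norm (X (c y) - X (c z)) \<le> K * norm (y - z)" for y z
      by (rule order_trans[OF K(2)[OF c c] mult_left_mono[OF c1 less_imp_le[OF K(1)]]])
    then obtain \<phi> where \<phi>: "\<phi> 0 = y" "solution_on (\<lambda>z. X (c z)) h \<phi>"
      using Lipschitz_solution_exists[of "\<lambda>z. X (c z)" K M h y] M(2)[OF c] h K by auto
    have "norm (\<phi> t - y) \<le> 1" if "t \<in> {0..h}" for t
    proof -
      have "norm (\<phi> t - \<phi> 0) \<le> M * t"
        using \<phi>(2) that by (intro increment_bound[of h \<phi> "\<lambda>s. X (c (\<phi> s))"] M(2) c) (auto simp: solution_on_def)
      also have "\<dots> \<le> M * h" using that M by (intro mult_left_mono) auto
      finally show ?thesis using h \<phi> by simp
    qed
    then have sub: "\<phi> t \<in> ?B" if "t \<in> {0..h}" for t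
      using y that dist_triangle[of x "\<phi> t" y] by (fastforce simp: dist_norm norm_minus_commute)
    then have "solution_on X h \<phi>"
      using \<phi>(2) unfolding solution_on_def c_def by (simp add: closest_point_self)
    then show ?thesis using \<phi>(1) sub by blast
  qed
  have compare: "norm ((\<phi> t - \<psi> t) - (\<phi> 0 - \<psi> 0)) \<le> norm (\<phi> 0 - \<psi> 0) / 2"
    if h': "h' \<le> h" and s: "solution_on X h' \<phi>" "solution_on X h' \<psi>"
      and B: "\<phi> ` {0..h'} \<subseteq> ?B" "\<psi> ` {0..h'} \<subseteq> ?B" and t: "t \<in> {0..h'}" for h' \<phi> \<psi> and t :: real
  proof -
    have "continuous_on {0..h'} (\<lambda>t. norm (\<phi> t - \<psi> t))"
      by (intro continuous_intros solution_on_continuous[OF s(1)] solution_on_continuous[OF s(2)])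
    then obtain t0 where t0: "t0 \<in> {0..h'}"
      and sup: "\<And>t. t \<in> {0..h'} \<Longrightarrow> norm (\<phi> t - \<psi> t) \<le> norm (\<phi> t0 - \<psi> t0)"
      using continuous_attains_sup[of "{0..h'}" "\<lambda>t. norm (\<phi> t - \<psi> t)"] t by auto
    define S where "S = norm (\<phi> t0 - \<psi> t0)"
    have *: "norm ((\<phi> t - \<psi> t) - (\<phi> 0 - \<psi> 0)) \<le> S / 4" if "t \<in> {0..h'}" for t
    proof -
      have "norm ((\<phi> t - \<psi> t) - (\<phi> 0 - \<psi> 0)) \<le> K * S * t"
      proof (rule increment_bound[OF _ _ that, of _ "\<lambda>s. X (\<phi> s) - X (\<psi> s)"])
        fix r assume r: "r \<in> {0..h'}"
        show "((\<lambda>t. \<phi> t - \<psi> t) has_vector_derivative X (\<phi> r) - X (\<psi> r)) (at r within {0..h'})"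
          using s r by (intro has_vector_derivative_diff) (auto simp: solution_on_def)
        have "\<phi> r \<in> ?B" "\<psi> r \<in> ?B" using B r by blast+
        then have "norm (X (\<phi> r) - X (\<psi> r)) \<le> K * norm (\<phi> r - \<psi> r)" by (rule K(2))
        also have "\<dots> \<le> K * S" using sup[OF r] K by (simp add: S_def)
        finally show "norm (X (\<phi> r) - X (\<psi> r)) \<le> K * S" .
      qed
      also have "\<dots> \<le> K * S * h" using that h' K by (intro mult_left_mono) (auto simp: S_def)
      also have "\<dots> = (K * h) * S" by simp
      also have "\<dots> \<le> 1 / 4 * S" using h by (intro mult_right_mono) (auto simp: S_def)
      finally show ?thesis by simp
    qed
    have "S \<le> norm (\<phi> 0 - \<psi> 0) + S / 4"
      using *[OF t0] norm_triangle_ineq2[of "\<phi> t0 - \<psi> t0" "\<phi> 0 - \<psi> 0"] by (simp add: S_def)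
    then show ?thesis using *[OF t] norm_ge_zero[of "\<phi> 0 - \<psi> 0"] by linarith
  qed
  have "solvable_near X x h M"
    unfolding solvable_near_def
    by (intro conjI allI ballI impI; (elim conjE)?; rule h(1) M(1) exist incr compare; assumption)
  then show ?thesis by blast
qed

lemma Gronwall_zero:
  fixes d :: "real \<Rightarrow> real"
  assumes cont: "continuous_on {a..b} d"
    and le: "\<And>t. t \<in> {a..b} \<Longrightarrow> d t \<le> K * integral {a..t} d" and "K \<ge> 0" "t \<in> {a..b}"
  shows "d t \<le> 0"
proof -
  define W where "W t = integral {a..t} d" for t
  have W: "(W has_real_derivative d t) (at t within {a..b})" if "t \<in> {a..b}" for t
    unfolding W_def[abs_def] using integral_has_vector_derivative[OF cont that]
    by (simp add: has_real_derivative_iff_has_vector_derivative)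
  define E where "E t = exp (- K * (t - a)) * W t" for t
  have E: "(E has_real_derivative exp (- K * (t - a)) * (d t - K * W t)) (at t within {a..b})" if "t \<in> {a..b}" for t
    unfolding E_def[abs_def] using W[OF that]
    by (auto intro!: derivative_eq_intros simp: algebra_simps)
  have "E a \<ge> E t"
  proof (rule DERIV_nonpos_imp_decreasing_open[of a t E])
    show "a \<le> t" using assms by auto
    have "continuous_on {a..b} W"
      using DERIV_continuous_on[of "{a..b}" W d] W by blast
    then have "continuous_on {a..b} E"
      unfolding E_def[abs_def] by (intro continuous_intros)
    then show "continuous_on {a..t} E"
      by (rule continuous_on_subset) (use assms(4) in auto)
    fix s assume s: "a < s" "s < t"
    then have "s \<in> {a..b}" using assms(4) by auto
    from E[OF this] have "(E has_real_derivative exp (- K * (s - a)) * (d s - K * W s)) (at s)"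
      using s assms(4) by (simp add: at_within_Icc_at)
    moreover have "exp (- K * (s - a)) * (d s - K * W s) \<le> 0"
      using le[OF \<open>s \<in> {a..b}\<close>] by (simp add: W_def mult_le_0_iff)
    ultimately show "\<exists>y. DERIV E s :> y \<and> y \<le> 0" by blast
  qed
  then have "W t \<le> 0" by (simp add: E_def W_def mult_le_0_iff)
  then have "K * W t \<le> 0" using assms(3) by (simp add: mult_nonneg_nonpos)
  then show ?thesis using le[OF assms(4)] by (simp add: W_def)
qed

text \<open>Both trajectories are continuous and stay in some ball, on which \<open>f\<close> and \<open>g\<close> are Lipschitz; the distance
between them then satisfies a Gronwall inequality with zero initial value.\<close>

lemma controlled_trajectory_unique:
  fixes f g :: "'a::euclidean_space \<Rightarrow> 'a" and x z :: "real \<Rightarrow> 'a"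
  assumes "smooth f" "smooth g"
    and w: "\<And>t. t \<in> {a..b} \<Longrightarrow> \<bar>w t\<bar> \<le> B"
    and x: "\<And>t. t \<in> {a..b} \<Longrightarrow> (\<lambda>s. f (x s) + w s *\<^sub>R g (x s)) integrable_on {a..t} \<and>
      x t = p + integral {a..t} (\<lambda>s. f (x s) + w s *\<^sub>R g (x s))"
    and z: "\<And>t. t \<in> {a..b} \<Longrightarrow> (\<lambda>s. f (z s) + w s *\<^sub>R g (z s)) integrable_on {a..t} \<and>
      z t = p + integral {a..t} (\<lambda>s. f (z s) + w s *\<^sub>R g (z s))"
    and t: "t \<in> {a..b}"
  shows "x t = z t"
proof -
  have cont: "continuous_on {a..b} y"
    if y: "\<And>t. t \<in> {a..b} \<Longrightarrow> (\<lambda>s. f (y s) + w s *\<^sub>R g (y s)) integrable_on {a..t} \<and>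
      y t = p + integral {a..t} (\<lambda>s. f (y s) + w s *\<^sub>R g (y s))" for y
  proof -
    have "continuous_on {a..b} (\<lambda>t. p + integral {a..t} (\<lambda>s. f (y s) + w s *\<^sub>R g (y s)))"
      using y[of b] t by (intro continuous_intros indefinite_integral_continuous_1) auto
    moreover have "y t = p + integral {a..t} (\<lambda>s. f (y s) + w s *\<^sub>R g (y s))" if "t \<in> {a..b}" for t
      using y[OF that] by blast
    ultimately show ?thesis by (subst continuous_on_cong[OF refl])
  qed
  have cx: "continuous_on {a..b} x" and cz: "continuous_on {a..b} z"
    using cont x z by blast+
  have "bounded (x ` {a..b} \<union> z ` {a..b})"
    by (intro bounded_Un[THEN iffD2] conjI compact_imp_bounded compact_continuous_image cx cz) auto
  then obtain r where "\<forall>y\<in>x ` {a..b} \<union> z ` {a..b}. norm y \<le> r"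
    unfolding bounded_iff by blast
  then have r: "x s \<in> cball 0 r" "z s \<in> cball 0 r" if "s \<in> {a..b}" for s
    using that by auto
  obtain Kf where Kf: "Kf > 0" "\<And>y z. y \<in> cball 0 r \<Longrightarrow> z \<in> cball 0 r \<Longrightarrow> norm (f y - f z) \<le> Kf * norm (y - z)"
    using smooth_Lipschitz_on_cball[OF assms(1)] by blast
  obtain Kg where Kg: "Kg > 0" "\<And>y z. y \<in> cball 0 r \<Longrightarrow> z \<in> cball 0 r \<Longrightarrow> norm (g y - g z) \<le> Kg * norm (y - z)"
    using smooth_Lipschitz_on_cball[OF assms(2)] by blast
  define K where "K = Kf + B * Kg"
  define d where "d t = norm (x t - z t)" for t
  have cd: "continuous_on {a..b} d" unfolding d_def by (intro continuous_intros cx cz)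
  have "B \<ge> 0" using w[OF t] by linarith
  then have "K \<ge> 0" using Kf Kg by (simp add: K_def)
  have "d t \<le> 0"
  proof (rule Gronwall_zero[OF cd _ \<open>K \<ge> 0\<close> t])
    fix t assume t: "t \<in> {a..b}"
    let ?F = "\<lambda>y s. f (y s) + w s *\<^sub>R g (y s)"
    have "x t - z t = integral {a..t} (\<lambda>s. ?F x s - ?F z s)"
      using x[OF t] z[OF t] by (simp add: integral_diff)
    then have "d t = norm (integral {a..t} (\<lambda>s. ?F x s - ?F z s))" by (simp add: d_def)
    also have "\<dots> \<le> integral {a..t} (\<lambda>s. K * d s)"
    proof (rule integral_norm_bound_integral)
      show "(\<lambda>s. ?F x s - ?F z s) integrable_on {a..t}"
        using x[OF t] z[OF t] by (intro integrable_diff) auto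
      show "(\<lambda>s. K * d s) integrable_on {a..t}"
        using t by (intro integrable_continuous_interval continuous_intros continuous_on_subset[OF cd]) auto
      fix s assume "s \<in> {a..t}"
      then have s: "s \<in> {a..b}" using t by auto
      have "?F x s - ?F z s = (f (x s) - f (z s)) + w s *\<^sub>R (g (x s) - g (z s))"
        by (simp add: algebra_simps)
      also have "norm \<dots> \<le> norm (f (x s) - f (z s)) + \<bar>w s\<bar> * norm (g (x s) - g (z s))"
        by (rule order_trans[OF norm_triangle_ineq]) simp
      also have "\<dots> \<le> Kf * d s + B * (Kg * d s)"
        unfolding d_def using r[OF s] w[OF s] Kf Kg by (intro add_mono mult_mono) auto
      finally show "norm (?F x s - ?F z s) \<le> K * d s" by (simp add: K_def algebra_simps)
    qed
    finally show "d t \<le> K * integral {a..t} d" by simp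
  qed
  then show ?thesis by (simp add: d_def)
qed


section \<open>Controlled arcs and their concatenation\<close>

text \<open>Controls are defined on the whole line and bounded on all bounded sets, so that the class is closed
under time shifts.\<close>

definition tame_control :: "(real \<Rightarrow> real) \<Rightarrow> bool"
  where "tame_control u \<longleftrightarrow> u \<in> borel_measurable borel \<and> (\<forall>c. \<exists>B. \<forall>t. \<bar>t\<bar> \<le> c \<longrightarrow> \<bar>u t\<bar> \<le> B)"

text \<open>Trajectories in differential form, with finitely many exceptional times for the switches of the control.
Being local in time, this form is easy to shift and to concatenate; the integral form is recovered by the
fundamental theorem of calculus (lemma \<open>control_arc_integral\<close>).\<close>

definition control_arc ::
    "('a::euclidean_space \<Rightarrow> 'a) \<Rightarrow> ('a \<Rightarrow> 'a) \<Rightarrow> real \<Rightarrow> real \<Rightarrow> (real \<Rightarrow> real) \<Rightarrow> (real \<Rightarrow> 'a) \<Rightarrow> bool"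
  where "control_arc f g a b u z \<longleftrightarrow> continuous_on {a..b} z \<and>
    (\<exists>S. finite S \<and> (\<forall>t\<in>{a<..<b} - S. (z has_vector_derivative f (z t) + u t *\<^sub>R g (z t)) (at t)))"

definition steers ::
    "('a::euclidean_space \<Rightarrow> 'a) \<Rightarrow> ('a \<Rightarrow> 'a) \<Rightarrow> real \<Rightarrow> 'a \<Rightarrow> 'a \<Rightarrow> 'a set \<Rightarrow> bool"
  where "steers f g b y y' A \<longleftrightarrow> (\<exists>u z. tame_control u \<and> control_arc f g 0 b u z \<and>
    z 0 = y \<and> z b = y' \<and> z ` {0..b} \<subseteq> A)"

lemma tame_control_const: "tame_control (\<lambda>t. c)"
  by (auto simp: tame_control_def)

lemma tame_control_shift: "tame_control u \<Longrightarrow> tame_control (\<lambda>t. u (t - c))"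
  unfolding tame_control_def
proof (intro conjI allI)
  fix d assume u: "u \<in> borel_measurable borel \<and> (\<forall>c. \<exists>B. \<forall>t. \<bar>t\<bar> \<le> c \<longrightarrow> \<bar>u t\<bar> \<le> B)"
  then obtain B where B: "\<And>t. \<bar>t\<bar> \<le> d + \<bar>c\<bar> \<Longrightarrow> \<bar>u t\<bar> \<le> B" by blast
  then have "\<bar>u (t - c)\<bar> \<le> B" if "\<bar>t\<bar> \<le> d" for t
    using that abs_triangle_ineq4[of t c] by (intro B) linarith
  then show "\<exists>B. \<forall>t. \<bar>t\<bar> \<le> d \<longrightarrow> \<bar>u (t - c)\<bar> \<le> B" by blast
next
  assume "u \<in> borel_measurable borel \<and> (\<forall>c. \<exists>B. \<forall>t. \<bar>t\<bar> \<le> c \<longrightarrow> \<bar>u t\<bar> \<le> B)"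
  then have [measurable]: "u \<in> borel_measurable borel" by blast
  show "(\<lambda>t. u (t - c)) \<in> borel_measurable borel" by measurable
qed

lemma tame_control_if:
  assumes "tame_control u" "tame_control v"
  shows "tame_control (\<lambda>t. if t < b then u t else v t)"
  unfolding tame_control_def
proof (intro conjI allI)
  have [measurable]: "u \<in> borel_measurable borel" "v \<in> borel_measurable borel"
    using assms by (auto simp: tame_control_def)
  show "(\<lambda>t. if t < b then u t else v t) \<in> borel_measurable borel" by measurable
  fix c
  obtain B C where "\<And>t. \<bar>t\<bar> \<le> c \<Longrightarrow> \<bar>u t\<bar> \<le> B" "\<And>t. \<bar>t\<bar> \<le> c \<Longrightarrow> \<bar>v t\<bar> \<le> C"
    using assms unfolding tame_control_def by meson
  then show "\<exists>B. \<forall>t. \<bar>t\<bar> \<le> c \<longrightarrow> \<bar>if t < b then u t else v t\<bar> \<le> B"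
    by (intro exI[of _ "max B C"]) (auto simp: le_max_iff_disj)
qed

lemma control_arc_cong:
  assumes "control_arc f g a b u z"
    and "\<And>t. t \<in> {a<..<b} \<Longrightarrow> u t = u' t" and "\<And>t. t \<in> {a..b} \<Longrightarrow> z t = z' t"
  shows "control_arc f g a b u' z'"
proof -
  obtain S where S: "finite S" "\<And>t. t \<in> {a<..<b} - S \<Longrightarrow> (z has_vector_derivative f (z t) + u t *\<^sub>R g (z t)) (at t)"
    using assms(1) unfolding control_arc_def by blast
  have "(z' has_vector_derivative f (z' t) + u' t *\<^sub>R g (z' t)) (at t)" if t: "t \<in> {a<..<b} - S" for t
  proof -
    have "(z' has_vector_derivative f (z t) + u t *\<^sub>R g (z t)) (at t)"
      by (rule has_vector_derivative_transform_within_open[OF S(2)[OF t], of "{a<..<b}"]) (use t assms(3) in auto)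
    then show ?thesis using assms(2)[of t] assms(3)[of t] t by simp
  qed
  moreover have "continuous_on {a..b} z'"
    using assms(1,3) unfolding control_arc_def by (subst continuous_on_cong[OF refl, of _ _ z]) auto
  ultimately show ?thesis using S(1) unfolding control_arc_def by blast
qed

lemma control_arc_shift:
  assumes "control_arc f g a b u z"
  shows "control_arc f g (a + c) (b + c) (\<lambda>t. u (t - c)) (\<lambda>t. z (t - c))"
proof -
  obtain S where S: "finite S" "\<And>t. t \<in> {a<..<b} - S \<Longrightarrow> (z has_vector_derivative f (z t) + u t *\<^sub>R g (z t)) (at t)"
    and z: "continuous_on {a..b} z"
    using assms unfolding control_arc_def by blast
  have "((\<lambda>t. z (t - c)) has_vector_derivative f (z (t - c)) + u (t - c) *\<^sub>R g (z (t - c))) (at t)"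
    if "t \<in> {a + c<..<b + c} - (\<lambda>t. t + c) ` S" for t
  proof -
    have "t - c \<notin> S" using that by (metis DiffD2 diff_add_cancel imageI)
    then have "(z has_vector_derivative f (z (t - c)) + u (t - c) *\<^sub>R g (z (t - c))) (at (t - c))"
      using that by (intro S) auto
    moreover have "((\<lambda>t. t - c) has_vector_derivative 1) (at t)"
      by (auto intro!: derivative_eq_intros)
    ultimately show ?thesis
      using vector_diff_chain_at[of "\<lambda>t. t - c" 1 t z] by (simp add: o_def)
  qed
  moreover have "continuous_on {a + c..b + c} (\<lambda>t. z (t - c))"
    by (rule continuous_on_compose2[OF z]) (auto intro!: continuous_intros)
  ultimately show ?thesis
    using S(1) unfolding control_arc_def by (intro conjI exI[of _ "(\<lambda>t. t + c) ` S"]) auto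
qed

lemma control_arc_join:
  assumes "control_arc f g a b u z" "control_arc f g b c u z" "a \<le> b" "b \<le> c"
  shows "control_arc f g a c u z"
proof -
  obtain S where S: "finite S" "\<And>t. t \<in> {a<..<b} - S \<Longrightarrow> (z has_vector_derivative f (z t) + u t *\<^sub>R g (z t)) (at t)"
    and z1: "continuous_on {a..b} z"
    using assms(1) unfolding control_arc_def by blast
  obtain S' where S': "finite S'" "\<And>t. t \<in> {b<..<c} - S' \<Longrightarrow> (z has_vector_derivative f (z t) + u t *\<^sub>R g (z t)) (at t)"
    and z2: "continuous_on {b..c} z"
    using assms(2) unfolding control_arc_def by blast
  have "(z has_vector_derivative f (z t) + u t *\<^sub>R g (z t)) (at t)"
    if "t \<in> {a<..<c} - (S \<union> S' \<union> {b})" for t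
    using that S(2)[of t] S'(2)[of t] by (cases "t < b") auto
  moreover have "continuous_on ({a..b} \<union> {b..c}) z"
    by (intro continuous_on_closed_Un z1 z2) auto
  moreover have "{a..b} \<union> {b..c} = {a..c}" using assms by auto
  ultimately show ?thesis
    using S(1) S'(1) unfolding control_arc_def by (intro conjI exI[of _ "S \<union> S' \<union> {b}"]) auto
qed

lemma control_arc_subinterval:
  "control_arc f g a b u z \<Longrightarrow> a \<le> a' \<Longrightarrow> b' \<le> b \<Longrightarrow> control_arc f g a' b' u z"
  unfolding control_arc_def by (auto intro: continuous_on_subset)

lemma steers_refl: "y \<in> A \<Longrightarrow> steers f g 0 y y A"
  unfolding steers_def control_arc_def
  by (rule exI[of _ "\<lambda>t. 0"], rule exI[of _ "\<lambda>t. y"]) (auto simp: tame_control_const intro: exI[of _ "{}"])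

lemma steers_mono: "steers f g b y y' A \<Longrightarrow> A \<subseteq> A' \<Longrightarrow> steers f g b y y' A'"
  unfolding steers_def by blast

lemma steers_end: "steers f g b y y' A \<Longrightarrow> b \<ge> 0 \<Longrightarrow> y' \<in> A"
  unfolding steers_def by force

lemma steers_trans:
  assumes "steers f g b y y' A" "steers f g c y' y'' A" "b \<ge> 0" "c \<ge> 0"
  shows "steers f g (b + c) y y'' A"
proof -
  obtain u z where 1: "tame_control u" "control_arc f g 0 b u z" "z 0 = y" "z b = y'" "z ` {0..b} \<subseteq> A"
    using assms(1) unfolding steers_def by blast
  obtain v w where 2: "tame_control v" "control_arc f g 0 c v w" "w 0 = y'" "w c = y''" "w ` {0..c} \<subseteq> A"
    using assms(2) unfolding steers_def by blast
  define U where "U t = (if t < b then u t else v (t - b))" for t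
  define Z where "Z t = (if t < b then z t else w (t - b))" for t
  have "control_arc f g 0 b U Z"
    by (rule control_arc_cong[OF 1(2)]) (use 1 2 in \<open>auto simp: U_def Z_def\<close>)
  moreover have "control_arc f g b (b + c) U Z"
  proof -
    have "control_arc f g b (b + c) (\<lambda>t. v (t - b)) (\<lambda>t. w (t - b))"
      using control_arc_shift[OF 2(2), of b] by (simp add: add.commute)
    then show ?thesis by (rule control_arc_cong) (auto simp: U_def Z_def)
  qed
  ultimately have "control_arc f g 0 (b + c) U Z"
    by (rule control_arc_join) (use assms in auto)
  moreover have "tame_control U"
    unfolding U_def[abs_def] by (rule tame_control_if[OF 1(1) tame_control_shift[OF 2(1)]])
  moreover have "Z ` {0..b + c} \<subseteq> A"
  proof
    fix p assume "p \<in> Z ` {0..b + c}"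
    then obtain t where t: "0 \<le> t" "t \<le> b + c" "p = Z t" by auto
    show "p \<in> A"
    proof (cases "t < b")
      case True
      then have "z t \<in> z ` {0..b}" using t by auto
      then show ?thesis using 1(5) True t by (auto simp: Z_def)
    next
      case False
      then have "w (t - b) \<in> w ` {0..c}" using t by auto
      then show ?thesis using 2(5) False t by (auto simp: Z_def)
    qed
  qed
  moreover have "Z 0 = y" using 1 2 assms by (auto simp: Z_def)
  moreover have "Z (b + c) = y''" using 2 assms by (auto simp: Z_def)
  ultimately show ?thesis unfolding steers_def by blast
qed

lemma solution_on_steers:
  assumes "solution_on (\<lambda>x. f x + c *\<^sub>R g x) h \<phi>" "\<phi> ` {0..h} \<subseteq> A"
  shows "steers f g h (\<phi> 0) (\<phi> h) A"
proof -
  have "(\<phi> has_vector_derivative f (\<phi> t) + c *\<^sub>R g (\<phi> t)) (at t)" if "t \<in> {0<..<h}" for t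
    using assms(1) that unfolding solution_on_def by (metis at_within_Icc_at greaterThanLessThan_iff atLeastAtMost_iff less_imp_le)
  then have "control_arc f g 0 h (\<lambda>t. c) \<phi>"
    using solution_on_continuous[OF assms(1)] unfolding control_arc_def by (intro conjI exI[of _ "{}"]) auto
  then show ?thesis
    unfolding steers_def using assms(2) tame_control_const by blast
qed

section \<open>Taylor expansion along a trajectory with one switch\<close>

lemma solution_Taylor:
  fixes W :: "'a::euclidean_space \<Rightarrow> real"
  assumes "smooth X" "smooth W" and sol: "solution_on X h \<phi>"
    and C: "\<And>t. t \<in> {0..h} \<Longrightarrow> \<bar>(lie_derivative X ^^ Suc n) W (\<phi> t)\<bar> \<le> C" and t: "t \<in> {0..h}"
  shows "\<bar>W (\<phi> t) - (\<Sum>i\<le>n. (lie_derivative X ^^ i) W (\<phi> 0) * t ^ i / fact i)\<bar> \<le> C * t ^ Suc n"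
proof -
  define F where "F i t = (lie_derivative X ^^ i) W (\<phi> t)" for i t
  have "(F i has_field_derivative F (Suc i) t) (at t within {0..h})" if "t \<in> {0..h}" for i t
  proof -
    have s: "smooth ((lie_derivative X ^^ i) W)" by (intro smooth_lie_derivative_power assms)
    have "(\<phi> has_derivative (\<lambda>s. s *\<^sub>R X (\<phi> t))) (at t within {0..h})"
      using sol that by (simp add: solution_on_def has_vector_derivative_def)
    from has_derivative_compose[OF this smooth_has_derivative[OF s]]
    have "(F i has_derivative (\<lambda>r. frechet_derivative ((lie_derivative X ^^ i) W) (at (\<phi> t)) (r *\<^sub>R X (\<phi> t)))) (at t within {0..h})"
      by (simp add: F_def[abs_def])
    moreover have "frechet_derivative ((lie_derivative X ^^ i) W) (at (\<phi> t)) (r *\<^sub>R X (\<phi> t)) = r * F (Suc i) t" for r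
      using linear_scale[OF has_derivative_linear[OF smooth_has_derivative[OF s]]]
      by (simp add: F_def lie_derivative_def)
    moreover have "(\<lambda>r. r * F (Suc i) t) = (*) (F (Suc i) t)" by (simp add: fun_eq_iff mult.commute)
    ultimately show ?thesis by (simp add: has_field_derivative_def)
  qed
  then have "norm (F 0 t - (\<Sum>i\<le>n. F i 0 * (t - 0) ^ i / fact i)) \<le> C * norm (t - 0) ^ Suc n / fact n"
    by (rule field_Taylor[OF convex_real_interval(5)]) (use C t in \<open>auto simp: F_def\<close>)
  also have "\<dots> \<le> C * t ^ Suc n"
  proof -
    have "0 \<le> C * t ^ Suc n" using order_trans[OF abs_ge_zero C[OF t]] t by simp
    moreover have "(1::real) \<le> fact n" by (rule fact_ge_1)
    ultimately have "C * t ^ Suc n / fact n \<le> C * t ^ Suc n / 1" by (intro divide_left_mono) auto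
    then show ?thesis using t by simp
  qed
  finally show ?thesis by (simp add: F_def)
qed

text \<open>Taylor's formula is applied first along the second piece, at the switching point \<open>p\<close>, and then along the
first piece to each coefficient \<open>X2^k V(p)\<close>.  Apart from \<open>V x\<close>, only terms with \<open>j + k = m\<close> survive; all
remainders are of order \<open>\<epsilon>^(m+1)\<close>, uniformly because the trajectories stay in a compact ball.\<close>

lemma two_piece_descent:
  fixes V :: "'a::euclidean_space \<Rightarrow> real"
  assumes "smooth X1" "smooth X2" "smooth V" "m \<ge> 1" "\<alpha> \<ge> 0"
    and van: "\<And>j k. 0 < j + k \<Longrightarrow> j + k < m \<Longrightarrow> (lie_derivative X1 ^^ j) ((lie_derivative X2 ^^ k) V) x = 0"
    and neg: "two_piece_coefficient X1 X2 V m \<alpha> x < 0"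
  obtains \<epsilon>0 where "\<epsilon>0 > 0"
    and "\<And>\<epsilon> \<phi>1 \<phi>2. 0 < \<epsilon> \<Longrightarrow> \<epsilon> < \<epsilon>0 \<Longrightarrow> solution_on X1 (\<alpha> * \<epsilon>) \<phi>1 \<Longrightarrow> \<phi>1 0 = x \<Longrightarrow>
      \<phi>1 ` {0..\<alpha> * \<epsilon>} \<subseteq> cball x r \<Longrightarrow> solution_on X2 \<epsilon> \<phi>2 \<Longrightarrow> \<phi>2 0 = \<phi>1 (\<alpha> * \<epsilon>) \<Longrightarrow>
      \<phi>2 ` {0..\<epsilon>} \<subseteq> cball x r \<Longrightarrow> V (\<phi>2 \<epsilon>) < V x"
proof -
  define F where "F k = (lie_derivative X2 ^^ k) V" for k
  define A where "A j k = (lie_derivative X1 ^^ j) (F k)" for j k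
  have sF: "smooth (F k)" for k unfolding F_def by (intro smooth_lie_derivative_power assms)
  have sA: "smooth (A j k)" for j k unfolding A_def by (intro smooth_lie_derivative_power assms sF)
  have "\<exists>C. \<forall>y\<in>cball x r. \<bar>G y\<bar> \<le> C" if G: "smooth G" for G :: "'a \<Rightarrow> real"
    using continuous_on_cball_bounded[OF smooth_continuous_on[OF G], of x r] by (metis real_norm_def)
  then obtain Bd where Bd: "\<And>(G :: 'a \<Rightarrow> real) y. smooth G \<Longrightarrow> y \<in> cball x r \<Longrightarrow> \<bar>G y\<bar> \<le> Bd G"
    by metis
  define D where "D = Bd (F (Suc m)) + (\<Sum>k\<le>m. Bd (A (Suc (m - k)) k) * \<alpha> ^ Suc (m - k) / fact k)"
  define Q where "Q = two_piece_coefficient X1 X2 V m \<alpha> x"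
  define \<epsilon>0 where "\<epsilon>0 = - Q / (\<bar>D\<bar> + 1)"
  have "\<epsilon>0 > 0" using neg divide_pos_pos[of "- Q" "\<bar>D\<bar> + 1"] by (simp add: \<epsilon>0_def Q_def)
  moreover have "V (\<phi>2 \<epsilon>) < V x" if \<epsilon>: "0 < \<epsilon>" "\<epsilon> < \<epsilon>0" and 1: "solution_on X1 (\<alpha> * \<epsilon>) \<phi>1" "\<phi>1 0 = x"
      "\<phi>1 ` {0..\<alpha> * \<epsilon>} \<subseteq> cball x r" and 2: "solution_on X2 \<epsilon> \<phi>2" "\<phi>2 0 = \<phi>1 (\<alpha> * \<epsilon>)"
      "\<phi>2 ` {0..\<epsilon>} \<subseteq> cball x r" for \<epsilon> \<phi>1 \<phi>2
  proof -
    define p where "p = \<phi>2 0"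
    have e1: "\<bar>V (\<phi>2 \<epsilon>) - (\<Sum>k\<le>m. F k p * \<epsilon> ^ k / fact k)\<bar> \<le> Bd (F (Suc m)) * \<epsilon> ^ Suc m"
      unfolding F_def p_def
      by (rule solution_Taylor[OF assms(2,3) 2(1)])
        (use 2(3) \<epsilon> Bd[OF sF[of "Suc m"]] in \<open>auto simp: F_def image_subset_iff\<close>)
    have e2: "\<bar>F k p - (\<Sum>i\<le>m - k. A i k x * (\<alpha> * \<epsilon>) ^ i / fact i)\<bar>
        \<le> Bd (A (Suc (m - k)) k) * (\<alpha> * \<epsilon>) ^ Suc (m - k)" for k
      unfolding A_def p_def 2(2) 1(2)[symmetric]
      by (rule solution_Taylor[OF assms(1) sF 1(1)])
        (use 1(2,3) \<epsilon> assms(5) Bd[OF sA[of "Suc (m - k)" k]] in \<open>auto simp: A_def image_subset_iff\<close>)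
    define a where "a i k = A i k x * (\<alpha> * \<epsilon>) ^ i / fact i * \<epsilon> ^ k / fact k" for i k
    have e3: "\<bar>F k p * \<epsilon> ^ k / fact k - (\<Sum>i\<le>m - k. a i k)\<bar>
        \<le> (Bd (A (Suc (m - k)) k) * \<alpha> ^ Suc (m - k) / fact k) * \<epsilon> ^ Suc m" if "k \<le> m" for k
    proof -
      have "F k p * \<epsilon> ^ k / fact k - (\<Sum>i\<le>m - k. a i k)
          = (F k p - (\<Sum>i\<le>m - k. A i k x * (\<alpha> * \<epsilon>) ^ i / fact i)) * (\<epsilon> ^ k / fact k)"
        unfolding a_def left_diff_distrib sum_distrib_right by simp
      also have "\<bar>\<dots>\<bar> \<le> Bd (A (Suc (m - k)) k) * (\<alpha> * \<epsilon>) ^ Suc (m - k) * (\<epsilon> ^ k / fact k)"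
        unfolding abs_mult using e2[of k] \<epsilon> by (intro mult_mono) auto
      also have "\<dots> = (Bd (A (Suc (m - k)) k) * \<alpha> ^ Suc (m - k) / fact k) * (\<epsilon> ^ Suc (m - k) * \<epsilon> ^ k)"
        by (simp add: power_mult_distrib)
      also have "\<epsilon> ^ Suc (m - k) * \<epsilon> ^ k = \<epsilon> ^ Suc m"
        using that by (simp flip: power_add)
      finally show ?thesis .
    qed
    have inner: "(\<Sum>i\<le>m - k. a i k) = (if k = 0 then V x else 0) + a (m - k) k" if "k \<le> m" for k
    proof -
      have "a i k = (if i = 0 then if k = 0 then V x else 0 else 0) + (if i = m - k then a (m - k) k else 0)"
        if "i \<in> {..m - k}" for i
      proof (cases "0 < i + k \<and> i + k < m")
        case True
        then show ?thesis using van[of i k] by (auto simp: a_def A_def F_def)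
      next
        case False
        then have "i = 0 \<and> k = 0 \<or> i = m - k \<and> i + k \<noteq> 0"
          using that \<open>k \<le> m\<close> assms(4) by auto
        then show ?thesis using assms(4) by (auto simp: a_def A_def F_def)
      qed
      then have "(\<Sum>i\<le>m - k. a i k) = (\<Sum>i\<le>m - k. (if i = 0 then if k = 0 then V x else 0 else 0) + (if i = m - k then a (m - k) k else 0))"
        by (rule sum.cong[OF refl])
      then show ?thesis by (simp add: sum.distrib)
    qed
    have "(\<Sum>k\<le>m. a (m - k) k) = (\<Sum>j\<le>m. a j (m - j))"
      by (rule sum.reindex_bij_witness[of _ "\<lambda>j. m - j" "\<lambda>k. m - k"]) auto
    also have "\<dots> = \<epsilon> ^ m * Q"
      unfolding Q_def two_piece_coefficient_def sum_distrib_left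
    proof (rule sum.cong)
      fix j assume "j \<in> {..m}"
      then have "\<epsilon> ^ j * \<epsilon> ^ (m - j) = \<epsilon> ^ m" by (simp flip: power_add)
      then show "a j (m - j) = \<epsilon> ^ m * (\<alpha> ^ j / (fact j * fact (m - j)) *
          (lie_derivative X1 ^^ j) ((lie_derivative X2 ^^ (m - j)) V) x)"
        by (simp add: a_def A_def F_def power_mult_distrib mult_ac)
    qed simp
    finally have total: "(\<Sum>k\<le>m. \<Sum>i\<le>m - k. a i k) = V x + \<epsilon> ^ m * Q"
      by (simp add: inner sum.distrib)
    have "\<bar>(\<Sum>k\<le>m. F k p * \<epsilon> ^ k / fact k) - (\<Sum>k\<le>m. \<Sum>i\<le>m - k. a i k)\<bar>
        \<le> (\<Sum>k\<le>m. (Bd (A (Suc (m - k)) k) * \<alpha> ^ Suc (m - k) / fact k) * \<epsilon> ^ Suc m)"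
      unfolding sum_subtractf[symmetric] by (rule order_trans[OF sum_abs sum_mono], rule e3) simp
    then have "V (\<phi>2 \<epsilon>) \<le> V x + \<epsilon> ^ m * Q + D * \<epsilon> ^ Suc m"
      using e1 unfolding total D_def sum_distrib_right[symmetric] distrib_right by linarith
    also have "\<dots> = V x + \<epsilon> ^ m * (Q + D * \<epsilon>)" by (simp add: algebra_simps)
    also have "\<dots> < V x"
    proof -
      have "\<epsilon> * (\<bar>D\<bar> + 1) < - Q"
        using \<epsilon>(2) unfolding \<epsilon>0_def by (subst (asm) pos_less_divide_eq) auto
      moreover have "D * \<epsilon> \<le> \<bar>D\<bar> * \<epsilon>" using \<epsilon> by (intro mult_right_mono) auto
      moreover have "\<epsilon> * (\<bar>D\<bar> + 1) = \<bar>D\<bar> * \<epsilon> + \<epsilon>" by (simp add: algebra_simps)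
      ultimately have "Q + D * \<epsilon> < 0" using \<epsilon> by linarith
      then show ?thesis using \<epsilon> by (simp add: mult_pos_neg)
    qed
    finally show ?thesis .
  qed
  ultimately show ?thesis using that by blast
qed


definition descent_step ::
    "('a::euclidean_space \<Rightarrow> 'a) \<Rightarrow> ('a \<Rightarrow> 'a) \<Rightarrow> ('a \<Rightarrow> real) \<Rightarrow> real \<Rightarrow> real \<Rightarrow> 'a \<Rightarrow> bool"
  where "descent_step f g V \<delta> b y \<longleftrightarrow>
    (\<exists>y'. steers f g b y y' {z. V y / 2 \<le> V z \<and> V z \<le> 2 * V y} \<and> V y' \<le> V y - \<delta>)"

lemma descent_step_antimono: "descent_step f g V \<delta> b y \<Longrightarrow> d \<le> \<delta> \<Longrightarrow> descent_step f g V d b y"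
  unfolding descent_step_def by (meson diff_left_mono order_trans)

text \<open>For the initial state \<open>x\<close> the endpoint lies strictly below the level of \<open>x\<close>.  Since nearby solutions under the
same controls end nearby, half of this gap survives in a neighbourhood of \<open>x\<close>.\<close>

lemma local_descent:
  fixes f g :: "'a::euclidean_space \<Rightarrow> 'a" and V :: "'a \<Rightarrow> real"
  assumes "smooth f" "smooth g" "smooth V" "V x > 0" "m \<ge> 1" "\<alpha> \<ge> 0"
    and van: "\<And>j k. 0 < j + k \<Longrightarrow> j + k < m \<Longrightarrow>
      (lie_derivative (control_field f g u1) ^^ j) ((lie_derivative (control_field f g u2) ^^ k) V) x = 0"
    and neg: "two_piece_coefficient (control_field f g u1) (control_field f g u2) V m \<alpha> x < 0"
  shows "\<exists>\<delta>>0. \<exists>T\<ge>0. \<forall>y\<in>ball x \<delta>. descent_step f g V \<delta> T y"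
proof -
  define X1 where "X1 = (control_field f g u1)"
  define X2 where "X2 = (control_field f g u2)"
  have sX: "smooth X1" "smooth X2"
    unfolding X1_def X2_def by (intro smooth_add smooth_cmult assms)+
  have contV: "\<exists>d>0. \<forall>z. dist z p < d \<longrightarrow> \<bar>V z - V p\<bar> < e" if "e > 0" for p e
    using smooth_continuous_on[OF assms(3), of UNIV] that unfolding continuous_on_iff dist_real_def by auto
  obtain \<rho>' where \<rho>': "\<rho>' > 0" "\<And>z. dist z x < \<rho>' \<Longrightarrow> \<bar>V z - V x\<bar> < V x / 4"
    using contV[of "V x / 4" x] assms(4) by auto
  define \<rho> where "\<rho> = min 1 \<rho>'"
  have \<rho>: "\<rho> > 0" "\<rho> \<le> 1" "\<And>z. dist z x < \<rho> \<Longrightarrow> \<bar>V z - V x\<bar> < V x / 4"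
    using \<rho>' by (auto simp: \<rho>_def)
  obtain h1 M1 where "solvable_near X1 x h1 M1" using local_solutions[OF sX(1)] by blast
  note h1 = solvable_nearD(1,2)[OF this] and ex1 = solvable_nearD(3)[OF this]
    and inc1 = solvable_nearD(4)[OF this] and cmp1 = solvable_nearD(5)[OF this]
  obtain h2 M2 where "solvable_near X2 x h2 M2" using local_solutions[OF sX(2)] by blast
  note h2 = solvable_nearD(1,2)[OF this] and ex2 = solvable_nearD(3)[OF this]
    and inc2 = solvable_nearD(4)[OF this] and cmp2 = solvable_nearD(5)[OF this]
  obtain \<epsilon>0 where e0: "\<epsilon>0 > 0"
    and desc: "\<And>\<epsilon> \<phi>1 \<phi>2. 0 < \<epsilon> \<Longrightarrow> \<epsilon> < \<epsilon>0 \<Longrightarrow> solution_on X1 (\<alpha> * \<epsilon>) \<phi>1 \<Longrightarrow> \<phi>1 0 = x \<Longrightarrow>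
      \<phi>1 ` {0..\<alpha> * \<epsilon>} \<subseteq> cball x 2 \<Longrightarrow> solution_on X2 \<epsilon> \<phi>2 \<Longrightarrow> \<phi>2 0 = \<phi>1 (\<alpha> * \<epsilon>) \<Longrightarrow>
      \<phi>2 ` {0..\<epsilon>} \<subseteq> cball x 2 \<Longrightarrow> V (\<phi>2 \<epsilon>) < V x"
    using two_piece_descent[OF sX assms(3,5,6) van[folded X1_def X2_def] neg[folded X1_def X2_def]] by blast
  \<comment> \<open>short enough for both pieces to exist, to move by at most \<open>\<rho> / 4\<close> each, and to decrease \<open>V\<close> at \<open>x\<close>\<close>
  define \<epsilon> where "\<epsilon> = Min {\<epsilon>0 / 2, h2, \<rho> / (4 * M2), h1 / (\<alpha> + 1), \<rho> / (4 * M1 * (\<alpha> + 1))}"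
  have "\<epsilon> > 0" using e0 h1 h2 \<rho> assms(6) by (simp add: \<epsilon>_def)
  have "\<epsilon> \<le> \<epsilon>0 / 2" "\<epsilon> \<le> h2" "\<epsilon> \<le> \<rho> / (4 * M2)" "\<epsilon> \<le> h1 / (\<alpha> + 1)" "\<epsilon> \<le> \<rho> / (4 * M1 * (\<alpha> + 1))"
    unfolding \<epsilon>_def by (intro Min_le; simp)+
  then have eps: "\<epsilon> > 0" "\<epsilon> < \<epsilon>0" "\<epsilon> \<le> h2" "M2 * \<epsilon> \<le> \<rho> / 4" "\<epsilon> * (\<alpha> + 1) \<le> h1" "M1 * (\<epsilon> * (\<alpha> + 1)) \<le> \<rho> / 4"
    using \<open>\<epsilon> > 0\<close> e0 h1 h2 assms(6) by (auto simp: field_simps add_pos_nonneg)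
  then have ah: "\<alpha> * \<epsilon> \<ge> 0" "\<alpha> * \<epsilon> \<le> h1"
    using assms(6) by (auto simp: algebra_simps)
  have Ma: "M1 * (\<alpha> * \<epsilon>) \<le> \<rho> / 4"
  proof -
    have "M1 * (\<epsilon> * (\<alpha> + 1)) = M1 * (\<alpha> * \<epsilon>) + M1 * \<epsilon>" by (simp add: algebra_simps)
    then show ?thesis using eps(6) mult_pos_pos[OF h1(2) eps(1)] by linarith
  qed
  have pieces: "\<exists>\<phi>1 \<phi>2. solution_on X1 (\<alpha> * \<epsilon>) \<phi>1 \<and> \<phi>1 0 = y \<and> \<phi>1 ` {0..\<alpha> * \<epsilon>} \<subseteq> ball x \<rho> \<and>
      solution_on X2 \<epsilon> \<phi>2 \<and> \<phi>2 0 = \<phi>1 (\<alpha> * \<epsilon>) \<and> \<phi>2 ` {0..\<epsilon>} \<subseteq> ball x \<rho>" if y: "dist y x < \<rho> / 4" for y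
  proof -
    have "y \<in> cball x 1" using y \<rho> by (simp add: dist_commute)
    from ex1[OF this] obtain \<phi>1 where p1: "\<phi>1 0 = y" "solution_on X1 h1 \<phi>1" "\<phi>1 ` {0..h1} \<subseteq> cball x 2" by blast
    have s1: "solution_on X1 (\<alpha> * \<epsilon>) \<phi>1" using solution_on_subinterval[OF p1(2) ah(2)] .
    have d1: "dist (\<phi>1 t) x < \<rho> / 2" if "t \<in> {0..\<alpha> * \<epsilon>}" for t
    proof -
      have "norm (\<phi>1 t - \<phi>1 0) \<le> M1 * t" using that ah by (intro inc1[OF p1(2,3)]) auto
      also have "\<dots> \<le> M1 * (\<alpha> * \<epsilon>)" using that h1 by (intro mult_left_mono) auto
      finally have "dist (\<phi>1 t) y \<le> \<rho> / 4" using p1 Ma by (simp add: dist_norm)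
      then show ?thesis using y dist_triangle[of "\<phi>1 t" x y] by linarith
    qed
    have "dist (\<phi>1 (\<alpha> * \<epsilon>)) x < \<rho> / 2" using d1 ah by auto
    then have "\<phi>1 (\<alpha> * \<epsilon>) \<in> cball x 1" using \<rho> by (simp add: dist_commute)
    from ex2[OF this] obtain \<phi>2 where p2: "\<phi>2 0 = \<phi>1 (\<alpha> * \<epsilon>)" "solution_on X2 h2 \<phi>2" "\<phi>2 ` {0..h2} \<subseteq> cball x 2" by blast
    have s2: "solution_on X2 \<epsilon> \<phi>2" using solution_on_subinterval[OF p2(2) eps(3)] .
    have d2: "dist (\<phi>2 t) x < \<rho>" if "t \<in> {0..\<epsilon>}" for t
    proof -
      have "norm (\<phi>2 t - \<phi>2 0) \<le> M2 * t" using that eps by (intro inc2[OF p2(2,3)]) auto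
      also have "\<dots> \<le> M2 * \<epsilon>" using that h2 by (intro mult_left_mono) auto
      finally have "dist (\<phi>2 t) (\<phi>1 (\<alpha> * \<epsilon>)) \<le> \<rho> / 4" using p2 eps by (simp add: dist_norm)
      then show ?thesis using \<open>dist (\<phi>1 (\<alpha> * \<epsilon>)) x < \<rho> / 2\<close> \<rho>(1) dist_triangle[of "\<phi>2 t" x "\<phi>1 (\<alpha> * \<epsilon>)"] by linarith
    qed
    have "\<phi>1 ` {0..\<alpha> * \<epsilon>} \<subseteq> ball x \<rho>"
    proof (rule image_subsetI)
      fix t assume "t \<in> {0..\<alpha> * \<epsilon>}"
      from d1[OF this] show "\<phi>1 t \<in> ball x \<rho>" using \<rho>(1) by (simp add: dist_commute)
    qed
    moreover have "\<phi>2 ` {0..\<epsilon>} \<subseteq> ball x \<rho>"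
      using d2 by (auto simp: dist_commute)
    ultimately show ?thesis using s1 s2 p1(1) p2(1) by blast
  qed
  have sub: "ball x \<rho> \<subseteq> cball x 2" using \<rho> by auto
  obtain \<phi>1 \<phi>2 where x1: "solution_on X1 (\<alpha> * \<epsilon>) \<phi>1" "\<phi>1 0 = x" "\<phi>1 ` {0..\<alpha> * \<epsilon>} \<subseteq> ball x \<rho>"
    and x2: "solution_on X2 \<epsilon> \<phi>2" "\<phi>2 0 = \<phi>1 (\<alpha> * \<epsilon>)" "\<phi>2 ` {0..\<epsilon>} \<subseteq> ball x \<rho>"
    using pieces[of x] \<rho> by auto
  define \<gamma> where "\<gamma> = V x - V (\<phi>2 \<epsilon>)"
  have "\<gamma> > 0"
    using desc[OF eps(1,2) x1(1,2) _ x2(1,2)] x1(3) x2(3) sub unfolding \<gamma>_def by auto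
  obtain \<delta>1 where d1: "\<delta>1 > 0" "\<And>z. dist z (\<phi>2 \<epsilon>) < \<delta>1 \<Longrightarrow> \<bar>V z - V (\<phi>2 \<epsilon>)\<bar> < \<gamma> / 4"
    using contV[of "\<gamma> / 4" "\<phi>2 \<epsilon>"] \<open>\<gamma> > 0\<close> by auto
  obtain \<delta>2 where d2: "\<delta>2 > 0" "\<And>z. dist z x < \<delta>2 \<Longrightarrow> \<bar>V z - V x\<bar> < \<gamma> / 4"
    using contV[of "\<gamma> / 4" x] \<open>\<gamma> > 0\<close> by auto
  \<comment> \<open>the endpoint moves by less than \<open>3 \<delta>\<close> when the initial state moves by less than \<open>\<delta>\<close>\<close>
  define \<delta> where "\<delta> = Min {\<rho> / 4, \<delta>1 / 3, \<delta>2, \<gamma> / 2}"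
  have "\<delta> > 0" using \<rho> d1 d2 \<open>\<gamma> > 0\<close> by (simp add: \<delta>_def)
  have del: "\<delta> \<le> \<rho> / 4" "\<delta> \<le> \<delta>1 / 3" "\<delta> \<le> \<delta>2" "\<delta> \<le> \<gamma> / 2"
    unfolding \<delta>_def by (intro Min_le; simp)+
  have "descent_step f g V \<delta> (\<alpha> * \<epsilon> + \<epsilon>) y"
    if "y \<in> ball x \<delta>" for y
  proof -
    have y: "dist y x < \<delta>" using that by (simp add: dist_commute)
    obtain \<psi>1 \<psi>2 where y1: "solution_on X1 (\<alpha> * \<epsilon>) \<psi>1" "\<psi>1 0 = y" "\<psi>1 ` {0..\<alpha> * \<epsilon>} \<subseteq> ball x \<rho>"
      and y2: "solution_on X2 \<epsilon> \<psi>2" "\<psi>2 0 = \<psi>1 (\<alpha> * \<epsilon>)" "\<psi>2 ` {0..\<epsilon>} \<subseteq> ball x \<rho>"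
      using pieces[of y] y del by auto
    have grow: "norm a \<le> norm b + norm b / 2" if "norm (a - b) \<le> norm b / 2" for a b :: 'a
      using that norm_triangle_ineq2[of a b] by linarith
    have "norm (\<psi>1 (\<alpha> * \<epsilon>) - \<phi>1 (\<alpha> * \<epsilon>)) \<le> norm (y - x) + norm (y - x) / 2"
      using cmp1[OF ah(2) y1(1) subset_trans[OF y1(3) sub] x1(1) subset_trans[OF x1(3) sub], of "\<alpha> * \<epsilon>"] ah
      by (intro grow) (simp add: x1 y1)
    moreover have "norm (\<psi>2 \<epsilon> - \<phi>2 \<epsilon>) \<le> norm (\<psi>2 0 - \<phi>2 0) + norm (\<psi>2 0 - \<phi>2 0) / 2"
      using cmp2[OF eps(3) y2(1) subset_trans[OF y2(3) sub] x2(1) subset_trans[OF x2(3) sub], of \<epsilon>] eps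
      by (intro grow) simp
    ultimately have "norm (\<psi>2 \<epsilon> - \<phi>2 \<epsilon>) \<le> 3 * norm (y - x)"
      using norm_ge_zero[of "y - x"] unfolding x2(2) y2(2) by linarith
    then have "dist (\<psi>2 \<epsilon>) (\<phi>2 \<epsilon>) < \<delta>1" using y del by (simp add: dist_norm)
    then have "\<bar>V (\<psi>2 \<epsilon>) - V (\<phi>2 \<epsilon>)\<bar> < \<gamma> / 4" by (rule d1(2))
    moreover have "\<bar>V y - V x\<bar> < \<gamma> / 4" using y del by (intro d2(2)) linarith
    ultimately have dec: "V (\<psi>2 \<epsilon>) \<le> V y - \<delta>" using del(4) \<gamma>_def by linarith
    have "dist y x < \<rho>" using y del \<rho> by linarith
    have A: "ball x \<rho> \<subseteq> {z. V y / 2 \<le> V z \<and> V z \<le> 2 * V y}"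
    proof
      fix z assume "z \<in> ball x \<rho>"
      then have "\<bar>V z - V x\<bar> < V x / 4" by (intro \<rho>(3)) (simp add: dist_commute)
      moreover have "\<bar>V y - V x\<bar> < V x / 4" by (rule \<rho>(3)) fact
      ultimately have "V y / 2 \<le> V z \<and> V z \<le> 2 * V y" by argo
      then show "z \<in> {z. V y / 2 \<le> V z \<and> V z \<le> 2 * V y}" by simp
    qed
    have "steers f g (\<alpha> * \<epsilon>) y (\<psi>1 (\<alpha> * \<epsilon>)) (ball x \<rho>)"
      using solution_on_steers[OF y1(1)[unfolded X1_def] y1(3)] by (simp add: y1(2))
    moreover have "steers f g \<epsilon> (\<psi>1 (\<alpha> * \<epsilon>)) (\<psi>2 \<epsilon>) (ball x \<rho>)"
      using solution_on_steers[OF y2(1)[unfolded X2_def] y2(3)] by (simp add: y2(2))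
    ultimately have "steers f g (\<alpha> * \<epsilon> + \<epsilon>) y (\<psi>2 \<epsilon>) (ball x \<rho>)"
      by (rule steers_trans) (use ah eps in auto)
    then show ?thesis unfolding descent_step_def using dec steers_mono[OF _ A] by blast
  qed
  moreover have "\<alpha> * \<epsilon> + \<epsilon> \<ge> 0" using ah eps by auto
  ultimately show ?thesis using \<open>\<delta> > 0\<close> by blast
qed


section \<open>Gluing along a sequence of sampling times\<close>

definition sample_index :: "(nat \<Rightarrow> real) \<Rightarrow> real \<Rightarrow> nat"
  where "sample_index s t = (LEAST n. t < s (Suc n))"

lemma sample_index_eq:
  assumes "sampling_times s" "s n \<le> t" "t < s (Suc n)"
  shows "sample_index s t = n"
  unfolding sample_index_def
proof (rule Least_equality)
  fix k assume "t < s (Suc k)"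
  then have "s n < s (Suc k)" using assms(2) by linarith
  then show "n \<le> k"
    using assms(1) by (auto simp: sampling_times_def strict_mono_less)
qed fact

lemma sampling_interval_exists:
  assumes "sampling_times s" "t \<ge> 0"
  obtains n where "s n \<le> t" "t < s (Suc n)"
proof -
  have "\<exists>n. t < s n"
    using assms(1) unfolding sampling_times_def filterlim_at_top_dense
    by (meson eventually_happens trivial_limit_sequentially)
  then obtain n where n: "t < s n" "\<And>k. k < n \<Longrightarrow> \<not> t < s k"
    using exists_least_iff[of "\<lambda>n. t < s n"] by blast
  then have "n \<noteq> 0" using assms by (auto simp: sampling_times_def intro: gr0I)
  then show ?thesis using n that[of "n - 1"] by (auto simp: not_less)
qed

lemma sampling_interval_after:
  assumes "sampling_times s" "t \<ge> s m"
  obtains n where "m \<le> n" "s n \<le> t" "t < s (Suc n)"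
proof -
  have mono: "s i < s j \<longleftrightarrow> i < j" for i j
    using assms(1) by (simp add: sampling_times_def strict_mono_less)
  have "s 0 \<le> s m" using mono[of m 0] by linarith
  then have "t \<ge> 0" using assms by (simp add: sampling_times_def)
  then obtain n where n: "s n \<le> t" "t < s (Suc n)" using sampling_interval_exists[OF assms(1)] by blast
  then have "s m < s (Suc n)" using assms(2) by linarith
  then show ?thesis using that[of n] n mono by simp
qed

lemma tame_control_glue:
  assumes s: "sampling_times s" and v: "\<And>n. tame_control (v n)"
  shows "tame_control (\<lambda>t. v (sample_index s t) t)"
  unfolding tame_control_def
proof (intro conjI allI)
  have [measurable]: "sample_index s \<in> measurable borel (count_space UNIV)"
    unfolding sample_index_def[abs_def] by measurable
  have [measurable]: "v n \<in> borel_measurable borel" for n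
    using v by (auto simp: tame_control_def)
  show "(\<lambda>t. v (sample_index s t) t) \<in> borel_measurable borel"
    by (rule measurable_compose_countable[where f = v]) auto
  fix c
  obtain N where N: "\<bar>c\<bar> < s (Suc N)"
    using sampling_interval_exists[OF s, of "\<bar>c\<bar>"] by auto
  have "\<forall>n. \<exists>B. \<forall>t. \<bar>t\<bar> \<le> c \<longrightarrow> \<bar>v n t\<bar> \<le> B"
    using v unfolding tame_control_def by blast
  then obtain B where B: "\<And>n t. \<bar>t\<bar> \<le> c \<Longrightarrow> \<bar>v n t\<bar> \<le> B n"
    unfolding choice_iff by blast
  have "\<bar>v (sample_index s t) t\<bar> \<le> (\<Sum>n\<le>N. \<bar>B n\<bar>)" if "\<bar>t\<bar> \<le> c" for t
  proof -
    have "t < s (Suc N)" using that N by linarith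
    then have "sample_index s t \<in> {..N}"
      unfolding sample_index_def by (simp add: Least_le)
    then have "\<bar>B (sample_index s t)\<bar> \<le> (\<Sum>n\<le>N. \<bar>B n\<bar>)"
      by (intro member_le_sum) auto
    then show ?thesis using B[OF that, of "sample_index s t"] by linarith
  qed
  then show "\<exists>B. \<forall>t. \<bar>t\<bar> \<le> c \<longrightarrow> \<bar>v (sample_index s t) t\<bar> \<le> B" by blast
qed

lemma tame_control_admissible: "tame_control u \<Longrightarrow> admissible_input u"
  unfolding admissible_input_def
proof (intro conjI allI impI)
  assume u: "tame_control u"
  then have "u \<in> borel_measurable lborel" by (simp add: tame_control_def)
  then have "u \<in> borel_measurable lebesgue" by (rule measurable_completion)
  then show "u \<in> borel_measurable (lebesgue_on {0..})" by (rule measurable_restrict_space1)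
  fix b :: real assume "0 \<le> b"
  obtain B where "\<And>t. \<bar>t\<bar> \<le> b \<Longrightarrow> \<bar>u t\<bar> \<le> B"
    using u unfolding tame_control_def by blast
  then show "\<exists>M. AE t in lebesgue_on {0..b}. norm (u t) \<le> M"
    by (intro exI[of _ B] AE_I2) auto
qed

text \<open>The control is measurable and bounded on \<open>[a, t]\<close>, hence so is the right-hand side along the continuous
trajectory.\<close>

lemma control_arc_integral:
  fixes f g :: "'a::euclidean_space \<Rightarrow> 'a"
  assumes "smooth f" "smooth g" "tame_control u" and arc: "control_arc f g a b u z" and t: "t \<in> {a..b}"
  shows "(\<lambda>s. f (z s) + u s *\<^sub>R g (z s)) absolutely_integrable_on {a..t} \<and>
    z t = z a + integral {a..t} (\<lambda>s. f (z s) + u s *\<^sub>R g (z s))"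
proof -
  let ?F = "\<lambda>s. f (z s) + u s *\<^sub>R g (z s)"
  have arc': "control_arc f g a t u z" using control_arc_subinterval[OF arc] t by auto
  then obtain S where S: "finite S" "\<And>s. s \<in> {a<..<t} - S \<Longrightarrow> (z has_vector_derivative ?F s) (at s)"
    and z: "continuous_on {a..t} z"
    unfolding control_arc_def by blast
  have "(?F has_integral (z t - z a)) {a..t}"
    by (rule fundamental_theorem_of_calculus_interior_strong[OF S(1) _ S(2) z]) (use t in auto)
  then have eq: "integral {a..t} ?F = z t - z a" by (rule integral_unique)
  have cf: "continuous_on {a..t} (\<lambda>s. f (z s))" and cg: "continuous_on {a..t} (\<lambda>s. g (z s))"
    by (rule continuous_on_compose2[OF smooth_continuous_on[of _ UNIV] z]; use assms in simp)+
  have "bounded ((\<lambda>s. f (z s)) ` {a..t})" "bounded ((\<lambda>s. g (z s)) ` {a..t})"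
    by (intro compact_imp_bounded compact_continuous_image cf cg; simp)+
  then obtain C D where CD: "\<forall>p\<in>(\<lambda>s. f (z s)) ` {a..t}. norm p \<le> C" "\<forall>p\<in>(\<lambda>s. g (z s)) ` {a..t}. norm p \<le> D"
    unfolding bounded_iff by blast
  have C: "norm (f (z s)) \<le> C" and D: "norm (g (z s)) \<le> D" if "s \<in> {a..t}" for s
    using CD that by blast+
  obtain B where B: "\<And>s. \<bar>s\<bar> \<le> max \<bar>a\<bar> \<bar>t\<bar> \<Longrightarrow> \<bar>u s\<bar> \<le> B"
    using assms(3) unfolding tame_control_def by blast
  have "?F absolutely_integrable_on {a..t}"
  proof (rule measurable_bounded_by_integrable_imp_absolutely_integrable[where g = "\<lambda>s. C + B * D"])
    have "u \<in> borel_measurable lborel" using assms(3) by (simp add: tame_control_def)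
    then have "u \<in> borel_measurable lebesgue" by (rule measurable_completion)
    then have [measurable]: "u \<in> borel_measurable (lebesgue_on {a..t})" by (rule measurable_restrict_space1)
    have [measurable]: "(\<lambda>s. f (z s)) \<in> borel_measurable (lebesgue_on {a..t})"
      "(\<lambda>s. g (z s)) \<in> borel_measurable (lebesgue_on {a..t})"
      by (intro continuous_imp_measurable_on_sets_lebesgue cf cg; simp)+
    show "?F \<in> borel_measurable (lebesgue_on {a..t})" by measurable
    fix s assume s: "s \<in> {a..t}"
    have "\<bar>s\<bar> \<le> max \<bar>a\<bar> \<bar>t\<bar>" using s by auto
    from B[OF this] have u: "\<bar>u s\<bar> \<le> B" .
    have "norm (?F s) \<le> norm (f (z s)) + \<bar>u s\<bar> * norm (g (z s))"
      by (rule order_trans[OF norm_triangle_ineq]) simp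
    also have "\<dots> \<le> C + B * D"
      using C[OF s] D[OF s] u order_trans[OF abs_ge_zero u] by (intro add_mono mult_mono) auto
    finally show "norm (?F s) \<le> C + B * D" .
  qed auto
  then show ?thesis using eq by simp
qed

section \<open>Open-loop plans\<close>

text \<open>What the global part needs of the Lie-algebraic hypothesis is only that \<open>V\<close> can be lowered by a fixed amount
from all states of a ball around each nonzero state.\<close>

locale descent_system =
  fixes f g :: "'a::euclidean_space \<Rightarrow> 'a" and V :: "'a \<Rightarrow> real"
  assumes smooth_f: "smooth f" and smooth_g: "smooth g" and f_0: "f 0 = 0"
    and continuous_V: "continuous_on UNIV V"
    and V_definite: "positive_definite V" and V_proper: "proper_function V"
    and descent: "\<And>x. x \<noteq> 0 \<Longrightarrow> \<exists>\<delta>>0. \<exists>T\<ge>0. \<forall>y\<in>ball x \<delta>. descent_step f g V \<delta> T y"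
begin

lemma V_0: "V 0 = 0" and V_pos: "x \<noteq> 0 \<Longrightarrow> V x > 0"
  using V_definite unfolding positive_definite_def by auto

lemma V_nonneg: "V x \<ge> 0"
  using V_0 V_pos[of x] by (cases "x = 0") auto

lemma V_pos_iff: "V x > 0 \<longleftrightarrow> x \<noteq> 0"
  using V_0 V_pos by auto

lemma V_small_if_norm_small: "e > 0 \<Longrightarrow> \<exists>d>0. \<forall>x. norm x \<le> d \<longrightarrow> V x < e"
proof -
  assume "e > 0"
  then obtain d where d: "d > 0" "\<And>x. dist x 0 < d \<Longrightarrow> dist (V x) (V 0) < e"
    using continuous_V unfolding continuous_on_iff by (metis UNIV_I)
  then have "V x < e" if "norm x \<le> d / 2" for x
  proof -
    have "dist x 0 < d" using d(1) that by simp
    from d(2)[OF this] show ?thesis by (simp add: V_0 dist_real_def)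
  qed
  then show ?thesis using d(1) half_gt_zero by blast
qed

text \<open>Off a ball, \<open>V\<close> has a positive minimum on the compact set \<open>{V \<le> 1}\<close>.\<close>

lemma norm_small_if_V_small: "e > 0 \<Longrightarrow> \<exists>\<eta>>0. \<forall>x. V x < \<eta> \<longrightarrow> norm x < e"
proof -
  assume e: "e > 0"
  define K where "K = V -` {0..1} - ball 0 e"
  have "compact (V -` {0..1})" using V_proper unfolding proper_function_def by simp
  then have K: "compact K" unfolding K_def by (intro compact_diff) auto
  show ?thesis
  proof (cases "K = {}")
    case True
    then have "norm x < e" if "V x < 1" for x
    proof -
      have "x \<in> V -` {0..1}" using that V_nonneg[of x] by simp
      then have "x \<in> ball 0 e" using True unfolding K_def by blast
      then show ?thesis by simp
    qed
    then show ?thesis using zero_less_one by blast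
  next
    case False
    then obtain p where p: "p \<in> K" "\<And>x. x \<in> K \<Longrightarrow> V p \<le> V x"
      using continuous_attains_inf[OF K False continuous_on_subset[OF continuous_V]] by auto
    have "p \<noteq> 0" using p(1) e by (auto simp: K_def)
    then have "V p > 0" by (rule V_pos)
    moreover have "norm x < e" if "V x < min 1 (V p)" for x
      using that V_nonneg[of x] p(2)[of x] by (fastforce simp: K_def)
    ultimately show ?thesis by (intro exI[of _ "min 1 (V p)"]) auto
  qed
qed

text \<open>The shell \<open>{\<eta> \<le> V \<le> c}\<close> is compact because \<open>V\<close> is proper, so finitely many of the balls cover it.\<close>

lemma uniform_descent:
  assumes "\<eta> > 0"
  shows "\<exists>d>0. \<forall>y. \<eta> \<le> V y \<and> V y \<le> c \<longrightarrow>
    (\<exists>b\<ge>0. descent_step f g V d b y)"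
proof -
  define K where "K = V -` {\<eta>..c}"
  have "compact K" using V_proper assms unfolding proper_function_def K_def by simp
  have "\<forall>x\<in>K. x \<noteq> 0" using assms V_0 by (auto simp: K_def)
  then have "\<forall>x. \<exists>\<delta>. x \<in> K \<longrightarrow> \<delta> > 0 \<and> (\<forall>y\<in>ball x \<delta>. \<exists>b\<ge>0. descent_step f g V \<delta> b y)"
  proof (intro allI)
    fix x
    show "\<exists>\<delta>. x \<in> K \<longrightarrow> \<delta> > 0 \<and> (\<forall>y\<in>ball x \<delta>. \<exists>b\<ge>0. descent_step f g V \<delta> b y)"
    proof (cases "x \<in> K")
      case True
      with \<open>\<forall>x\<in>K. x \<noteq> 0\<close> have "x \<noteq> 0" by blast
      from descent[OF this] obtain \<delta> T where "\<delta> > 0" "T \<ge> 0" and st: "\<forall>y\<in>ball x \<delta>. descent_step f g V \<delta> T y"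
        by (elim exE conjE)
      show ?thesis
        by (intro exI[of _ \<delta>] impI conjI ballI exI[of _ T] \<open>\<delta> > 0\<close> \<open>T \<ge> 0\<close> st[rule_format])
    qed simp
  qed
  then obtain \<delta> where *: "\<forall>x. x \<in> K \<longrightarrow> \<delta> x > 0 \<and> (\<forall>y\<in>ball x (\<delta> x). \<exists>b\<ge>0. descent_step f g V (\<delta> x) b y)"
    unfolding choice_iff by blast
  then have \<delta>: "\<And>x. x \<in> K \<Longrightarrow> \<delta> x > 0" by blast
  have st: "\<exists>b\<ge>0. descent_step f g V (\<delta> x) b y"
    if "x \<in> K" "y \<in> ball x (\<delta> x)" for x y
    using * that by blast
  obtain D where D: "D \<subseteq> K" "finite D" "K \<subseteq> (\<Union>x\<in>D. ball x (\<delta> x))"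
  proof (rule compactE_image[OF \<open>compact K\<close>, of K "\<lambda>x. ball x (\<delta> x)"])
    show "K \<subseteq> (\<Union>x\<in>K. ball x (\<delta> x))" using \<delta> by force
  qed auto
  define d where "d = Min (insert 1 (\<delta> ` D))"
  have "d > 0" using D \<delta> by (auto simp: d_def)
  moreover have "\<exists>b\<ge>0. descent_step f g V d b y"
    if "\<eta> \<le> V y \<and> V y \<le> c" for y
  proof -
    have "y \<in> K" using that by (simp add: K_def)
    then obtain x where x: "x \<in> D" "y \<in> ball x (\<delta> x)" using D by blast
    have "d \<le> \<delta> x" unfolding d_def using x D by (intro Min_le) auto
    then show ?thesis using st[of x y] x D descent_step_antimono by blast
  qed
  ultimately show ?thesis by blast
qed

text \<open>Each step lowers \<open>V\<close> by at least \<open>d\<close>, so finitely many steps suffice; the excursion above the current level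
is always measured against a smaller value than the initial one.\<close>

lemma descend_below:
  assumes "y \<noteq> 0" "\<eta> > 0"
  shows "\<exists>b\<ge>0. \<exists>y'. steers f g b y y' {z. 0 < V z \<and> V z \<le> 2 * V y} \<and> V y' < \<eta>"
proof -
  define c where "c = V y"
  obtain d where d: "d > 0" and step: "\<And>y. \<eta> \<le> V y \<Longrightarrow> V y \<le> c \<Longrightarrow>
    \<exists>b\<ge>0. descent_step f g V d b y"
    using uniform_descent[OF assms(2), of c] by blast
  have "\<exists>b\<ge>0. \<exists>y'. steers f g b y y' {z. 0 < V z \<and> V z \<le> 2 * V y} \<and> V y' < \<eta>"
    if "V y > 0" "V y \<le> c" "V y < \<eta> + real n * d" for y n
    using that
  proof (induction n arbitrary: y)
    case 0
    then show ?case
      by (intro exI[of _ 0] conjI exI[of _ y] steers_refl) auto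
  next
    case (Suc n)
    show ?case
    proof (cases "V y < \<eta>")
      case True
      then show ?thesis using Suc.prems by (intro exI[of _ 0] conjI exI[of _ y] steers_refl) auto
    next
      case False
      then obtain b y1 where b: "b \<ge> 0" and st: "steers f g b y y1 {z. V y / 2 \<le> V z \<and> V z \<le> 2 * V y}"
        and dec: "V y1 \<le> V y - d"
        using step[of y] Suc.prems unfolding descent_step_def by auto
      have "V y1 > 0" using steers_end[OF st b] Suc.prems by auto
      moreover have "V y1 \<le> c" "V y1 < \<eta> + real n * d"
        using dec d Suc.prems by (auto simp: algebra_simps)
      ultimately obtain b' y2 where b': "b' \<ge> 0" and st': "steers f g b' y1 y2 {z. 0 < V z \<and> V z \<le> 2 * V y1}"
        and "V y2 < \<eta>"
        using Suc.IH by blast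
      have "steers f g b y y1 {z. 0 < V z \<and> V z \<le> 2 * V y}"
        using Suc.prems by (intro steers_mono[OF st]) auto
      moreover have "steers f g b' y1 y2 {z. 0 < V z \<and> V z \<le> 2 * V y}"
        using dec d by (intro steers_mono[OF st']) auto
      ultimately have "steers f g (b + b') y y2 {z. 0 < V z \<and> V z \<le> 2 * V y}"
        using b b' by (rule steers_trans)
      then show ?thesis using \<open>V y2 < \<eta>\<close> b b' by (intro exI[of _ "b + b'"]) auto
    qed
  qed
  moreover obtain n where "V y < \<eta> + real n * d"
  proof -
    obtain n where "V y / d < real n" using reals_Archimedean2 by blast
    then have "V y < real n * d" using d by (simp add: field_simps)
    then show ?thesis using assms(2) by (intro that[of n]) linarith
  qed
  ultimately show ?thesis using V_pos[OF assms(1)] c_def by blast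
qed

text \<open>Under zero control the origin is an equilibrium.  Comparison with the zero solution bounds the state from
above and away from \<open>0\<close>, for a time \<open>w\<close> that does not depend on the initial state.\<close>

lemma wait_near_origin:
  "\<exists>w>0. \<forall>y. y \<noteq> 0 \<and> norm y \<le> 1 \<longrightarrow> (\<exists>y'. steers f g w y y' {z. z \<noteq> 0 \<and> norm z \<le> 2 * norm y})"
proof -
  obtain h M where "solvable_near f 0 h M" using local_solutions[OF smooth_f] by blast
  note h = solvable_nearD(1)[OF this] and ex = solvable_nearD(3)[OF this] and cmp = solvable_nearD(5)[OF this]
  have "\<exists>y'. steers f g h y y' {z. z \<noteq> 0 \<and> norm z \<le> 2 * norm y}" if y: "y \<noteq> 0" "norm y \<le> 1" for y
  proof -
    obtain \<phi> where \<phi>: "\<phi> 0 = y" "solution_on f h \<phi>" "\<phi> ` {0..h} \<subseteq> cball 0 2"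
      using ex[of y] y by auto
    have zero: "solution_on f h (\<lambda>t. 0)" by (simp add: solution_on_def f_0)
    have "\<phi> t \<in> {z. z \<noteq> 0 \<and> norm z \<le> 2 * norm y}" if "t \<in> {0..h}" for t
    proof -
      have "norm ((\<phi> t - 0) - (\<phi> 0 - 0)) \<le> norm (\<phi> 0 - 0) / 2"
        by (rule cmp[OF order_refl \<phi>(2,3) zero _ that]) auto
      then have "norm (\<phi> t - y) \<le> norm y / 2" by (simp add: \<phi>(1))
      then show ?thesis
        using y(1) norm_triangle_ineq2[of "\<phi> t" y] norm_triangle_ineq3[of "\<phi> t" y] by auto
    qed
    then have "\<phi> ` {0..h} \<subseteq> {z. z \<noteq> 0 \<and> norm z \<le> 2 * norm y}" by (rule image_subsetI)
    then show ?thesis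
      using solution_on_steers[of f 0 g h \<phi>] \<phi>(1,2) by auto
  qed
  then show ?thesis using h by blast
qed

text \<open>First \<open>V\<close> is lowered so far that even the subsequent waiting period cannot bring it above \<open>V y / 2\<close>.  The
waiting period makes every step last at least \<open>w\<close>.\<close>

lemma halving_step:
  "\<exists>w>0. \<forall>y. y \<noteq> 0 \<longrightarrow> (\<exists>b\<ge>w. \<exists>y'. steers f g b y y' {z. z \<noteq> 0 \<and> V z \<le> 2 * V y} \<and> V y' \<le> V y / 2)"
proof -
  obtain w where w: "w > 0"
    and wait: "\<And>y. y \<noteq> 0 \<Longrightarrow> norm y \<le> 1 \<Longrightarrow> \<exists>y'. steers f g w y y' {z. z \<noteq> 0 \<and> norm z \<le> 2 * norm y}"
    using wait_near_origin by blast
  have "\<exists>b\<ge>w. \<exists>y'. steers f g b y y' {z. z \<noteq> 0 \<and> V z \<le> 2 * V y} \<and> V y' \<le> V y / 2" if y: "y \<noteq> 0" for y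
  proof -
    have "V y / 2 > 0" using V_pos[OF y] by simp
    from V_small_if_norm_small[OF this] obtain d where d: "d > 0" "\<And>x. norm x \<le> d \<Longrightarrow> V x < V y / 2" by blast
    have "min 1 (d / 2) > 0" using d by simp
    from norm_small_if_V_small[OF this] obtain \<eta> where \<eta>: "\<eta> > 0" "\<And>x. V x < \<eta> \<Longrightarrow> norm x < min 1 (d / 2)" by blast
    obtain b y1 where b: "b \<ge> 0" and st: "steers f g b y y1 {z. 0 < V z \<and> V z \<le> 2 * V y}" and y1: "V y1 < \<eta>"
      using descend_below[OF y \<eta>(1)] by blast
    have n1: "norm y1 < min 1 (d / 2)" by (rule \<eta>(2)[OF y1])
    have "y1 \<noteq> 0" using steers_end[OF st b] V_0 by auto
    then obtain y2 where st2: "steers f g w y1 y2 {z. z \<noteq> 0 \<and> norm z \<le> 2 * norm y1}"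
      using wait[of y1] n1 by auto
    have small: "V z < V y / 2" if "norm z \<le> 2 * norm y1" for z
      using that n1 by (intro d(2)) auto
    have "steers f g b y y1 {z. z \<noteq> 0 \<and> V z \<le> 2 * V y}"
      by (rule steers_mono[OF st]) (auto simp: V_pos_iff)
    moreover have "steers f g w y1 y2 {z. z \<noteq> 0 \<and> V z \<le> 2 * V y}"
      by (rule steers_mono[OF st2]) (use small V_pos[OF \<open>y \<noteq> 0\<close>] in fastforce)
    ultimately have "steers f g (b + w) y y2 {z. z \<noteq> 0 \<and> V z \<le> 2 * V y}"
      by (rule steers_trans) (use b w in auto)
    moreover have "V y2 \<le> V y / 2"
      using steers_end[OF st2] w small[of y2] by auto
    ultimately show ?thesis using b by (intro exI[of _ "b + w"]) auto
  qed
  then show ?thesis using w by blast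
qed

text \<open>The steps are iterated and glued.  Their durations are bounded below, so they fill the whole half-line, and
\<open>V\<close> at most doubles within a step while its values between steps decrease geometrically.\<close>

lemma open_loop_plan:
  assumes "y \<noteq> 0"
  shows "\<exists>u z. tame_control u \<and> (\<forall>b. control_arc f g 0 b u z) \<and> z 0 = y \<and>
    (\<forall>t\<ge>0. z t \<noteq> 0 \<and> V (z t) \<le> 2 * V y) \<and> (z \<longlongrightarrow> 0) at_top"
proof -
  obtain w where w: "w > 0"
    and "\<And>y. y \<noteq> 0 \<Longrightarrow> \<exists>b\<ge>w. \<exists>y'. steers f g b y y' {z. z \<noteq> 0 \<and> V z \<le> 2 * V y} \<and> V y' \<le> V y / 2"
    using halving_step by blast
  then have "\<forall>y. \<exists>b y' u z. y \<noteq> 0 \<longrightarrow> b \<ge> w \<and> V y' \<le> V y / 2 \<and>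
      tame_control u \<and> control_arc f g 0 b u z \<and> z 0 = y \<and> z b = y' \<and> z ` {0..b} \<subseteq> {z. z \<noteq> 0 \<and> V z \<le> 2 * V y}"
    unfolding steers_def by blast
  then obtain dur nxt ctl trj where "\<forall>y. y \<noteq> 0 \<longrightarrow> dur y \<ge> w \<and> V (nxt y) \<le> V y / 2 \<and>
      tame_control (ctl y) \<and> control_arc f g 0 (dur y) (ctl y) (trj y) \<and> trj y 0 = y \<and> trj y (dur y) = nxt y \<and>
      trj y ` {0..dur y} \<subseteq> {z. z \<noteq> 0 \<and> V z \<le> 2 * V y}"
    unfolding choice_iff by blast
  note step = this[rule_format]
  define Y where "Y n = (nxt ^^ n) y" for n
  have Y0: "Y 0 = y" and YS: "Y (Suc n) = nxt (Y n)" for n by (simp_all add: Y_def)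
  have Ynz: "Y n \<noteq> 0" for n
  proof (induction n)
    case (Suc n)
    have "dur (Y n) \<in> {0..dur (Y n)}" using step[OF Suc] w by auto
    then have "trj (Y n) (dur (Y n)) \<noteq> 0" using step[OF Suc] by blast
    then show ?case using step[OF Suc] by (simp add: YS)
  qed (simp add: Y0 assms)
  note S = step[OF Ynz]
  define s where "s n = (\<Sum>i<n. dur (Y i))" for n
  have s0: "s 0 = 0" and sS: "s (Suc n) = s n + dur (Y n)" for n by (simp_all add: s_def)
  have less: "s n < s (Suc n)" for n using S[of n] w by (simp add: sS)
  have "s n \<ge> real n * w" for n
  proof (induction n)
    case (Suc n)
    then show ?case using S[of n] by (simp add: sS algebra_simps)
  qed (simp add: s0)
  moreover have "filterlim (\<lambda>n. real n * w) at_top sequentially"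
    using w by (simp add: filterlim_at_top_mult_tendsto_pos[OF tendsto_const] filterlim_real_sequentially)
  ultimately have "filterlim s at_top sequentially"
    using filterlim_at_top_mono[of _ sequentially s] by simp
  then have samp: "sampling_times s"
    unfolding sampling_times_def using s0 less by (simp add: strict_mono_Suc_iff)
  note idx = sample_index_eq[OF samp]
  have mono: "s m \<le> s n" if "m \<le> n" for m n
    using samp that by (simp add: sampling_times_def strict_mono_less_eq)
  define u where "u t = ctl (Y (sample_index s t)) (t - s (sample_index s t))" for t
  define z where "z t = trj (Y (sample_index s t)) (t - s (sample_index s t))" for t
  have "tame_control (\<lambda>t. ctl (Y n) (t - s n))" for n
    using S by (intro tame_control_shift) blast
  then have "tame_control u"
    unfolding u_def[abs_def] using tame_control_glue[OF samp, of "\<lambda>n t. ctl (Y n) (t - s n)"] by blast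
  moreover have zn: "z t = trj (Y n) (t - s n)" if "t \<in> {s n..s (Suc n)}" for n t
  proof (cases "t = s (Suc n)")
    case True
    then have "sample_index s t = Suc n" using idx[of "Suc n" t] less by auto
    then have "z t = Y (Suc n)" using S[of "Suc n"] True by (simp add: z_def)
    then show ?thesis using S[of n] True by (simp add: sS YS)
  next
    case False
    then have "sample_index s t = n" using idx[of n t] that by auto
    then show ?thesis by (simp add: z_def)
  qed
  have un: "u t = ctl (Y n) (t - s n)" if "t \<in> {s n<..<s (Suc n)}" for n t
    using idx[of n t] that by (simp add: u_def)
  have piece: "control_arc f g (s n) (s (Suc n)) u z" for n
  proof -
    have "control_arc f g 0 (dur (Y n)) (ctl (Y n)) (trj (Y n))" using S[of n] by blast
    from control_arc_shift[OF this, of "s n"]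
    have "control_arc f g (s n) (s (Suc n)) (\<lambda>t. ctl (Y n) (t - s n)) (\<lambda>t. trj (Y n) (t - s n))"
      by (simp add: sS add.commute)
    then show ?thesis by (rule control_arc_cong) (simp_all add: un zn)
  qed
  have upto: "control_arc f g 0 (s n) u z" for n
  proof (induction n)
    case 0
    show ?case by (auto simp: s0 control_arc_def intro: exI[of _ "{}"])
  next
    case (Suc n)
    show ?case by (rule control_arc_join[OF Suc piece]) (use mono[of 0 n] s0 less[of n] in auto)
  qed
  have "control_arc f g 0 b u z" for b
  proof (cases "b \<ge> 0")
    case True
    obtain n where "b < s (Suc n)" using sampling_interval_exists[OF samp True] by blast
    then show ?thesis using control_arc_subinterval[OF upto[of "Suc n"]] by simp
  qed (auto simp: control_arc_def intro: exI[of _ "{}"])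
  moreover have "z 0 = y" using zn[of 0 0] S[of 0] less[of 0] by (simp add: s0 Y0)
  moreover have Vn: "V (Y n) \<le> V y / 2 ^ n" for n
  proof (induction n)
    case (Suc n)
    then show ?case using S[of n] by (simp add: YS)
  qed (simp add: Y0)
  have path: "z t \<noteq> 0 \<and> V (z t) \<le> 2 * (V y / 2 ^ n)" if t: "t \<ge> s n" for t n
  proof -
    obtain k where "n \<le> k" and k: "s k \<le> t" "t < s (Suc k)"
      using sampling_interval_after[OF samp t] by blast
    have "t - s k \<in> {0..dur (Y k)}" using k by (simp add: sS)
    then have "trj (Y k) (t - s k) \<in> {z. z \<noteq> 0 \<and> V z \<le> 2 * V (Y k)}" using S[of k] by blast
    then have "z t \<noteq> 0 \<and> V (z t) \<le> 2 * V (Y k)" using k by (simp add: zn[of t k])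
    moreover have "V y / 2 ^ k \<le> V y / 2 ^ n"
      using \<open>n \<le> k\<close> V_nonneg by (intro divide_left_mono) auto
    ultimately show ?thesis using Vn[of k] by linarith
  qed
  have "z t \<noteq> 0 \<and> V (z t) \<le> 2 * V y" if "t \<ge> 0" for t
    using path[of 0 t] that by (simp add: s0)
  moreover have "(z \<longlongrightarrow> 0) at_top"
    unfolding tendsto_iff
  proof (intro allI impI)
    fix e :: real assume "e > 0"
    then obtain \<eta> where \<eta>: "\<eta> > 0" "\<And>x. V x < \<eta> \<Longrightarrow> norm x < e" using norm_small_if_V_small by blast
    obtain n where n: "2 * V y / \<eta> < 2 ^ n" using real_arch_pow[of 2 "2 * V y / \<eta>"] by auto
    have "\<forall>t\<ge>s n. dist (z t) 0 < e"
    proof (intro allI impI)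
      fix t assume "t \<ge> s n"
      then have "V (z t) \<le> 2 * (V y / 2 ^ n)" using path by blast
      also have "\<dots> < \<eta>" using n \<eta>(1) by (simp add: field_simps)
      finally show "dist (z t) 0 < e" using \<eta>(2) by simp
    qed
    then show "\<forall>\<^sub>F t in at_top. dist (z t) 0 < e"
      using eventually_at_top_linorder by blast
  qed
  ultimately show ?thesis by blast
qed

end


section \<open>Sampled-data feedback from open-loop plans\<close>

text \<open>A well-order, reduced to the two properties by which plans are ranked.\<close>

lemma least_element_relation:
  obtains r :: "'b rel" where "antisym r" "\<And>Q. Q \<noteq> {} \<Longrightarrow> \<exists>p\<in>Q. \<forall>q\<in>Q. (p, q) \<in> r"
proof -
  obtain r :: "'b rel" where r: "well_order_on UNIV r"
    using well_order_on by blast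
  have "\<exists>p\<in>Q. \<forall>q\<in>Q. (p, q) \<in> r" if Q: "Q \<noteq> {}" for Q
  proof -
    have "wf (r - Id)" using r by (simp add: well_order_on_def)
    then obtain p where p: "p \<in> Q" "\<And>q. (q, p) \<in> r - Id \<Longrightarrow> q \<notin> Q"
      using Q by (metis wfE_min ex_in_conv)
    have "(p, q) \<in> r" if "q \<in> Q" for q
    proof (cases "p = q")
      case True
      then show ?thesis
        using r by (simp add: well_order_on_def linear_order_on_def partial_order_on_def preorder_on_def refl_on_def)
    next
      case False
      then have "(p, q) \<in> r \<or> (q, p) \<in> r"
        using r by (auto simp: well_order_on_def linear_order_on_def total_on_def)
      then show ?thesis using p(2)[of q] that False by auto
    qed
    then show ?thesis using p(1) by blast
  qed
  moreover have "antisym r"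
    using r by (simp add: well_order_on_def linear_order_on_def partial_order_on_def)
  ultimately show ?thesis using that by blast
qed

lemma small_fraction:
  assumes "\<eta> > 0"
  shows "\<exists>n\<ge>1. 2 / real n < \<eta>"
proof -
  obtain n where n: "2 / \<eta> < real n" using reals_Archimedean2 by blast
  moreover have "2 / \<eta> > 0" using assms by simp
  ultimately have "real n > 0" by linarith
  moreover have "2 < real n * \<eta>" using n assms by (simp add: pos_divide_less_eq)
  ultimately have "2 / real n < \<eta>" by (simp add: pos_divide_less_eq mult.commute)
  moreover have "n \<ge> 1" using \<open>real n > 0\<close> by simp
  ultimately show ?thesis by blast
qed

context descent_system
begin

abbreviation dynamics :: "'a \<Rightarrow> real \<Rightarrow> 'a"
  where "dynamics \<equiv> \<lambda>x u. f x + u *\<^sub>R g x"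

lemma sampled_trajectoryI:
  assumes "\<And>y. tame_control (\<lambda>t. k t y)"
    and "\<And>i. control_arc f g (T i) (T (Suc i)) (\<lambda>t. k t (x (T i))) x"
  shows "sampled_trajectory dynamics k T x"
  unfolding sampled_trajectory_def
  using control_arc_integral[OF smooth_f smooth_g assms(1) assms(2)] by blast

text \<open>Between two sampling times the feedback is open-loop, so the closed-loop trajectory is determined by the
sampled state.\<close>

lemma sampled_trajectory_eq_arc:
  assumes "\<And>y. tame_control (\<lambda>t. k t y)" and x: "sampled_trajectory dynamics k T x"
    and arc: "control_arc f g (T i) (T (Suc i)) (\<lambda>t. k t (x (T i))) z" "z (T i) = x (T i)"
    and t: "t \<in> {T i..T (Suc i)}"
  shows "x t = z t"
proof -
  obtain B where B: "\<And>t. \<bar>t\<bar> \<le> max \<bar>T i\<bar> \<bar>T (Suc i)\<bar> \<Longrightarrow> \<bar>k t (x (T i))\<bar> \<le> B"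
    using assms(1)[of "x (T i)"] unfolding tame_control_def by blast
  show ?thesis
  proof (rule controlled_trajectory_unique[OF smooth_f smooth_g _ _ _ t])
    show "\<bar>k s (x (T i))\<bar> \<le> B" if "s \<in> {T i..T (Suc i)}" for s
      using that by (intro B) auto
    show "(\<lambda>s. f (x s) + k s (x (T i)) *\<^sub>R g (x s)) integrable_on {T i..s} \<and>
      x s = x (T i) + integral {T i..s} (\<lambda>s. f (x s) + k s (x (T i)) *\<^sub>R g (x s))" if "s \<in> {T i..T (Suc i)}" for s
      using x that unfolding sampled_trajectory_def by (auto intro: absolutely_integrable_on_def[THEN iffD1, THEN conjunct1])
    show "(\<lambda>s. f (z s) + k s (x (T i)) *\<^sub>R g (z s)) integrable_on {T i..s} \<and>
      z s = x (T i) + integral {T i..s} (\<lambda>s. f (z s) + k s (x (T i)) *\<^sub>R g (z s))" if "s \<in> {T i..T (Suc i)}" for s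
      using control_arc_integral[OF smooth_f smooth_g assms(1) arc(1) that] arc(2)
      by (auto intro: absolutely_integrable_on_def[THEN iffD1, THEN conjunct1])
  qed
qed

definition is_plan :: "'a \<Rightarrow> (real \<Rightarrow> real) \<Rightarrow> (real \<Rightarrow> 'a) \<Rightarrow> bool"
  where "is_plan y u z \<longleftrightarrow> tame_control u \<and> (\<forall>b. control_arc f g 0 b u z) \<and> z 0 = y \<and>
    (\<forall>t\<ge>0. z t \<noteq> 0 \<and> V (z t) \<le> 2 * V y) \<and> (z \<longlongrightarrow> 0) at_top"

lemma plan_functions:
  obtains U Z where "\<And>y. y \<noteq> 0 \<Longrightarrow> is_plan y (U y) (Z y)"
proof -
  have "\<forall>y. \<exists>u z. y \<noteq> 0 \<longrightarrow> is_plan y u z"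
    using open_loop_plan unfolding is_plan_def by blast
  then obtain U Z where "\<forall>y. y \<noteq> 0 \<longrightarrow> is_plan y (U y) (Z y)"
    unfolding choice_iff by blast
  then show ?thesis using that by blast
qed

text \<open>The feedback may depend on the initial state, so it plays the plan of that state and ignores the samples; the
sampling period is constant.  Plans avoid the origin, so the sampled states are nonzero.\<close>

lemma weak_sampled_data_stabilizable: "SDF_WGAS dynamics"
proof -
  obtain U Z where UZ: "\<And>y. y \<noteq> 0 \<Longrightarrow> is_plan y (U y) (Z y)" using plan_functions by blast
  have stab: "\<exists>\<delta>>0. \<forall>y. y \<noteq> 0 \<and> norm y \<le> \<delta> \<longrightarrow> (\<forall>s\<ge>0. norm (Z y s) \<le> \<epsilon>)" if "\<epsilon> > 0" for \<epsilon>
  proof -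
    obtain \<eta> where \<eta>: "\<eta> > 0" "\<And>x. V x < \<eta> \<Longrightarrow> norm x < \<epsilon>"
      using norm_small_if_V_small[OF \<open>\<epsilon> > 0\<close>] by blast
    then have "\<eta> / 2 > 0" by simp
    from V_small_if_norm_small[OF this] obtain \<delta> where \<delta>: "\<delta> > 0" "\<And>x. norm x \<le> \<delta> \<Longrightarrow> V x < \<eta> / 2" by blast
    have "norm (Z y s) \<le> \<epsilon>" if "y \<noteq> 0" "norm y \<le> \<delta>" "s \<ge> 0" for y s
    proof -
      have "V (Z y s) \<le> 2 * V y" using UZ[OF that(1)] that(3) by (simp add: is_plan_def)
      then have "V (Z y s) < \<eta>" using \<delta>(2)[OF that(2)] by simp
      then show ?thesis using \<eta>(2) less_imp_le by blast
    qed
    then show ?thesis using \<delta>(1) by blast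
  qed
  show ?thesis
    unfolding SDF_WGAS_def Let_def
  proof (intro conjI allI impI, goal_cases)
    case 1
    show ?case by (simp add: f_0)
  next
    case \<tau>: (2 \<tau>)
    define k where "k s y x0 = (if x0 = 0 then 0 else U x0 s)" for s :: real and y x0 :: 'a
    define t where "t x0 n = real n * \<tau>" for x0 :: 'a and n
    have tame: "tame_control (\<lambda>s. k s y x0)" for y x0
      using UZ[of x0] by (cases "x0 = 0") (simp_all add: k_def tame_control_const is_plan_def)
    have arc: "control_arc f g (t x0 i) (t x0 (Suc i)) (\<lambda>s. k s y x0) (Z x0)" if "x0 \<noteq> 0" for x0 y i
      using UZ[OF that] \<tau> control_arc_subinterval[of f g 0 "t x0 (Suc i)" "U x0" "Z x0" "t x0 i" "t x0 (Suc i)"] that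
      by (simp add: k_def is_plan_def t_def)
    have samp: "sampling_times (t x0)" for x0
    proof -
      have "filterlim (\<lambda>n. real n * \<tau>) at_top sequentially"
        using \<tau> by (simp add: filterlim_at_top_mult_tendsto_pos[OF tendsto_const] filterlim_real_sequentially)
      then show ?thesis using \<tau> by (simp add: sampling_times_def t_def[abs_def] strict_mono_def)
    qed
    have eq: "x s = Z x0 s" if x: "x0 \<noteq> 0" "x 0 = x0" "sampled_trajectory dynamics (\<lambda>s y. k s y x0) (t x0) x"
      and s: "s \<ge> 0" for x0 x s
    proof -
      have sample: "x (t x0 i) = Z x0 (t x0 i)" for i
      proof (induction i)
        case 0
        then show ?case using x UZ[OF x(1)] by (simp add: t_def is_plan_def)
      next
        case (Suc i)
        show ?case
          by (rule sampled_trajectory_eq_arc[OF tame x(3) arc[OF x(1)] Suc[symmetric]])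
            (use \<tau> in \<open>simp add: t_def\<close>)
      qed
      obtain i where "t x0 i \<le> s" "s < t x0 (Suc i)" using sampling_interval_exists[OF samp s] by blast
      then show ?thesis
        by (intro sampled_trajectory_eq_arc[OF tame x(3) arc[OF x(1)] sample[symmetric]]) auto
    qed
    show ?case
    proof (intro exI[of _ "\<lambda>_. \<tau>"] exI[of _ k] exI[of _ t] conjI allI impI)
      show "admissible_input (\<lambda>t. k t x x0)" for x x0 by (rule tame_control_admissible[OF tame])
      show "sampling_times (t x0)" for x0 by (rule samp)
      show "\<exists>x. x0 \<noteq> 0 \<and> x 0 = x0 \<and> sampled_trajectory dynamics (\<lambda>s y. k s y x0) (t x0) x" if "x0 \<noteq> 0" for x0
      proof (intro exI[of _ "Z x0"] conjI that)
        show "Z x0 0 = x0" using UZ[OF that] by (simp add: is_plan_def)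
        show "sampled_trajectory dynamics (\<lambda>s y. k s y x0) (t x0) (Z x0)"
          by (rule sampled_trajectoryI) (rule tame arc[OF that])+
      qed
      fix x0 x i assume x: "x0 \<noteq> 0 \<and> x 0 = x0 \<and> sampled_trajectory dynamics (\<lambda>s y. k s y x0) (t x0) x"
      have "t x0 i \<ge> 0" using \<tau> by (simp add: t_def)
      then show "x (t x0 i) \<noteq> 0" using eq[of x0 x] UZ[of x0] x by (simp add: is_plan_def)
      show "t x0 (Suc i) - t x0 i = \<tau>" by (simp add: t_def algebra_simps)
    next
      fix \<epsilon> :: real assume "\<epsilon> > 0"
      from stab[OF this] obtain \<delta> where \<delta>: "\<delta> > 0" "\<And>y s. y \<noteq> 0 \<Longrightarrow> norm y \<le> \<delta> \<Longrightarrow> s \<ge> 0 \<Longrightarrow> norm (Z y s) \<le> \<epsilon>" by blast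
      show "\<exists>\<delta>>0. \<forall>x0 x. (x0 \<noteq> 0 \<and> x 0 = x0 \<and> sampled_trajectory dynamics (\<lambda>s y. k s y x0) (t x0) x) \<and> norm (x 0) \<le> \<delta> \<longrightarrow>
          (\<forall>s\<ge>0. norm (x s) \<le> \<epsilon>)"
      proof (intro exI[of _ \<delta>] conjI allI impI \<delta>(1))
        fix x0 x and s :: real
        assume x: "(x0 \<noteq> 0 \<and> x 0 = x0 \<and> sampled_trajectory dynamics (\<lambda>s y. k s y x0) (t x0) x) \<and> norm (x 0) \<le> \<delta>"
          and s: "s \<ge> 0"
        then have "x s = Z x0 s" by (intro eq) auto
        then show "norm (x s) \<le> \<epsilon>" using \<delta>(2)[of x0 s] x s by auto
      qed
    next
      fix x0 x assume x: "x0 \<noteq> 0 \<and> x 0 = x0 \<and> sampled_trajectory dynamics (\<lambda>s y. k s y x0) (t x0) x"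
      then have "(Z x0 \<longlongrightarrow> 0) at_top" using UZ by (simp add: is_plan_def)
      then show "(x \<longlongrightarrow> 0) at_top"
        by (rule Lim_transform_eventually)
          (use eq x in \<open>auto simp: eventually_at_top_linorder intro!: exI[of _ 0]\<close>)
    qed (use \<tau> in auto)
  qed
qed


text \<open>A discrete measure of how good a plan with initial state \<open>y\<close> is: \<open>V\<close> is at most \<open>2 V y\<close> along the plan.
Discreteness ensures that bounded increasing levels are eventually constant.\<close>

definition level :: "'a \<Rightarrow> nat"
  where "level y = nat \<lfloor>1 / V y\<rfloor>"

lemma level_geD:
  assumes "level y \<ge> n" "n \<ge> 1"
  shows "V y \<le> 1 / n"
proof (cases "V y > 0")
  case True
  have "int n \<le> \<lfloor>1 / V y\<rfloor>" using assms unfolding level_def by linarith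
  then have "real n \<le> 1 / V y" by (simp add: le_floor_iff)
  then show ?thesis using True assms(2) by (simp add: field_simps)
next
  case False
  then show ?thesis using V_nonneg[of y] by simp
qed

lemma level_geI: "y \<noteq> 0 \<Longrightarrow> V y \<le> 1 / n \<Longrightarrow> n \<ge> 1 \<Longrightarrow> level y \<ge> n"
  using V_pos[of y] unfolding level_def by (simp add: le_nat_iff le_floor_iff field_simps)

text \<open>Only finitely many levels occur among the plans that pass through a given nonzero state, so there is a
highest one.\<close>

lemma level_le_of_passing: "x \<noteq> 0 \<Longrightarrow> V x \<le> 2 * V y \<Longrightarrow> level y \<le> nat \<lfloor>2 / V x\<rfloor>"
  using V_pos[of x] unfolding level_def by (intro nat_mono floor_mono) (simp add: field_simps)

text \<open>A plan is a pair \<open>(j, y)\<close>: the open-loop trajectory that starts at time \<open>T j\<close> in the state \<open>y\<close>.  At time \<open>T i\<close>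
and in the state \<open>x \<noteq> 0\<close>, the feedback selects among the plans that pass through \<open>x\<close> one of the highest level
and, among these, the one that comes first in a fixed well-order of all plans.  The plan \<open>(i, x)\<close> itself is a
candidate, and a plan that is being followed remains one at the next sampling time.  The level is thus
nondecreasing along trajectories, which gives stability.  If it is unbounded, \<open>V\<close> tends to \<open>0\<close>.  Otherwise
it is eventually constant; then the plan can only move down in the well-order, so it is eventually constant
too, and the trajectory inherits the convergence of that plan.\<close>

lemma semiglobal_sampled_data_feedback:
  assumes samp: "sampling_times T"
  shows "\<exists>k. (\<forall>y. tame_control (\<lambda>t. k t y)) \<and>
    (\<forall>x0. \<exists>x. sampled_trajectory dynamics k T x \<and> x 0 = x0) \<and>
    (\<forall>\<epsilon>>0. \<exists>\<delta>>0. \<forall>x. sampled_trajectory dynamics k T x \<and> norm (x 0) \<le> \<delta> \<longrightarrow> (\<forall>t\<ge>0. norm (x t) \<le> \<epsilon>)) \<and>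
    (\<forall>x. sampled_trajectory dynamics k T x \<longrightarrow> (x \<longlongrightarrow> 0) at_top)"
proof -
  obtain U Z where UZ: "\<And>y. y \<noteq> 0 \<Longrightarrow> is_plan y (U y) (Z y)" using plan_functions by blast
  obtain r :: "(nat \<times> 'a) rel" where r: "antisym r" "\<And>Q. Q \<noteq> {} \<Longrightarrow> \<exists>p\<in>Q. \<forall>q\<in>Q. (p, q) \<in> r"
    using least_element_relation by blast
  have T0: "T 0 = 0" and less: "T i < T (Suc i)" for i
    using samp by (auto simp: sampling_times_def strict_mono_Suc_iff)
  have mono: "T i \<le> T j" if "i \<le> j" for i j
    using samp that by (simp add: sampling_times_def strict_mono_less_eq)
  note idx = sample_index_eq[OF samp]
  define avail where "avail i x = {(j, y). j \<le> i \<and> y \<noteq> 0 \<and> Z y (T i - T j) = x}" for i x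
  have avail_self: "(i, x) \<in> avail i x" if "x \<noteq> 0" for i x
    using UZ[OF that] that by (simp add: avail_def is_plan_def)
  have avail_V: "V x \<le> 2 * V (snd p)" if avail: "p \<in> avail i x" for i x p
  proof -
    obtain j y where p: "p = (j, y)" "j \<le> i" "y \<noteq> 0" "Z y (T i - T j) = x"
      using avail by (auto simp: avail_def)
    then show ?thesis using UZ[OF p(3)] mono[OF p(2)] unfolding is_plan_def by auto
  qed
  have "\<exists>p\<in>avail i x. \<forall>q\<in>avail i x. level (snd q) \<le> level (snd p) \<and>
      (level (snd q) = level (snd p) \<longrightarrow> (p, q) \<in> r)" if x: "x \<noteq> 0" for i x
  proof -
    define L where "L = Max ((\<lambda>p. level (snd p)) ` avail i x)"
    have "(\<lambda>p. level (snd p)) ` avail i x \<subseteq> {..nat \<lfloor>2 / V x\<rfloor>}"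
      using level_le_of_passing[OF x avail_V] by blast
    then have fin: "finite ((\<lambda>p. level (snd p)) ` avail i x)" by (rule finite_subset) simp
    have "L \<in> (\<lambda>p. level (snd p)) ` avail i x"
      unfolding L_def using fin avail_self[OF x] by (intro Max_in) auto
    then have "{p \<in> avail i x. level (snd p) = L} \<noteq> {}" by blast
    from r(2)[OF this] obtain p where p: "p \<in> avail i x" "level (snd p) = L"
      "\<And>q. q \<in> avail i x \<Longrightarrow> level (snd q) = L \<Longrightarrow> (p, q) \<in> r" by auto
    moreover have "level (snd q) \<le> L" if "q \<in> avail i x" for q
      unfolding L_def using fin that by (intro Max_ge) auto
    ultimately show ?thesis by blast
  qed
  then have "\<forall>i x. \<exists>p. x \<noteq> 0 \<longrightarrow> p \<in> avail i x \<and> (\<forall>q\<in>avail i x. level (snd q) \<le> level (snd p) \<and>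
      (level (snd q) = level (snd p) \<longrightarrow> (p, q) \<in> r))" by blast
  then obtain sel where sel: "\<forall>i x. x \<noteq> 0 \<longrightarrow> sel i x \<in> avail i x \<and> (\<forall>q\<in>avail i x. level (snd q) \<le> level (snd (sel i x)) \<and>
      (level (snd q) = level (snd (sel i x)) \<longrightarrow> (sel i x, q) \<in> r))"
    unfolding choice_iff by blast
  have sel_avail: "sel i x \<in> avail i x" if "x \<noteq> 0" for i x using sel that by blast
  have sel_max: "level (snd q) \<le> level (snd (sel i x))" if "x \<noteq> 0" "q \<in> avail i x" for i x q
    using sel that by blast
  have sel_least: "(sel i x, q) \<in> r" if "x \<noteq> 0" "q \<in> avail i x" "level (snd q) = level (snd (sel i x))" for i x q
    using sel that by blast
  have sel_nz: "snd (sel i x) \<noteq> 0" and sel_le: "fst (sel i x) \<le> i"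
    and sel_pass: "Z (snd (sel i x)) (T i - T (fst (sel i x))) = x" if "x \<noteq> 0" for i x
    using sel_avail[OF that, of i] by (auto simp: avail_def)
  note plan = UZ[OF sel_nz, unfolded is_plan_def]
  \<comment> \<open>at the origin the zero control keeps the state at rest\<close>
  define c where "c n x t = (if x = 0 then 0 else U (snd (sel n x)) (t - T (fst (sel n x))))" for n x t
  define k where "k t x = c (sample_index T t) x t" for t x
  define W where "W n x t = (if x = 0 then 0 else Z (snd (sel n x)) (t - T (fst (sel n x))))" for n x t
  let ?traj = "sampled_trajectory dynamics k T"
  have tame: "tame_control (\<lambda>t. k t x)" for x
  proof -
    have "tame_control (c n x)" for n
      using plan[of x n] by (cases "x = 0") (auto simp: c_def[abs_def] tame_control_const intro: tame_control_shift)
    then show ?thesis unfolding k_def by (rule tame_control_glue[OF samp])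
  qed
  have arc: "control_arc f g (T i) (T (Suc i)) (\<lambda>t. k t x) (W i x)" for i x
  proof (cases "x = 0")
    case True
    then show ?thesis
      by (auto simp: control_arc_def W_def[abs_def] k_def c_def f_0 intro!: exI[of _ "{}"])
  next
    case False
    define j y where "j = fst (sel i x)" and "y = snd (sel i x)"
    have "control_arc f g 0 (T (Suc i) - T j) (U y) (Z y)"
      using plan[OF False] unfolding y_def by blast
    from control_arc_shift[OF this, of "T j"]
    have "control_arc f g (T j) (T (Suc i)) (\<lambda>t. U y (t - T j)) (\<lambda>t. Z y (t - T j))" by simp
    then have "control_arc f g (T i) (T (Suc i)) (\<lambda>t. U y (t - T j)) (\<lambda>t. Z y (t - T j))"
      by (rule control_arc_subinterval) (use mono sel_le[OF False] in \<open>auto simp: j_def\<close>)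
    then show ?thesis
      by (rule control_arc_cong) (use False in \<open>auto simp: k_def c_def W_def j_def y_def idx[OF less_imp_le]\<close>)
  qed
  have W_start: "W i x (T i) = x" for i x
    using sel_pass[of x i] by (simp add: W_def)
  have W_0: "W i 0 t = 0" for i t by (simp add: W_def)
  have W_nz: "W i x t \<noteq> 0" and W_V: "V (W i x t) \<le> 2 * V (snd (sel i x))" if "x \<noteq> 0" "t \<ge> T i" for i x t
    using plan[OF that(1), of i] that mono[OF sel_le[OF that(1), of i]] by (auto simp: W_def)
  have follow: "x t = W i (x (T i)) t" if "?traj x" "t \<in> {T i..T (Suc i)}" for x t i
    by (rule sampled_trajectory_eq_arc[OF tame that(1) arc W_start that(2)])
  have ex: "\<exists>x. ?traj x \<and> x 0 = x0" for x0
  proof -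
    define X where "X = rec_nat x0 (\<lambda>i p. W i p (T (Suc i)))"
    have X0: "X 0 = x0" and XS: "X (Suc i) = W i (X i) (T (Suc i))" for i by (simp_all add: X_def)
    define x where "x t = W (sample_index T t) (X (sample_index T t)) t" for t
    have xT: "x (T i) = X i" for i
      using idx[of i "T i"] less by (simp add: x_def W_start)
    have xt: "W i (X i) t = x t" if "t \<in> {T i..T (Suc i)}" for i t
    proof (cases "t = T (Suc i)")
      case True
      then show ?thesis using xT[of "Suc i"] XS by simp
    next
      case False
      then show ?thesis using idx[of i t] that by (simp add: x_def)
    qed
    have "?traj x"
    proof (rule sampled_trajectoryI[OF tame])
      show "control_arc f g (T i) (T (Suc i)) (\<lambda>t. k t (x (T i))) x" for i
        unfolding xT by (rule control_arc_cong[OF arc]) (auto simp: xt)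
    qed
    moreover have "x 0 = x0" using xT[of 0] T0 X0 by simp
    ultimately show ?thesis by blast
  qed
  have zero: "x t = 0" if x: "?traj x" "x 0 = 0" and t: "t \<ge> 0" for x t
  proof -
    have "x (T i) = 0" for i
    proof (induction i)
      case 0
      show ?case using x(2) T0 by simp
    next
      case (Suc i)
      show ?case using follow[OF x(1), of "T (Suc i)" i] less[of i] by (simp add: Suc W_0)
    qed
    moreover obtain i where "T i \<le> t" "t < T (Suc i)" using sampling_interval_exists[OF samp t] by blast
    ultimately show ?thesis using follow[OF x(1), of t i] by (simp add: W_0)
  qed
  have nz: "x (T i) \<noteq> 0" if x: "?traj x" "x 0 \<noteq> 0" for x i
  proof (induction i)
    case 0
    show ?case using x(2) T0 by simp
  next
    case (Suc i)
    show ?case using follow[OF x(1), of "T (Suc i)" i] less[of i] W_nz[OF Suc, of i "T (Suc i)"] by simp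
  qed
  define P where "P x i = sel i (x (T i))" for x i
  have carried: "P x i \<in> avail (Suc i) (x (T (Suc i)))"
    if x: "?traj x" "x 0 \<noteq> 0" for x i
    using follow[OF x(1), of "T (Suc i)" i] less[of i] sel_le[OF nz[OF x], of i i] sel_nz[OF nz[OF x], of i i] nz[OF x, of i]
    by (auto simp: avail_def P_def W_def case_prod_beta)
  have lev_step: "level (snd (P x i)) \<le> level (snd (P x (Suc i)))"
    if x: "?traj x" "x 0 \<noteq> 0" for x i
    using sel_max[OF nz[OF x] carried[OF x]] by (simp add: P_def)
  have lev_mono: "level (snd (P x i)) \<le> level (snd (P x j))"
    if x: "?traj x" "x 0 \<noteq> 0" and "i \<le> j" for x i j
    by (rule lift_Suc_mono_le[of "\<lambda>i. level (snd (P x i))", OF lev_step[OF x] that(3)])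
  have V_le: "V (x t) \<le> 2 / n"
    if x: "?traj x" "x 0 \<noteq> 0" and n: "level (snd (P x i)) \<ge> n" "n \<ge> 1" and t: "t \<ge> T i" for x i n t
  proof -
    obtain j where "i \<le> j" and j: "T j \<le> t" "t < T (Suc j)"
      using sampling_interval_after[OF samp t] by blast
    have "V (snd (P x j)) \<le> 1 / n"
      using lev_mono[OF x \<open>i \<le> j\<close>] n by (intro level_geD) auto
    moreover have "V (x t) \<le> 2 * V (snd (P x j))"
      using follow[OF x(1), of t j] W_V[OF nz[OF x], of j t j] j by (simp add: P_def)
    ultimately show ?thesis by simp
  qed
  have stable: "\<exists>\<delta>>0. \<forall>x. ?traj x \<and> norm (x 0) \<le> \<delta> \<longrightarrow> (\<forall>t\<ge>0. norm (x t) \<le> \<epsilon>)"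
    if "\<epsilon> > 0" for \<epsilon>
  proof -
    obtain \<eta> where \<eta>: "\<eta> > 0" "\<And>x. V x < \<eta> \<Longrightarrow> norm x < \<epsilon>"
      using norm_small_if_V_small[OF \<open>\<epsilon> > 0\<close>] by blast
    obtain n where n: "n \<ge> 1" "2 / real n < \<eta>" using small_fraction[OF \<eta>(1)] by blast
    have "1 / real n > 0" using n by simp
    from V_small_if_norm_small[OF this] obtain \<delta> where \<delta>: "\<delta> > 0" "\<And>x. norm x \<le> \<delta> \<Longrightarrow> V x < 1 / n" by blast
    have "norm (x t) \<le> \<epsilon>" if x: "?traj x" "norm (x 0) \<le> \<delta>" and t: "t \<ge> 0" for x t
    proof (cases "x 0 = 0")
      case True
      then show ?thesis using zero[OF x(1) _ t] \<open>\<epsilon> > 0\<close> by simp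
    next
      case False
      have "level (x 0) \<ge> n" using False \<delta>(2)[OF x(2)] n(1) by (intro level_geI) auto
      also have "level (x 0) \<le> level (snd (P x 0))"
        using sel_max[OF False avail_self[OF False], of 0] T0 by (simp add: P_def)
      finally have "V (x t) \<le> 2 / n"
        using n(1) t T0 by (intro V_le[OF x(1) False, of n 0]) auto
      then show ?thesis using \<eta>(2) n(2) by (intro less_imp_le) auto
    qed
    then show ?thesis using \<delta>(1) by blast
  qed
  have attractive: "(x \<longlongrightarrow> 0) at_top" if x: "?traj x" for x
  proof (cases "x 0 = 0")
    case True
    show ?thesis
      by (rule tendsto_eventually)
        (use zero[OF x True] in \<open>auto simp: eventually_at_top_linorder\<close>)
  next
    case False
    note x = x False
    show ?thesis
    proof (cases "\<exists>B. \<forall>i. level (snd (P x i)) \<le> B")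
      case False
      show ?thesis
        unfolding tendsto_iff
      proof (intro allI impI)
        fix \<epsilon> :: real assume "\<epsilon> > 0"
        then obtain \<eta> where \<eta>: "\<eta> > 0" "\<And>x. V x < \<eta> \<Longrightarrow> norm x < \<epsilon>"
          using norm_small_if_V_small by blast
        obtain n where n: "n \<ge> 1" "2 / real n < \<eta>" using small_fraction[OF \<eta>(1)] by blast
        obtain i where i: "n \<le> level (snd (P x i))" using False by (meson nat_le_linear)
        have "\<forall>t\<ge>T i. dist (x t) 0 < \<epsilon>"
          using V_le[OF x i n(1)] n(2) \<eta>(2) by (auto intro: order.strict_trans1)
        then show "\<forall>\<^sub>F t in at_top. dist (x t) 0 < \<epsilon>"
          using eventually_at_top_linorder by blast
      qed
    next
      case True
      then have fin: "finite (range (\<lambda>i. level (snd (P x i))))"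
        by (auto intro: finite_subset[of _ "{.._}"])
      then have "Max (range (\<lambda>i. level (snd (P x i)))) \<in> range (\<lambda>i. level (snd (P x i)))"
        by (intro Max_in) auto
      then obtain I where I: "Max (range (\<lambda>i. level (snd (P x i)))) = level (snd (P x I))" by blast
      have const: "level (snd (P x i)) = level (snd (P x I))" if "i \<ge> I" for i
        using lev_mono[OF x that] Max_ge[OF fin, of "level (snd (P x i))"] I by auto
      obtain m where m: "m \<ge> I" "\<And>i. i \<ge> I \<Longrightarrow> (P x m, P x i) \<in> r"
        using r(2)[of "P x ` {I..}"] by auto
      have fixed: "P x i = P x m" if "i \<ge> m" for i
        using that
      proof (induction i rule: dec_induct)
        case (step i)
        have "level (snd (P x i)) = level (snd (P x (Suc i)))"
          using const[of i] const[of "Suc i"] step(1) m(1) by simp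
        then have "(P x (Suc i), P x m) \<in> r"
          using sel_least[OF nz[OF x] carried[OF x, of i]] step(3)
          by (simp add: P_def)
        moreover have "(P x m, P x (Suc i)) \<in> r" using m step(1) by simp
        ultimately show ?case using r(1) by (auto dest: antisymD)
      qed simp
      define j y where "j = fst (P x m)" and "y = snd (P x m)"
      have "x t = Z y (t - T j)" if t: "t \<ge> T m" for t
      proof -
        obtain i where "m \<le> i" and i: "T i \<le> t" "t < T (Suc i)"
          using sampling_interval_after[OF samp t] by blast
        from fixed[OF \<open>m \<le> i\<close>] have "sel i (x (T i)) = P x m" unfolding P_def .
        then show ?thesis
          using follow[OF x(1), of t i] i nz[OF x, of i] by (simp add: W_def j_def y_def)
      qed
      then have "\<forall>\<^sub>F t in at_top. Z y (t - T j) = x t"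
        unfolding eventually_at_top_linorder by (intro exI[of _ "T m"]) auto
      moreover have "((\<lambda>t. Z y (t - T j)) \<longlongrightarrow> 0) at_top"
      proof -
        have "(Z y \<longlongrightarrow> 0) at_top" using plan[OF nz[OF x], of m m] unfolding y_def P_def by blast
        moreover have "filterlim (\<lambda>t. t - T j) at_top at_top"
          using filterlim_tendsto_add_at_top[OF tendsto_const filterlim_ident, of "- T j"] by simp
        ultimately show ?thesis by (rule filterlim_compose)
      qed
      ultimately show ?thesis by (rule Lim_transform_eventually[rotated])
    qed
  qed
  show ?thesis using tame ex stable attractive by blast
qed

lemma semiglobal_sampled_data_stabilizable: "SDF_SGAS dynamics"
  unfolding SDF_SGAS_def Let_def
proof (intro conjI allI impI, goal_cases)
  case 1
  show ?case by (simp add: f_0)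
next
  case (2 R T)
  from semiglobal_sampled_data_feedback[OF this(2)] obtain k where k: "\<And>y. tame_control (\<lambda>t. k t y)"
    "\<forall>x0. \<exists>x. sampled_trajectory dynamics k T x \<and> x 0 = x0"
    "\<forall>\<epsilon>>0. \<exists>\<delta>>0. \<forall>x. sampled_trajectory dynamics k T x \<and> norm (x 0) \<le> \<delta> \<longrightarrow> (\<forall>t\<ge>0. norm (x t) \<le> \<epsilon>)"
    "\<forall>x. sampled_trajectory dynamics k T x \<longrightarrow> (x \<longlongrightarrow> 0) at_top"
    by (elim exE conjE) blast
  show ?case
    using k(2-4) tame_control_admissible[OF k(1)]
    by (intro exI[of _ UNIV] exI[of _ k]) simp
qed

end

theorem proposition3:
  fixes f g :: "real ^ 'n \<Rightarrow> real ^ 'n"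
    and V :: "real ^ 'n \<Rightarrow> real"
  assumes "smooth f" and "smooth g" and "f 0 = 0"
    and "smooth V" and "positive_definite V" and "proper_function V"
    and "\<And>x. x \<noteq> 0 \<Longrightarrow>
      lie_derivative g V x \<noteq> 0 \<or>
      (lie_derivative g V x = 0 \<and> lie_derivative f V x < 0) \<or>
      (\<exists>N\<ge>1.
        lie_derivative g V x = 0 \<and>
        (\<forall>i\<in>{1..N}. (lie_derivative f ^^ i) V x = 0) \<and>
        (\<forall>\<Delta>s. \<Delta>s \<noteq> [] \<and> set \<Delta>s \<subseteq> (lie_algebra f g - {0}) - {g} \<and>
            (\<Sum>\<Delta>\<leftarrow>\<Delta>s. lie_order f g \<Delta>) \<le> N \<longrightarrow>
          foldr lie_derivative \<Delta>s V x = 0) \<and>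
        ((lie_derivative f ^^ (N + 1)) V x < 0 \<or>
         (odd N \<and> lie_derivative (iterated_bracket N f g) V x \<noteq> 0) \<or>
         (even N \<and> lie_derivative (iterated_bracket N f g) V x < 0) \<or>
         ((lie_derivative f ^^ (N + 1)) V x = 0 \<and>
          lie_derivative (iterated_bracket N g f) V x \<noteq> 0)))"
  shows "SDF_SGAS (\<lambda>x (u::real). f x + u *\<^sub>R g x) \<and>
         SDF_WGAS (\<lambda>x (u::real). f x + u *\<^sub>R g x)"
proof -
  interpret descent_system f g V
  proof
    show "continuous_on UNIV V" by (rule smooth_continuous_on) fact
    fix x :: "real ^ 'n" assume "x \<noteq> 0"
    note alternatives = assms(7)[OF this]
    have "V x > 0" using assms(5) \<open>x \<noteq> 0\<close> by (simp add: positive_definite_def)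
    show "\<exists>\<delta>>0. \<exists>T\<ge>0. \<forall>y\<in>ball x \<delta>. descent_step f g V \<delta> T y"
    proof (rule descent_pair[OF assms(1,2,4) alternatives])
      fix \<alpha> u1 u2 :: real and m :: nat
      assume "\<alpha> \<ge> 0" "m \<ge> 1"
        and vanish: "\<And>j k. 0 < j + k \<Longrightarrow> j + k < m \<Longrightarrow>
          (lie_derivative (control_field f g u1) ^^ j) ((lie_derivative (control_field f g u2) ^^ k) V) x = 0"
        and neg: "two_piece_coefficient (control_field f g u1) (control_field f g u2) V m \<alpha> x < 0"
      show ?thesis
        by (rule local_descent[OF assms(1,2,4) \<open>V x > 0\<close> \<open>m \<ge> 1\<close> \<open>\<alpha> \<ge> 0\<close> vanish neg])
    qed
  qed fact+
  show ?thesis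
    using semiglobal_sampled_data_stabilizable weak_sampled_data_stabilizable by blast
qed

end
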